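(* Let $d\ge1$, let $\mathbb S^d$ be the unit sphere of $\mathbb R^{d+1}$ with geodesic distance $\rho(\xi,\eta)=\arccos\langle\xi,\eta\rangle$, and let $0<\alpha\le1$. Then the function $$\psi(\xi,\eta)=\rho(\xi,\eta)^\alpha,\qquad\xi,\eta\in\mathbb S^d,$$ is negative definite, and the associated Gaussian process has trajectories almost surely in $B^\gamma_{\infty,1}(\mathbb S^d)$ for every $0<\gamma<\frac\alpha2$.
   Context: A real function $\psi$ on $M\times M$ is negative definite if $\psi(x,y)=\psi(y,x)$, $\psi(x,x)=0$, and $\sum_{i,j=1}^n\alpha_i\alpha_j\psi(x_i,x_j)\le0$ for all $n$, all $x_1,\dots,x_n\in M$ and all real $\alpha_1,\dots,\alpha_n$ with $\sum_i\alpha_i=0$. The associated Gaussian process is the centered Gaussian process $(Z_\xi)_{\xi\in\mathbb S^d}$ whose covariance is the rotation-invariant positive definite kernel $K(\xi,\eta)=C-\frac12\rho(\xi,\eta)^\alpha$, where $C>0$ is a sufficiently large constant so that $K$ is positive definite; thus $\mathbb E(Z_\xi-Z_\eta)^2=\psi(\xi,\eta)$. As throughout, the trajectory regularity is understood for a suitable modification of the process. Besov spaces on $\mathbb S^d$ are those associated with $A=-\Delta_{\mathbb S^d}$ (positive Laplace–Beltrami operator), with eigenvalues $k(k+d-1)$, $k\ge0$, and eigenspaces the spherical harmonics of degree $k$, with orthogonal projectors $\mathrm{Proj}_k$; $\mu$ is the Riemannian measure. Let $\Phi\in C^\infty(\mathbb R)$ be real, even, $\mathrm{supp}\,\Phi\subset[-2,2]$,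 $0\le\Phi\le1$, $\Phi=1$ on $[0,1]$, $\Psi(\lambda):=\Phi(\lambda)-\Phi(2\lambda)$, $\Psi_0:=\Phi$, $\Psi_j(\lambda):=\Psi(2^{-j}\lambda)$ ($j\ge1$), and $\Psi_j(\sqrt A)f=\sum_k\Psi_j(\sqrt{k(k+d-1)})\,\mathrm{Proj}_kf$. For $s>0$, a continuous $f$ on $\mathbb S^d$ belongs to $B^s_{\infty,1}$ iff $\sum_{j\ge0}2^{js}\|\Psi_j(\sqrt A)f\|_\infty<\infty$ (equivalent to the definition by real interpolation between $C(\mathbb S^d)$ and $\{f:\|f\|_\infty+\|A^{k/2}f\|_\infty<\infty\}$, $k>s$). *)

theory Defs
  imports "HOL-Probability.Probability"
begin

section \<open>Negative and positive definite functions\<close>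

definition negative_definite_on :: "'a set \<Rightarrow> ('a \<Rightarrow> 'a \<Rightarrow> real) \<Rightarrow> bool" where
  "negative_definite_on S \<psi> \<longleftrightarrow>
     (\<forall>x\<in>S. \<forall>y\<in>S. \<psi> x y = \<psi> y x) \<and>
     (\<forall>x\<in>S. \<psi> x x = 0) \<and>
     (\<forall>(n::nat) (x::nat \<Rightarrow> 'a) (a::nat \<Rightarrow> real).
        (\<forall>i<n. x i \<in> S) \<longrightarrow> (\<Sum>i<n. a i) = 0 \<longrightarrow>
        (\<Sum>i<n. \<Sum>j<n. a i * a j * \<psi> (x i) (x j)) \<le> 0)"

definition positive_definite_on :: "'a set \<Rightarrow> ('a \<Rightarrow> 'a \<Rightarrow> real) \<Rightarrow> bool" where
  "positive_definite_on S K \<longleftrightarrow>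
     (\<forall>x\<in>S. \<forall>y\<in>S. K x y = K y x) \<and>
     (\<forall>(n::nat) (x::nat \<Rightarrow> 'a) (a::nat \<Rightarrow> real).
        (\<forall>i<n. x i \<in> S) \<longrightarrow>
        (\<Sum>i<n. \<Sum>j<n. a i * a j * K (x i) (x j)) \<ge> 0)"


section \<open>Gaussian processes\<close>

text \<open>Constants count as (degenerate) Gaussian variables; the library's normal density
  covers only positive standard deviations.\<close>

definition gaussian_variable :: "'w measure \<Rightarrow> ('w \<Rightarrow> real) \<Rightarrow> bool" where
  "gaussian_variable M X \<longleftrightarrow>
     X \<in> borel_measurable M \<and>
     ((\<exists>m \<sigma>. \<sigma> > 0 \<and> distributed M lborel X (\<lambda>x. ennreal (normal_density m \<sigma> x))) \<or>
      (\<exists>m. AE w in M. X w = m))"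

text \<open>All finite linear combinations are Gaussian, so all second moments below exist; since
  the means vanish, the covariance is the expectation of the product.\<close>

definition centered_gaussian_process ::
    "'w measure \<Rightarrow> 'a set \<Rightarrow> ('a \<Rightarrow> 'w \<Rightarrow> real) \<Rightarrow> ('a \<Rightarrow> 'a \<Rightarrow> real) \<Rightarrow> bool" where
  "centered_gaussian_process M S Z K \<longleftrightarrow>
     prob_space M \<and>
     (\<forall>(n::nat) (x::nat \<Rightarrow> 'a) (a::nat \<Rightarrow> real). (\<forall>i<n. x i \<in> S) \<longrightarrow>
        gaussian_variable M (\<lambda>w. \<Sum>i<n. a i * Z (x i) w)) \<and>
     (\<forall>x\<in>S. (LINT w|M. Z x w) = 0) \<and>
     (\<forall>x\<in>S. \<forall>y\<in>S. (LINT w|M. Z x w * Z y w) = K x y)"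

definition modification_on ::
    "'w measure \<Rightarrow> 'a set \<Rightarrow> ('a \<Rightarrow> 'w \<Rightarrow> real) \<Rightarrow> ('a \<Rightarrow> 'w \<Rightarrow> real) \<Rightarrow> bool" where
  "modification_on M S Z Z' \<longleftrightarrow>
     (\<forall>x\<in>S. Z' x \<in> borel_measurable M \<and> (AE w in M. Z' x w = Z x w))"


section \<open>The sphere and spherical harmonics\<close>

definition geodist :: "'a::euclidean_space \<Rightarrow> 'a \<Rightarrow> real" where
  "geodist x y = arccos (x \<bullet> y)"

text \<open>The Riemannian measure of the unit sphere in dimension \<open>D\<close>: the measure of a Borel set \<open>E\<close>
  of the sphere is \<open>D\<close> times the volume of the cone over \<open>E\<close> in the unit ball (integration in
  polar coordinates).  Its underlying space is the sphere, so measurability and integrals of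
  functions do not depend on values off the sphere.\<close>

definition sphere_measure :: "'a::euclidean_space measure" where
  "sphere_measure =
     scale_measure (ennreal (real DIM('a)))
       (distr (restrict_space lborel (ball 0 1 - {0})) (restrict_space borel (sphere 0 1)) sgn)"

definition laplacian :: "('a::euclidean_space \<Rightarrow> real) \<Rightarrow> 'a \<Rightarrow> real" where
  "laplacian p x = (\<Sum>b\<in>Basis. (deriv ^^ 2) (\<lambda>t::real. p (x + t *\<^sub>R b)) 0)"

definition homogeneous_harmonic_polynomials :: "nat \<Rightarrow> ('a::euclidean_space \<Rightarrow> real) set" where
  "homogeneous_harmonic_polynomials k =
     {p. real_polynomial_function p \<and>
         (\<forall>c x. p (c *\<^sub>R x) = c ^ k * p x) \<and>
         (\<forall>x. laplacian p x = 0)}"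

definition spherical_harmonics :: "nat \<Rightarrow> ('a::euclidean_space \<Rightarrow> real) set" where
  "spherical_harmonics k = (\<lambda>p. restrict p (sphere 0 1)) ` homogeneous_harmonic_polynomials k"

text \<open>Orthogonal projection in \<open>L\<^sup>2\<close> of the sphere onto the spherical harmonics of degree \<open>k\<close>.\<close>

definition harmonic_proj :: "nat \<Rightarrow> ('a::euclidean_space \<Rightarrow> real) \<Rightarrow> 'a \<Rightarrow> real" where
  "harmonic_proj k f =
     (THE g. g \<in> spherical_harmonics k \<and>
        (\<forall>h\<in>spherical_harmonics k. (LINT x|sphere_measure. (f x - g x) * h x) = 0))"

text \<open>The eigenvalue \<open>k (k + d - 1)\<close> of the positive Laplace--Beltrami operator, where the
  ambient space has dimension \<open>d + 1\<close>.\<close>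

definition sphere_eigenvalue :: "'a::euclidean_space itself \<Rightarrow> nat \<Rightarrow> real" where
  "sphere_eigenvalue _ k = real k * (real k + (real DIM('a) - 1) - 1)"


section \<open>Besov spaces on the sphere\<close>

definition smooth_cutoff :: "(real \<Rightarrow> real) \<Rightarrow> bool" where
  "smooth_cutoff \<Phi> \<longleftrightarrow>
     (\<forall>n x. (deriv ^^ n) \<Phi> field_differentiable at x) \<and>
     (\<forall>x. \<Phi> (- x) = \<Phi> x) \<and>
     closure {x. \<Phi> x \<noteq> 0} \<subseteq> {-2..2} \<and>
     (\<forall>x. 0 \<le> \<Phi> x \<and> \<Phi> x \<le> 1) \<and>
     (\<forall>x\<in>{0..1}. \<Phi> x = 1)"

definition dyadic_cutoff :: "(real \<Rightarrow> real) \<Rightarrow> nat \<Rightarrow> real \<Rightarrow> real" where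
  "dyadic_cutoff \<Phi> j r =
     (if j = 0 then \<Phi> r else \<Phi> (r / 2 ^ j) - \<Phi> (2 * (r / 2 ^ j)))"

text \<open>Only finitely many terms of the series are nonzero because the cutoff has compact support.\<close>

definition littlewood_paley ::
    "(real \<Rightarrow> real) \<Rightarrow> nat \<Rightarrow> ('a::euclidean_space \<Rightarrow> real) \<Rightarrow> 'a \<Rightarrow> real" where
  "littlewood_paley \<Phi> j f x =
     (\<Sum>k. dyadic_cutoff \<Phi> j (sqrt (sphere_eigenvalue TYPE('a) k)) * harmonic_proj k f x)"

definition sphere_sup_norm :: "('a::euclidean_space \<Rightarrow> real) \<Rightarrow> real" where
  "sphere_sup_norm g = (SUP x\<in>sphere 0 1. \<bar>g x\<bar>)"

definition besov_inf_1 :: "(real \<Rightarrow> real) \<Rightarrow> real \<Rightarrow> ('a::euclidean_space \<Rightarrow> real) set" where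
  "besov_inf_1 \<Phi> s =
     {f. continuous_on (sphere 0 1) f \<and>
         summable (\<lambda>j. 2 powr (real j * s) * sphere_sup_norm (littlewood_paley \<Phi> j f))}"

end

theory Submission
  imports Defs
begin

text \<open>The kernel part rests on the identity \<open>\<rho>(x, y) = \<pi>/2 - arcsin \<langle>x, y\<rangle>\<close>.  Both \<open>arcsin t\<close> and, because
  \<open>0 < \<alpha> \<le> 1\<close>, \<open>1 - (1 - t)\<^sup>\<alpha>\<close> are power series with nonnegative coefficients, so by Schur's product
  theorem \<open>(\<pi>/2)\<^sup>\<alpha> - \<rho>\<^sup>\<alpha>\<close> is positive definite (\<open>pd_multiplier_one_minus_power_geodist\<close>).  This gives
  the positive definiteness of \<open>C - \<rho>\<^sup>\<alpha>/2\<close> for large \<open>C\<close> and the negative definiteness of \<open>\<rho>\<^sup>\<alpha>\<close>.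

  For the regularity, let \<open>P\<^sub>j\<close> be the Littlewood--Paley projection at frequency \<open>2\<^sup>j\<close>.  The crucial estimate is
  \<open>E (P\<^sub>j Z (x))\<^sup>2 \<le> c 2\<^bsup>-j\<alpha>\<^esup>\<close> (\<open>block_variance_bound\<close>).  Rotation invariance makes the left side
  independent of \<open>x\<close>, so it suffices to bound its mean over the sphere, that is, the expected energy
  \<open>E \<parallel>P\<^sub>j Z\<parallel>\<^sup>2\<close> in \<open>L\<^sup>2\<close>.  The generators of the rotations of the coordinate planes have the
  Laplace--Beltrami operator as their sum of squares (\<open>harmonic_casimir\<close>); hence a spherical harmonic \<open>h\<close> of
  eigenvalue \<open>\<lambda>\<close> satisfies \<open>\<theta>\<^sup>2 \<lambda> \<parallel>h\<parallel>\<^sup>2 \<le> \<Sum> \<parallel>h \<circ> R - h\<parallel>\<^sup>2\<close>, the sum over the rotations \<open>R\<close> by the angle \<open>\<theta>\<close>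
  in the coordinate planes, as long as \<open>\<theta>\<^sup>2 \<lambda> \<le> 1\<close> (\<open>harmonic_rotation_gap\<close>).  With \<open>\<theta> = 2\<^bsup>-(j+1)\<^esup>\<close>, comparable to
  the inverse frequency, \<open>\<parallel>P\<^sub>j f\<parallel>\<^sup>2\<close> is at most a constant times \<open>\<Sum> \<parallel>f \<circ> R - f\<parallel>\<^sup>2\<close>
  (\<open>block_energy_bound\<close>), and for \<open>f = Z\<close> the expectation of each term is controlled by
  \<open>E (Z (R x) - Z x)\<^sup>2 = \<rho>(x, R x)\<^sup>\<alpha> \<le> \<theta>\<^sup>\<alpha>\<close>.

  From variances to suprema: \<open>P\<^sub>j Z\<close> is a polynomial of degree at most \<open>2\<^bsup>j+1\<^esup>\<close> on the sphere, and so is its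
  \<open>p\<close>-th power with degree \<open>p 2\<^bsup>j+1\<^esup>\<close>.  A polynomial of degree \<open>m\<close> in \<open>D\<close> variables is bounded by its
  \<open>L\<^sup>2\<close> norm times a constant multiple of \<open>(m + 1)\<^bsup>D/2\<^esup>\<close>
  (\<open>polys_sup_moment_bound\<close>), and the \<open>2p\<close>-th moments of Gaussian variables are governed by their variances.
  Together \<open>E sup \<bar>P\<^sub>j Z\<bar>\<^bsup>2p\<^esup> \<le> c 2\<^bsup>jD\<^esup> 2\<^bsup>-j\<alpha>p\<^esup>\<close>, and for \<open>\<tau> < \<alpha>/2\<close> and \<open>p\<close> large the series
  of the expectations of \<open>2\<^bsup>2pj\<tau>\<^esup> sup \<bar>P\<^sub>j Z\<bar>\<^bsup>2p\<^esup>\<close> converges.  Hence almost surely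
  \<open>sup \<bar>P\<^sub>j Z\<bar> \<le> B 2\<^bsup>-j\<tau>\<^esup>\<close> for all \<open>j \<ge> 1\<close> (\<open>AE_block_decay\<close>), which is summable against
  \<open>2\<^bsup>j\<gamma>\<^esup>\<close> for every \<open>\<gamma> < \<tau>\<close>.

  The trajectories themselves are constructed as uniform limits of interpolations of \<open>Z\<close> between the points of finer
  and finer nets (\<open>AE_approx_uniform\<close>).  The estimates above are carried out for these interpolations, which
  involve finitely many Gaussian variables each, and are then passed to the limit by Fatou's lemma.\<close>

section \<open>Kernels that multiply positive definite kernels\<close>

text \<open>Schur's product theorem says that every positive definite kernel has this property.  Taking closure under products
  as the definition makes powers and power series of kernels immediate, and the constant kernel \<open>1\<close> leads back to positive
  definiteness.\<close>

definition pd_multiplier :: "'a set \<Rightarrow> ('a \<Rightarrow> 'a \<Rightarrow> real) \<Rightarrow> bool" where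
  "pd_multiplier S G \<longleftrightarrow>
     (\<forall>K. positive_definite_on S K \<longrightarrow> positive_definite_on S (\<lambda>x y. K x y * G x y))"

lemma positive_definite_on_one: "positive_definite_on S (\<lambda>x y. 1)"
proof -
  have "(\<Sum>i<n. \<Sum>j<n. a i * a j * 1) = (\<Sum>i<n. a i)^2" for n and a :: "nat \<Rightarrow> real"
    by (simp add: power2_eq_square sum_product)
  then show ?thesis by (simp add: positive_definite_on_def)
qed

lemma pd_multiplier_imp_positive_definite:
  assumes "pd_multiplier S G" shows "positive_definite_on S G"
  using assms positive_definite_on_one[of S] by (force simp: pd_multiplier_def)

lemma pd_multiplier_const: "c \<ge> 0 \<Longrightarrow> pd_multiplier S (\<lambda>x y. c)"
proof -
  have "(\<Sum>i<n. \<Sum>j<n. a i * a j * (K (x i) (x j) * c)) = c * (\<Sum>i<n. \<Sum>j<n. a i * a j * K (x i) (x j))"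
    for n and a :: "nat \<Rightarrow> real" and K :: "'a \<Rightarrow> 'a \<Rightarrow> real" and x
    by (simp add: sum_distrib_left mult_ac)
  then show "c \<ge> 0 \<Longrightarrow> ?thesis"
    unfolding pd_multiplier_def positive_definite_on_def by simp
qed

lemma pd_multiplier_add:
  assumes "pd_multiplier S G" "pd_multiplier S H" shows "pd_multiplier S (\<lambda>x y. G x y + H x y)"
proof -
  have "(\<Sum>i<n. \<Sum>j<n. a i * a j * (K (x i) (x j) * (G (x i) (x j) + H (x i) (x j)))) =
     (\<Sum>i<n. \<Sum>j<n. a i * a j * (K (x i) (x j) * G (x i) (x j))) +
     (\<Sum>i<n. \<Sum>j<n. a i * a j * (K (x i) (x j) * H (x i) (x j)))"
    for n and a :: "nat \<Rightarrow> real" and K :: "'a \<Rightarrow> 'a \<Rightarrow> real" and x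
    by (simp add: algebra_simps sum.distrib)
  note sum_eq = this
  show ?thesis
    unfolding pd_multiplier_def
  proof (intro allI impI)
    fix K assume "positive_definite_on S K"
    then have "positive_definite_on S (\<lambda>x y. K x y * G x y)" "positive_definite_on S (\<lambda>x y. K x y * H x y)"
      using assms by (auto simp: pd_multiplier_def)
    then show "positive_definite_on S (\<lambda>x y. K x y * (G x y + H x y))"
      unfolding positive_definite_on_def sum_eq by (simp add: distrib_left add_nonneg_nonneg)
  qed
qed

lemma pd_multiplier_mult:
  assumes "pd_multiplier S G" "pd_multiplier S H" shows "pd_multiplier S (\<lambda>x y. G x y * H x y)"
  using assms unfolding pd_multiplier_def by (simp add: mult.assoc[symmetric])

lemma pd_multiplier_power: "pd_multiplier S G \<Longrightarrow> pd_multiplier S (\<lambda>x y. G x y ^ k)"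
proof (induction k)
  case 0
  show ?case using pd_multiplier_const[of 1 S] by simp
next
  case (Suc k)
  then show ?case using pd_multiplier_mult[of S G] by simp
qed

lemma pd_multiplier_lim:
  assumes "\<And>k. pd_multiplier S (G k)"
    and lim: "\<And>x y. x \<in> S \<Longrightarrow> y \<in> S \<Longrightarrow> (\<lambda>k. G k x y) \<longlonglongrightarrow> L x y"
  shows "pd_multiplier S L"
  unfolding pd_multiplier_def
proof (intro allI impI)
  fix K assume K: "positive_definite_on S K"
  have P: "positive_definite_on S (\<lambda>x y. K x y * G k x y)" for k
    using assms(1) K unfolding pd_multiplier_def by blast
  show "positive_definite_on S (\<lambda>x y. K x y * L x y)"
    unfolding positive_definite_on_def
  proof (intro conjI ballI allI impI)
    fix x y assume xy: "x \<in> S" "y \<in> S"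
    have "(\<lambda>k. K x y * G k x y) \<longlonglongrightarrow> K x y * L x y" "(\<lambda>k. K y x * G k y x) \<longlonglongrightarrow> K y x * L y x"
      using lim xy by (auto intro!: tendsto_intros)
    moreover have "(\<lambda>k. K x y * G k x y) = (\<lambda>k. K y x * G k y x)"
      using P xy unfolding positive_definite_on_def by blast
    ultimately show "K x y * L x y = K y x * L y x" using LIMSEQ_unique by metis
  next
    fix n :: nat and x and a :: "nat \<Rightarrow> real" assume x: "\<forall>i<n. x i \<in> S"
    have "(\<lambda>k. \<Sum>i<n. \<Sum>j<n. a i * a j * (K (x i) (x j) * G k (x i) (x j)))
        \<longlonglongrightarrow> (\<Sum>i<n. \<Sum>j<n. a i * a j * (K (x i) (x j) * L (x i) (x j)))"
      using lim x by (intro tendsto_intros) auto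
    then show "0 \<le> (\<Sum>i<n. \<Sum>j<n. a i * a j * (K (x i) (x j) * L (x i) (x j)))"
      by (rule LIMSEQ_le_const) (use P x in \<open>auto simp: positive_definite_on_def\<close>)
  qed
qed

lemma pd_multiplier_power_series:
  assumes G: "pd_multiplier S G" and c: "\<And>k. c k \<ge> 0"
    and sums: "\<And>x y. x \<in> S \<Longrightarrow> y \<in> S \<Longrightarrow> (\<lambda>k. c k * G x y ^ k) sums L x y"
  shows "pd_multiplier S L"
proof (rule pd_multiplier_lim)
  show "pd_multiplier S (\<lambda>x y. \<Sum>k<n. c k * G x y ^ k)" for n
  proof (induction n)
    case 0
    show ?case using pd_multiplier_const[of 0 S] by simp
  next
    case (Suc n)
    then show ?case
      using pd_multiplier_add[OF Suc pd_multiplier_mult[OF pd_multiplier_const[OF c] pd_multiplier_power[OF G]]]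
      by simp
  qed
  show "(\<lambda>n. \<Sum>k<n. c k * G x y ^ k) \<longlonglongrightarrow> L x y" if "x \<in> S" "y \<in> S" for x y
    using sums[OF that] unfolding sums_def .
qed

text \<open>The inner product is a sum over coordinates of the kernels \<open>(x \<bullet> b) (y \<bullet> b)\<close>, and a factor of this
  product form is absorbed into the weights.\<close>

lemma pd_multiplier_inner: "pd_multiplier S (\<lambda>x y::'a::euclidean_space. x \<bullet> y)"
  unfolding pd_multiplier_def positive_definite_on_def
proof (intro allI impI conjI ballI, goal_cases)
  case (1 K x y) then show ?case by (metis inner_commute)
next
  case (2 K n x a)
  let ?t = "\<lambda>i j b. (a i * (x i \<bullet> b)) * (a j * (x j \<bullet> b)) * K (x i) (x j)"
  have "a i * a j * (K (x i) (x j) * (x i \<bullet> x j)) = (\<Sum>b\<in>Basis. ?t i j b)" for i j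
    by (subst euclidean_inner) (simp add: sum_distrib_left mult_ac)
  then have "(\<Sum>i<n. \<Sum>j<n. a i * a j * (K (x i) (x j) * (x i \<bullet> x j))) = (\<Sum>i<n. \<Sum>j<n. \<Sum>b\<in>Basis. ?t i j b)"
    by simp
  also have "\<dots> = (\<Sum>i<n. \<Sum>b\<in>Basis. \<Sum>j<n. ?t i j b)" by (rule sum.cong[OF refl], rule sum.swap)
  also have "\<dots> = (\<Sum>b\<in>Basis. \<Sum>i<n. \<Sum>j<n. ?t i j b)" by (rule sum.swap)
  also have "\<dots> \<ge> 0"
  proof (rule sum_nonneg)
    fix b :: 'a
    have "\<forall>a::nat \<Rightarrow> real. 0 \<le> (\<Sum>i<n. \<Sum>j<n. a i * a j * K (x i) (x j))" using 2 by blast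
    then show "0 \<le> (\<Sum>i<n. \<Sum>j<n. ?t i j b)" by (rule spec)
  qed
  finally show ?case .
qed

text \<open>The series is the termwise integral of the binomial series of \<open>(1 - t\<^sup>2)\<^bsup>-1/2\<^esup>\<close>.\<close>

lemma arcsin_power_series_nonneg:
  obtains c :: "nat \<Rightarrow> real" where "\<And>n. c n \<ge> 0"
    "\<And>t. \<bar>t\<bar> < 1 \<Longrightarrow> (\<lambda>n. c n * t ^ n) sums arcsin t"
proof -
  define b where "b k = (-1)^k * ((-1/2::real) gchoose k)" for k
  define a where "a n = (if even n then b (n div 2) else 0)" for n
  have b0: "b k \<ge> 0" for k
  proof -
    have "b k = (1/2 + real k - 1) gchoose k"
      using gbinomial_minus[of "1/2::real" k] by (simp add: b_def flip: mult.assoc power_add)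
    also have "\<dots> = (\<Prod>i = 0..<k. 1/2 + real k - 1 - real i) / fact k" by (simp add: gbinomial_prod_rev)
    also have "\<dots> \<ge> 0" by (intro divide_nonneg_nonneg prod_nonneg) auto
    finally show ?thesis .
  qed
  then have a0: "a n \<ge> 0" for n by (simp add: a_def)
  have suma: "(\<lambda>n. a n * t ^ n) sums (1 - t^2) powr (-1/2)" if "\<bar>t\<bar> < 1" for t
  proof -
    have "abs (- (t^2)) < 1" using that by (simp add: abs_square_less_1)
    from gen_binomial_real[OF this, of "-1/2"]
    have "(\<lambda>k. b k * (t^2)^k) sums (1 - t^2) powr (-1/2)"
      by (simp add: b_def power_minus[of "t^2"] mult_ac)
    then have "(\<lambda>k. a (2*k) * t^(2*k)) sums (1 - t^2) powr (-1/2)"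
      by (simp add: a_def power_mult)
    then show ?thesis
      by (subst (asm) sums_mono_reindex) (auto simp: strict_mono_def a_def elim!: evenE)
  qed
  define f where "f n = a n / real (Suc n)" for n
  define F where "F t = (\<Sum>n. f n * t ^ Suc n)" for t
  have f1: "f n * real (Suc n) = a n" for n by (simp add: f_def)
  have sumf: "summable (\<lambda>n. f n * t ^ Suc n)" if "\<bar>t\<bar> < 1" for t
  proof (rule summable_comparison_test')
    show "summable (\<lambda>n. a n * \<bar>t\<bar>^n)" using suma[of "\<bar>t\<bar>"] that by (simp add: sums_iff)
    show "norm (f n * t ^ Suc n) \<le> a n * \<bar>t\<bar>^n" for n
    proof -
      have "\<bar>f n\<bar> \<le> a n" unfolding f_def using a0[of n] by (simp add: divide_le_eq mult_le_cancel_left1)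
      moreover have "\<bar>t\<bar>^Suc n \<le> \<bar>t\<bar>^n" using that by (simp add: mult_left_le_one_le)
      ultimately show ?thesis by (auto simp: abs_mult power_abs simp del: power_Suc intro!: mult_mono)
    qed
  qed
  have "F t = arcsin t" if t: "\<bar>t\<bar> < 1" for t
  proof -
    have "((\<lambda>t. F t - arcsin t) has_real_derivative 0) (at u)" if u: "u \<in> {-1<..<1}" for u
    proof -
      have "(F has_real_derivative (\<Sum>n. f n * real (Suc n) * u^n)) (at u)"
        unfolding F_def by (rule DERIV_power_series'[of 1]) (use suma u in \<open>auto simp: f1 sums_iff simp del: of_nat_Suc\<close>)
      also have "(\<Sum>n. f n * real (Suc n) * u^n) = (1 - u^2) powr (-1/2)"
        using suma[of u] u by (simp only: f1) (simp add: sums_iff abs_less_iff)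
      also have "\<dots> = inverse (sqrt (1 - u^2))"
        using powr_minus[of "1-u^2" "1/2"] u abs_square_less_1[of u] by (simp add: powr_half_sqrt abs_less_iff)
      finally have "(F has_real_derivative inverse (sqrt (1 - u^2))) (at u)" .
      from DERIV_diff[OF this DERIV_arcsin[of u]] u show ?thesis by simp
    qed
    then have "\<exists>c. \<forall>u\<in>{-1<..<1::real}. F u - arcsin u = c"
      by (intro has_field_derivative_zero_constant) (auto intro: has_field_derivative_at_within)
    then obtain c where c: "F u - arcsin u = c" if "u \<in> {-1<..<1::real}" for u by blast
    have "c = 0" using c[of 0] by (simp add: F_def)
    then show ?thesis using c[of t] t by (simp add: abs_less_iff)
  qed
  then have "(\<lambda>n. f n * t ^ Suc n) sums arcsin t" if "\<bar>t\<bar> < 1" for t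
    using sumf[OF that] that by (simp add: F_def sums_iff)
  then have "(\<lambda>n. (case n of 0 \<Rightarrow> 0 | Suc n \<Rightarrow> f n) * t ^ n) sums arcsin t" if "\<bar>t\<bar> < 1" for t
    using sums_Suc[where f="\<lambda>n. (case n of 0 \<Rightarrow> 0 | Suc n \<Rightarrow> f n) * t ^ n" and l="arcsin t"] that by simp
  then show ?thesis
    by (rule that[rotated]) (auto split: nat.split simp: f_def a0)
qed

text \<open>Except for the constant term, the binomial coefficients of \<open>(1 - t)\<^sup>\<alpha>\<close> have the sign of
  \<open>- \<alpha> (1 - \<alpha>) (2 - \<alpha>) \<dots>\<close>, which is negative or zero because \<open>\<alpha> \<le> 1\<close>.\<close>

lemma one_minus_powr_series:
  assumes \<alpha>: "0 < \<alpha>" "\<alpha> \<le> 1"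
  obtains c :: "nat \<Rightarrow> real" where "\<And>n. c n \<ge> 0"
    "\<And>t. \<bar>t\<bar> < 1 \<Longrightarrow> (\<lambda>n. c n * t ^ n) sums (1 - (1 - t) powr \<alpha>)"
proof -
  define b where "b n = (if n = 0 then 0 else - ((-1)^n * (\<alpha> gchoose n)))" for n
  have "b n \<ge> 0" for n
  proof (cases n)
    case (Suc m)
    have "b n = - ((n - 1 - \<alpha>) gchoose n)"
      using gbinomial_minus[of "-\<alpha>" n] Suc by (simp add: b_def flip: mult.assoc power_add)
    also have "(n - 1 - \<alpha>) gchoose n = (\<Prod>i = 0..<n. n - 1 - \<alpha> - real i) / fact n"
      by (simp add: gbinomial_prod_rev)
    also have "(\<Prod>i = 0..<n. n - 1 - \<alpha> - real i) = (\<Prod>i = 0..<m. n - 1 - \<alpha> - real i) * (-\<alpha>)"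
      by (simp add: Suc)
    finally have "b n = (\<Prod>i = 0..<m. n - 1 - \<alpha> - real i) * \<alpha> / fact n" by simp
    also have "\<dots> \<ge> 0" using \<alpha> Suc by (intro divide_nonneg_nonneg mult_nonneg_nonneg prod_nonneg) auto
    finally show ?thesis .
  qed (simp add: b_def)
  moreover have "(\<lambda>n. b n * t ^ n) sums (1 - (1 - t) powr \<alpha>)" if "\<bar>t\<bar> < 1" for t
  proof -
    have "(\<lambda>n. (\<alpha> gchoose n) * (-t) ^ n) sums (1 - t) powr \<alpha>" using gen_binomial_real[of "-t" \<alpha>] that by simp
    moreover have "(\<lambda>n. if n = 0 then 1 else 0) sums (1::real)"
      using sums_single[of 0 "\<lambda>_. 1::real"] by simp
    ultimately have "(\<lambda>n. (if n = 0 then 1 else 0) - (\<alpha> gchoose n) * (-t) ^ n) sums (1 - (1 - t) powr \<alpha>)"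
      by (intro sums_diff)
    moreover have "(if n = 0 then 1 else 0) - (\<alpha> gchoose n) * (-t) ^ n = b n * t ^ n" for n
      by (simp add: b_def power_minus[of t] mult_ac)
    ultimately show ?thesis by simp
  qed
  ultimately show ?thesis using that by blast
qed

text \<open>The power series are available for \<open>\<bar>t\<bar> < 1\<close> only, whereas inner products of unit vectors attain \<open>\<plusminus>1\<close>.
  Kernels are therefore first multiplied by \<open>1 - 1/(n + 1)\<close>.\<close>

lemma shrink_tendsto: "(\<lambda>n. 1 - 1 / real (Suc n)) \<longlonglongrightarrow> 1"
  using tendsto_diff[OF tendsto_const LIMSEQ_inverse_real_of_nat, of 1] by (simp add: inverse_eq_divide)

lemma shrink_bound: "\<bar>s\<bar> \<le> 1 \<Longrightarrow> \<bar>(1 - 1 / real (Suc n)) * s\<bar> < 1"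
proof -
  have "0 \<le> 1 - 1 / real (Suc n)" "1 - 1 / real (Suc n) < 1" by auto
  then show "\<bar>s\<bar> \<le> 1 \<Longrightarrow> ?thesis"
    by (simp only: abs_mult abs_of_nonneg) (meson dual_order.strict_trans2 mult_left_le order.strict_trans1)
qed

text \<open>With \<open>s = 2/\<pi> arcsin \<langle>x, y\<rangle>\<close> the geodesic distance is \<open>\<pi>/2 (1 - s)\<close>, so the kernel is
  \<open>(\<pi>/2)\<^sup>\<alpha> (1 - (1 - s)\<^sup>\<alpha>)\<close>: a power series in \<open>s\<close>, which is itself a power series in the inner product.\<close>

lemma pd_multiplier_one_minus_power_geodist:
  assumes \<alpha>: "0 < \<alpha>" "\<alpha> \<le> 1"
  shows "pd_multiplier (sphere (0::'a::euclidean_space) 1) (\<lambda>x y. (pi/2) powr \<alpha> - geodist x y powr \<alpha>)"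
proof -
  let ?S = "sphere (0::'a) 1"
  let ?r = "\<lambda>n. 1 - 1 / real (Suc n)"
  have ip: "\<bar>x \<bullet> y\<bar> \<le> 1" if "x \<in> ?S" "y \<in> ?S" for x y
    using Cauchy_Schwarz_ineq2[of x y] that by simp
  have r0: "0 \<le> ?r n" for n by simp
  have arcsin: "pd_multiplier ?S (\<lambda>x y. arcsin (x \<bullet> y))"
  proof (rule pd_multiplier_lim)
    obtain c :: "nat \<Rightarrow> real" where c: "\<And>n. c n \<ge> 0"
      "\<And>t. \<bar>t\<bar> < 1 \<Longrightarrow> (\<lambda>n. c n * t ^ n) sums arcsin t" by (rule arcsin_power_series_nonneg) blast
    show "pd_multiplier ?S (\<lambda>x y. arcsin (?r n * (x \<bullet> y)))" for n
      by (rule pd_multiplier_power_series[OF pd_multiplier_mult[OF pd_multiplier_const[OF r0[of n]] pd_multiplier_inner] c(1)])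
        (erule (1) c(2)[OF shrink_bound[OF ip]])
    show "(\<lambda>n. arcsin (?r n * (x \<bullet> y))) \<longlonglongrightarrow> arcsin (x \<bullet> y)" if "x \<in> ?S" "y \<in> ?S" for x y
    proof (rule continuous_on_tendsto_compose[OF continuous_on_arcsin'])
      show "(\<lambda>n. ?r n * (x \<bullet> y)) \<longlonglongrightarrow> x \<bullet> y"
        using tendsto_mult[OF shrink_tendsto tendsto_const, of "x \<bullet> y"] by simp
      show "x \<bullet> y \<in> {-1..1}" using ip[OF that] by auto
      show "\<forall>\<^sub>F n in sequentially. ?r n * (x \<bullet> y) \<in> {- 1..1}"
        using shrink_bound[OF ip[OF that]] by (intro always_eventually) (auto simp: abs_less_iff less_imp_le dest!: spec)
    qed
  qed
  define s where "s x y = 2 / pi * arcsin (x \<bullet> y)" for x y :: 'a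
  have s: "pd_multiplier ?S s"
    unfolding s_def by (rule pd_multiplier_mult[OF pd_multiplier_const arcsin]) simp
  have s1: "\<bar>s x y\<bar> \<le> 1" if "x \<in> ?S" "y \<in> ?S" for x y
    using arcsin_bounded[of "x \<bullet> y"] ip[OF that] by (auto simp: s_def abs_le_iff field_simps)
  have "pd_multiplier ?S (\<lambda>x y. 1 - (1 - s x y) powr \<alpha>)"
  proof (rule pd_multiplier_lim)
    obtain c :: "nat \<Rightarrow> real" where c: "\<And>n. c n \<ge> 0"
      "\<And>t. \<bar>t\<bar> < 1 \<Longrightarrow> (\<lambda>n. c n * t ^ n) sums (1 - (1 - t) powr \<alpha>)" by (rule one_minus_powr_series[OF \<alpha>]) blast
    show "pd_multiplier ?S (\<lambda>x y. 1 - (1 - ?r n * s x y) powr \<alpha>)" for n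
      by (rule pd_multiplier_power_series[OF pd_multiplier_mult[OF pd_multiplier_const[OF r0[of n]] s] c(1)])
        (erule (1) c(2)[OF shrink_bound[OF s1]])
    show "(\<lambda>n. 1 - (1 - ?r n * s x y) powr \<alpha>) \<longlonglongrightarrow> 1 - (1 - s x y) powr \<alpha>" if "x \<in> ?S" "y \<in> ?S" for x y
    proof -
      have "(\<lambda>n. 1 - ?r n * s x y) \<longlonglongrightarrow> 1 - s x y"
        using tendsto_diff[OF tendsto_const tendsto_mult[OF shrink_tendsto tendsto_const, of "s x y"], of 1] by simp
      then have "(\<lambda>n. (1 - ?r n * s x y) powr \<alpha>) \<longlonglongrightarrow> (1 - s x y) powr \<alpha>"
        using \<alpha> shrink_bound[OF s1[OF that]]
        by (intro tendsto_powr2 tendsto_const always_eventually) (auto simp: abs_less_iff less_imp_le)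
      then show ?thesis by (rule tendsto_diff[OF tendsto_const])
    qed
  qed
  then have "pd_multiplier ?S (\<lambda>x y. (pi/2) powr \<alpha> * (1 - (1 - s x y) powr \<alpha>))"
    by (intro pd_multiplier_mult[OF pd_multiplier_const[of "(pi/2) powr \<alpha>" ?S]]) auto
  moreover have "(pi/2) powr \<alpha> * (1 - (1 - s x y) powr \<alpha>) = (pi/2) powr \<alpha> - geodist x y powr \<alpha>"
    if "x \<in> ?S" "y \<in> ?S" for x y
  proof -
    have "geodist x y = pi/2 * (1 - s x y)"
      using ip[OF that] by (simp add: geodist_def s_def arccos_arcsin_eq abs_le_iff algebra_simps)
    then have "geodist x y powr \<alpha> = (pi/2) powr \<alpha> * (1 - s x y) powr \<alpha>"
      using s1[OF that] by (simp only:) (subst powr_mult, auto simp: abs_le_iff)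
    then show ?thesis by (simp add: algebra_simps)
  qed
  \<comment> \<open>A constant sequence: only the values of a kernel on \<open>S\<close> matter.\<close>
  ultimately show ?thesis
    using pd_multiplier_lim[of ?S "\<lambda>_ x y. (pi/2) powr \<alpha> * (1 - (1 - s x y) powr \<alpha>)"
        "\<lambda>x y. (pi/2) powr \<alpha> - geodist x y powr \<alpha>"] by simp
qed

lemma positive_definite_power_geodist:
  assumes \<alpha>: "0 < \<alpha>" "\<alpha> \<le> 1" and C: "C \<ge> (pi/2) powr \<alpha> / 2"
  shows "positive_definite_on (sphere (0::'a::euclidean_space) 1) (\<lambda>x y. C - 1/2 * geodist x y powr \<alpha>)"
proof -
  have "pd_multiplier (sphere (0::'a) 1)
      (\<lambda>x y. (C - (pi/2) powr \<alpha> / 2) + 1/2 * ((pi/2) powr \<alpha> - geodist x y powr \<alpha>))"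
    by (rule pd_multiplier_add[OF pd_multiplier_const pd_multiplier_mult[OF pd_multiplier_const
        pd_multiplier_one_minus_power_geodist[OF \<alpha>]]]) (use C in auto)
  also have "(\<lambda>x y::'a. (C - (pi/2) powr \<alpha> / 2) + 1/2 * ((pi/2) powr \<alpha> - geodist x y powr \<alpha>)) =
     (\<lambda>x y. C - 1/2 * geodist x y powr \<alpha>)" by (simp add: fun_eq_iff diff_divide_distrib right_diff_distrib)
  finally show ?thesis by (rule pd_multiplier_imp_positive_definite)
qed

lemma geodist_commute: "geodist x y = geodist y x"
  by (simp add: geodist_def inner_commute)

lemma geodist_self: "x \<in> sphere 0 1 \<Longrightarrow> geodist x x = 0"
  by (simp add: geodist_def flip: power2_norm_eq_inner)

text \<open>Weights of sum zero annihilate the constant \<open>C\<close> in the quadratic form of \<open>C - \<rho>\<^sup>\<alpha>/2\<close>.\<close>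

lemma negative_definite_power_geodist:
  assumes \<alpha>: "0 < \<alpha>" "\<alpha> \<le> 1"
  shows "negative_definite_on (sphere (0::'a::euclidean_space) 1) (\<lambda>x y. geodist x y powr \<alpha>)"
  unfolding negative_definite_on_def
proof (intro conjI ballI allI impI)
  fix n :: nat and x :: "nat \<Rightarrow> 'a" and a :: "nat \<Rightarrow> real"
  assume x: "\<forall>i<n. x i \<in> sphere 0 1" and a: "(\<Sum>i<n. a i) = 0"
  let ?C = "(pi/2) powr \<alpha> / 2"
  have "0 \<le> (\<Sum>i<n. \<Sum>j<n. a i * a j * (?C - 1/2 * geodist (x i) (x j) powr \<alpha>))"
    using positive_definite_power_geodist[OF \<alpha> order_refl] x unfolding positive_definite_on_def by blast
  also have "\<dots> = ?C * (\<Sum>i<n. a i) * (\<Sum>j<n. a j) - 1/2 * (\<Sum>i<n. \<Sum>j<n. a i * a j * geodist (x i) (x j) powr \<alpha>)"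
  proof -
    have "a i * a j * (?C - 1/2 * geodist (x i) (x j) powr \<alpha>) =
       ?C * (a i * a j) - 1/2 * (a i * a j * geodist (x i) (x j) powr \<alpha>)" for i j by (simp add: algebra_simps)
    then show ?thesis
      by (simp only: sum_subtractf sum_distrib_left[symmetric] mult.assoc[of ?C] sum_product)
  qed
  finally show "(\<Sum>i<n. \<Sum>j<n. a i * a j * geodist (x i) (x j) powr \<alpha>) \<le> 0" using a by simp
qed (use \<alpha> in \<open>auto simp: geodist_commute geodist_self\<close>)


section \<open>The rotation invariant measure on the sphere\<close>

text \<open>The image measure is translation invariant and gives the unit ball its volume.  The argument is the one for the
  uniqueness of Haar measure.\<close>

lemma lborel_distr_orthogonal:
  fixes U :: "'a::euclidean_space \<Rightarrow> 'a"
  assumes U: "orthogonal_transformation U"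
  shows "distr lborel borel U = lborel"
proof -
  have linU: "linear U" using U by (rule orthogonal_transformation_linear)
  have mU[measurable]: "U \<in> borel_measurable borel"
    using linU by (intro borel_measurable_continuous_onI linear_continuous_on linear_conv_bounded_linear[THEN iffD1])
  let ?\<nu> = "distr lborel borel U"
  let ?B = "ball (0::'a) 1"
  have Bm[measurable]: "?B \<in> sets borel" by simp
  have preB: "U -` ?B = ?B" by (auto simp: orthogonal_transformation_norm[OF U])
  have nu_shift: "(\<integral>\<^sup>+x. f (y + x) \<partial>?\<nu>) = (\<integral>\<^sup>+x. f x \<partial>?\<nu>)"
    if [measurable]: "f \<in> borel_measurable borel" for f :: "'a \<Rightarrow> ennreal" and y
  proof -
    obtain z where z: "y = U z" using orthogonal_transformation_surj[OF U] by (metis surjD)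
    have "(\<integral>\<^sup>+x. f (y + x) \<partial>?\<nu>) = (\<integral>\<^sup>+x. f (U (z + x)) \<partial>lborel)"
      by (simp add: nn_integral_distr z linear_add[OF linU])
    also have "\<dots> = (\<integral>\<^sup>+x. f (U x) \<partial>distr lborel borel ((+) z))"
      by (subst nn_integral_distr) auto
    also have "\<dots> = (\<integral>\<^sup>+x. f x \<partial>?\<nu>)" by (simp add: lborel_distr_plus nn_integral_distr)
    finally show ?thesis .
  qed
  have lborel_shift: "(\<integral>\<^sup>+y. f (y + x) \<partial>lborel) = (\<integral>\<^sup>+y. f y \<partial>lborel)"
    if [measurable]: "f \<in> borel_measurable borel" for f :: "'a \<Rightarrow> ennreal" and x
  proof -
    have "(\<integral>\<^sup>+y. f (y + x) \<partial>lborel) = (\<integral>\<^sup>+y. f y \<partial>distr lborel borel ((+) x))"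
      by (subst nn_integral_distr) (auto simp: add.commute)
    then show ?thesis by (simp add: lborel_distr_plus)
  qed
  have fin: "emeasure lborel ?B < \<infinity>" by (rule emeasure_lborel_ball_finite)
  have "emeasure lborel ?B = ennreal (measure lborel ?B)"
    using fin by (simp add: emeasure_eq_ennreal_measure less_top)
  then have pos: "emeasure lborel ?B \<noteq> 0" using content_ball_pos[of 1 "0::'a"] by simp
  have \<nu>B: "emeasure ?\<nu> ?B = emeasure lborel ?B" by (simp add: emeasure_distr preB)
  have "sigma_finite_measure ?\<nu>"
  proof
    show "\<exists>A::'a set set. countable A \<and> A \<subseteq> sets ?\<nu> \<and> \<Union>A = space ?\<nu> \<and> (\<forall>a\<in>A. emeasure ?\<nu> a \<noteq> \<infinity>)"
    proof (intro exI[of _ "range (\<lambda>n::nat. ball 0 (real n))"] conjI ballI)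
      show "\<Union> (range (\<lambda>n::nat. ball 0 (real n))) = space ?\<nu>"
        by (auto simp: reals_Archimedean2)
      fix a assume "a \<in> range (\<lambda>n::nat. ball (0::'a) (real n))"
      then obtain n where a: "a = ball 0 (real n)" by blast
      have "U -` a = a" unfolding a by (auto simp: orthogonal_transformation_norm[OF U])
      then show "emeasure ?\<nu> a \<noteq> \<infinity>"
        using emeasure_lborel_ball_finite[of "0::'a" "real n"] unfolding a by (simp add: emeasure_distr less_top)
    qed auto
  qed
  then interpret \<nu>: sigma_finite_measure ?\<nu> .
  interpret pair_sigma_finite lborel ?\<nu> by (intro pair_sigma_finite.intro sigma_finite_lborel \<nu>.sigma_finite_measure_axioms)
  show ?thesis
  proof (rule measure_eqI)
    fix A assume "A \<in> sets ?\<nu>"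
    then have A[measurable]: "A \<in> sets borel" by simp
    \<comment> \<open>Both iterated integrals of \<open>1\<^sub>A(x) 1\<^sub>B(y - x)\<close> factor by translation invariance.\<close>
    let ?g = "\<lambda>y x. indicator A x * indicator ?B (y - x) :: ennreal"
    have "(\<integral>\<^sup>+x. \<integral>\<^sup>+y. ?g y x \<partial>lborel \<partial>?\<nu>) = (\<integral>\<^sup>+x. indicator A x * emeasure lborel ?B \<partial>?\<nu>)"
    proof (rule nn_integral_cong)
      fix x
      have "(\<integral>\<^sup>+y. ?g y x \<partial>lborel) = indicator A x * (\<integral>\<^sup>+y. indicator ?B (y + (- x)) \<partial>lborel)"
        using nn_integral_cmult[of "\<lambda>y. indicator ?B (y - x)" lborel "indicator A x"]
          measurable_compose[OF _ borel_measurable_indicator[OF Bm], of "\<lambda>y. y - x" borel] by simp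
      also have "(\<integral>\<^sup>+y. indicator ?B (y + (- x)) \<partial>lborel) = emeasure lborel ?B"
        by (subst lborel_shift) auto
      finally show "(\<integral>\<^sup>+y. ?g y x \<partial>lborel) = indicator A x * emeasure lborel ?B" .
    qed
    also have "\<dots> = emeasure ?\<nu> A * emeasure lborel ?B"
      by (subst nn_integral_multc) auto
    finally have 1: "(\<integral>\<^sup>+x. \<integral>\<^sup>+y. ?g y x \<partial>lborel \<partial>?\<nu>) = emeasure ?\<nu> A * emeasure lborel ?B" .
    have "(\<integral>\<^sup>+x. \<integral>\<^sup>+y. ?g y x \<partial>lborel \<partial>?\<nu>) = (\<integral>\<^sup>+y. \<integral>\<^sup>+x. ?g y x \<partial>?\<nu> \<partial>lborel)"
      by (rule Fubini') measurable
    also have "\<dots> = (\<integral>\<^sup>+y. \<integral>\<^sup>+x. indicator A (y + x) * indicator ?B (- x) \<partial>?\<nu> \<partial>lborel)"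
    proof (rule nn_integral_cong)
      fix y
      show "(\<integral>\<^sup>+x. ?g y x \<partial>?\<nu>) = (\<integral>\<^sup>+x. indicator A (y + x) * indicator ?B (- x) \<partial>?\<nu>)"
        using nu_shift[of "?g y" y] by simp
    qed
    also have "\<dots> = (\<integral>\<^sup>+x. \<integral>\<^sup>+y. indicator A (y + x) * indicator ?B (- x) \<partial>lborel \<partial>?\<nu>)"
      by (rule Fubini'[symmetric]) measurable
    also have "\<dots> = (\<integral>\<^sup>+x. emeasure lborel A * indicator ?B x \<partial>?\<nu>)"
    proof (rule nn_integral_cong)
      fix x :: 'a
      have "(\<integral>\<^sup>+y. indicator A (y + x) * indicator ?B (- x) \<partial>lborel) =
        (\<integral>\<^sup>+y. indicator A (y + x) \<partial>lborel) * indicator ?B (- x)"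
        by (intro nn_integral_multc) (simp add: measurable_compose[OF _ borel_measurable_indicator[OF A], of "\<lambda>y. y + x" borel])
      also have "(\<integral>\<^sup>+y. indicator A (y + x) \<partial>lborel) = emeasure lborel A"
        by (subst lborel_shift) auto
      finally show "(\<integral>\<^sup>+y. indicator A (y + x) * indicator ?B (- x) \<partial>lborel) = emeasure lborel A * indicator ?B x"
        by (simp add: indicator_def)
    qed
    also have "\<dots> = emeasure lborel A * emeasure lborel ?B"
      by (subst nn_integral_cmult) (auto simp: \<nu>B)
    finally show "emeasure ?\<nu> A = emeasure lborel A"
      using 1 pos fin by (auto simp add: mult.commute[of _ "emeasure lborel ?B"] ennreal_mult_cancel_left)
  qed simp
qed

lemma space_sphere_measure [simp]: "space sphere_measure = sphere (0::'a::euclidean_space) 1"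
  by (simp add: sphere_measure_def space_scale_measure space_restrict_space)

lemma sets_sphere_measure: "sets sphere_measure = sets (restrict_space borel (sphere (0::'a::euclidean_space) 1))"
  by (simp add: sphere_measure_def)

lemma sgn_measurable_cone [measurable]:
  "sgn \<in> restrict_space lborel (ball (0::'a::euclidean_space) 1 - {0}) \<rightarrow>\<^sub>M restrict_space borel (sphere 0 1)"
  by (rule measurable_restrict_space2)
    (auto simp: space_restrict_space norm_sgn intro!: measurable_restrict_space1)

lemma emeasure_sphere_measure:
  assumes A: "A \<in> sets sphere_measure"
  shows "emeasure sphere_measure (A :: 'a::euclidean_space set) =
    ennreal (real DIM('a)) * emeasure lborel {x \<in> ball 0 1 - {0}. sgn x \<in> A}"
proof -
  have eq: "sgn -` A \<inter> (ball 0 1 - {0}) = {x \<in> ball 0 1 - {0::'a}. sgn x \<in> A}" by auto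
  have "emeasure (distr (restrict_space lborel (ball (0::'a) 1 - {0})) (restrict_space borel (sphere 0 1)) sgn) A =
     emeasure (restrict_space lborel (ball 0 1 - {0})) {x \<in> ball 0 1 - {0}. sgn x \<in> A}"
    using A by (subst emeasure_distr) (auto simp: sets_sphere_measure space_restrict_space eq)
  also have "\<dots> = emeasure lborel {x \<in> ball 0 1 - {0}. sgn x \<in> A}"
    by (rule emeasure_restrict_space) auto
  finally show ?thesis by (simp add: sphere_measure_def)
qed

interpretation sphere: finite_measure "sphere_measure :: 'a::euclidean_space measure"
proof
  have "emeasure sphere_measure (sphere (0::'a) 1) \<le> ennreal (real DIM('a)) * emeasure lborel (ball (0::'a) 1)"
    by (subst emeasure_sphere_measure) (auto simp: sets_sphere_measure sets_restrict_space_iff intro!: mult_left_mono emeasure_mono)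
  also have "\<dots> < \<infinity>" by (simp add: ennreal_mult_less_top emeasure_lborel_ball_finite[simplified])
  finally show "emeasure (sphere_measure :: 'a measure) (space sphere_measure) \<noteq> \<infinity>" by simp
qed

lemma orthogonal_on_sphere: "orthogonal_transformation (U :: 'a::euclidean_space \<Rightarrow> 'a) \<Longrightarrow> U x \<in> sphere 0 1 \<longleftrightarrow> x \<in> sphere 0 1"
  by (simp add: orthogonal_transformation_norm)

lemma continuous_on_orthogonal: "orthogonal_transformation U \<Longrightarrow> continuous_on A (U :: 'a::euclidean_space \<Rightarrow> 'a)"
  by (intro linear_continuous_on linear_conv_bounded_linear[THEN iffD1] orthogonal_transformation_linear)

lemma continuous_on_compose_orthogonal:
  fixes U :: "'a::euclidean_space \<Rightarrow> 'a"
  assumes "orthogonal_transformation U" "continuous_on (sphere (0::'a::euclidean_space) 1) f"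
  shows "continuous_on (sphere 0 1) (\<lambda>x. f (U x))"
  by (rule continuous_on_compose2[OF assms(2) continuous_on_orthogonal[OF assms(1)]])
    (auto simp: orthogonal_transformation_norm[OF assms(1)])

lemma orthogonal_measurable_sphere:
  fixes U :: "'a::euclidean_space \<Rightarrow> 'a"
  assumes U: "orthogonal_transformation U"
  shows "U \<in> sphere_measure \<rightarrow>\<^sub>M (sphere_measure :: 'a::euclidean_space measure)"
proof -
  have "U \<in> restrict_space borel (sphere 0 1) \<rightarrow>\<^sub>M restrict_space borel (sphere (0::'a) 1)"
    using orthogonal_on_sphere[OF U]
    by (intro measurable_restrict_space3 borel_measurable_continuous_onI continuous_on_orthogonal[OF U]) auto
  then show ?thesis by (simp add: measurable_cong_sets[OF sets_sphere_measure sets_sphere_measure])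
qed

text \<open>\<open>U\<close> maps the cone over \<open>U\<^sup>-\<^sup>1 A\<close> in the unit ball onto the cone over \<open>A\<close>.\<close>

lemma sphere_measure_orthogonal:
  fixes U :: "'a::euclidean_space \<Rightarrow> 'a"
  assumes U: "orthogonal_transformation U"
  shows "distr sphere_measure sphere_measure U = (sphere_measure :: 'a::euclidean_space measure)"
proof (rule measure_eqI)
  fix A assume "A \<in> sets (distr sphere_measure (sphere_measure :: 'a measure) U)"
  then have A: "A \<in> sets (sphere_measure :: 'a measure)" by simp
  have mU[measurable]: "U \<in> borel_measurable borel"
    by (intro borel_measurable_continuous_onI continuous_on_orthogonal[OF U])
  let ?P = "U -` A \<inter> sphere 0 1"
  have P: "?P \<in> sets sphere_measure"
    using measurable_sets[OF orthogonal_measurable_sphere[OF U] A] by simp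
  have inj: "U x = 0 \<longleftrightarrow> x = 0" for x
    using orthogonal_transformation_norm[OF U, of x] by (metis norm_eq_zero)
  have sgnU: "sgn (U x) = U (sgn x)" for x
    by (simp add: sgn_div_norm orthogonal_transformation_norm[OF U] orthogonal_transformation_scaleR[OF U])
  let ?C = "{x \<in> ball 0 1 - {0}. sgn x \<in> A}"
  have "A \<in> sets borel" using A by (auto simp: sets_sphere_measure sets_restrict_space)
  then have [measurable]: "A \<in> sets borel" .
  have C: "?C \<in> sets borel" by measurable
  have eq: "{x \<in> ball 0 1 - {0}. sgn x \<in> ?P} = U -` ?C"
    by (auto simp: orthogonal_transformation_norm[OF U] inj sgnU norm_sgn)
  have "emeasure lborel (U -` ?C) = emeasure (distr lborel borel U) ?C"
    using emeasure_distr[OF _ C, of U lborel] by simp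
  then have "emeasure lborel {x \<in> ball 0 1 - {0}. sgn x \<in> ?P} = emeasure lborel ?C"
    unfolding eq lborel_distr_orthogonal[OF U] .
  then show "emeasure (distr sphere_measure sphere_measure U) A = emeasure sphere_measure A"
    by (simp add: emeasure_distr[OF orthogonal_measurable_sphere[OF U] A] emeasure_sphere_measure[OF A] emeasure_sphere_measure[OF P])
qed simp

lemma borel_measurable_sphere_continuous:
  "continuous_on (sphere (0::'a::euclidean_space) 1) f \<Longrightarrow> f \<in> borel_measurable sphere_measure"
  using borel_measurable_continuous_on_restrict[of "sphere (0::'a) 1" f]
  by (simp add: measurable_cong_sets[OF sets_sphere_measure refl])

lemma continuous_on_sphere_bounded:
  fixes f :: "'a::euclidean_space \<Rightarrow> real"
  assumes "continuous_on (sphere 0 1) f"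
  obtains B where "B > 0" "\<And>x. x \<in> sphere 0 1 \<Longrightarrow> \<bar>f x\<bar> \<le> B"
proof -
  have "bounded (f ` sphere 0 1)" by (intro compact_imp_bounded compact_continuous_image assms compact_sphere)
  then show ?thesis using that by (auto simp: bounded_pos)
qed

lemma integrable_sphere_continuous:
  fixes f :: "'a::euclidean_space \<Rightarrow> real"
  assumes "continuous_on (sphere 0 1) f"
  shows "integrable sphere_measure f"
proof -
  obtain B where "\<And>x. x \<in> sphere 0 1 \<Longrightarrow> \<bar>f x\<bar> \<le> B" using continuous_on_sphere_bounded[OF assms] by blast
  then show ?thesis
    by (intro sphere.integrable_const_bound[of _ B] borel_measurable_sphere_continuous assms) auto
qed

lemma integral_sphere_orthogonal:
  fixes f :: "'a::euclidean_space \<Rightarrow> real" and U :: "'a \<Rightarrow> 'a"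
  assumes U: "orthogonal_transformation U" and f: "continuous_on (sphere 0 1) f"
  shows "(LINT x|sphere_measure. f (U x)) = (LINT x|sphere_measure. f x)"
  using integral_distr[OF orthogonal_measurable_sphere[OF U] borel_measurable_sphere_continuous[OF f]]
  by (simp add: sphere_measure_orthogonal[OF U])

text \<open>If \<open>f x \<noteq> 0\<close>, then \<open>f\<close> is nonzero on the directions of an open subset of the unit ball, and such a set has
  positive volume.\<close>

lemma integral_sphere_eq_0_imp:
  fixes f :: "'a::euclidean_space \<Rightarrow> real"
  assumes f: "continuous_on (sphere 0 1) f" and nonneg: "\<And>x. x \<in> sphere 0 1 \<Longrightarrow> 0 \<le> f x"
    and 0: "(LINT x|sphere_measure. f x) = 0" and x: "x \<in> sphere 0 1"
  shows "f x = 0"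
proof (rule ccontr)
  assume nz: "f x \<noteq> 0"
  have "AE x in sphere_measure. f x = 0"
  proof -
    have "AE x in sphere_measure. 0 \<le> f x" using nonneg by (intro AE_I2) auto
    then show ?thesis using 0 integral_nonneg_eq_0_iff_AE[OF integrable_sphere_continuous[OF f]] by simp
  qed
  moreover have "{x \<in> space sphere_measure. f x \<noteq> 0} \<in> sets sphere_measure"
    using borel_measurable_sphere_continuous[OF f] by measurable
  ultimately have null: "emeasure sphere_measure {x \<in> space sphere_measure. f x \<noteq> 0} = 0"
    by (subst (asm) AE_iff_null) (auto simp: null_sets_def)
  let ?V = "{x \<in> ball 0 1 - {0}. f (sgn x) \<noteq> 0}"
  have "continuous_on (ball 0 1 - {0}) (\<lambda>x::'a. f (sgn x))"
    by (rule continuous_on_compose2[OF f]) (auto intro!: continuous_intros simp: norm_sgn split: if_splits)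
  then have "open ((\<lambda>x::'a. f (sgn x)) -` (-{0}) \<inter> (ball 0 1 - {0}))"
    using continuous_on_open_vimage[of "ball 0 1 - {0}" "\<lambda>x::'a. f (sgn x)"]
    by (simp add: open_Compl open_Diff)
  moreover have "(\<lambda>x::'a. f (sgn x)) -` (-{0}) \<inter> (ball 0 1 - {0}) = ?V" by auto
  ultimately have "open ?V" by simp
  moreover have "(1/2) *\<^sub>R x \<in> ?V" using x nz by (auto simp: sgn_scaleR sgn_div_norm)
  ultimately obtain r where r: "r > 0" "ball ((1/2) *\<^sub>R x) r \<subseteq> ?V" by (meson openE)
  have "?V = {y \<in> ball 0 1 - {0}. sgn y \<in> {x \<in> space sphere_measure. f x \<noteq> 0}}"
    by (auto simp: norm_sgn split: if_splits)
  then have "emeasure lborel ?V = 0"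
    using null emeasure_sphere_measure[of "{x \<in> space sphere_measure. f x \<noteq> 0}"]
      \<open>{x \<in> space sphere_measure. f x \<noteq> 0} \<in> sets sphere_measure\<close> by simp
  then have "emeasure lborel (ball ((1/2) *\<^sub>R x) r) = 0"
    using emeasure_mono[OF r(2), of lborel] \<open>open ?V\<close> by simp
  then show False using content_ball_pos[OF r(1), of "(1/2) *\<^sub>R x"] by (simp add: measure_def)
qed

lemma sphere_measure_pos: "measure sphere_measure (sphere (0::'a::euclidean_space) 1) > 0"
proof (rule ccontr)
  obtain b :: 'a where b: "b \<in> Basis" using nonempty_Basis by blast
  assume "\<not> ?thesis"
  then have "measure sphere_measure (sphere (0::'a) 1) = 0" using measure_nonneg by (metis less_eq_real_def)
  then have "(LINT x|sphere_measure. (\<lambda>x::'a. 1::real) x) = 0" by simp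
  from integral_sphere_eq_0_imp[OF _ _ this, of b] b show False by auto
qed


section \<open>Partial derivatives of polynomial functions\<close>

lemmas poly_linear = real_polynomial_function.intros(1)
  and poly_const = real_polynomial_function.intros(2)
  and poly_add = real_polynomial_function.intros(3)
  and poly_mult = real_polynomial_function.intros(4)

lemma if_one_mult: "(if b then 1 else 0) * c = (if b then c else (0::real))" by simp

definition partial :: "'n \<Rightarrow> (real^'n::finite \<Rightarrow> real) \<Rightarrow> real^'n \<Rightarrow> real" where
  "partial i p x = deriv (\<lambda>t. p (x + t *\<^sub>R axis i 1)) 0"

lemma linear_expand_axis:
  fixes f :: "real^'n \<Rightarrow> real"
  assumes "linear f" shows "f v = (\<Sum>i\<in>UNIV. v $ i * f (axis i 1))"
proof -
  have "f v = f (\<Sum>i\<in>UNIV. v $ i *\<^sub>R axis i 1)"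
    using basis_expansion[of v] by (simp add: scalar_mult_eq_scaleR)
  then show ?thesis using assms by (simp add: linear_sum linear_scale)
qed

text \<open>The induction keeps the gradient polynomial, so that all higher partial derivatives exist as well.\<close>

lemma polynomial_gradient_exists:
  fixes p :: "real^'n \<Rightarrow> real"
  assumes "real_polynomial_function p"
  shows "\<exists>q. (\<forall>i. real_polynomial_function (q i)) \<and>
     (\<forall>x. (p has_derivative (\<lambda>v. \<Sum>i\<in>UNIV. v $ i * q i x)) (at x))"
  using assms
proof (induction p rule: real_polynomial_function.induct)
  case (linear f)
  have "(f has_derivative (\<lambda>v. \<Sum>i\<in>UNIV. v $ i * f (axis i 1))) (at x)" for x
    using bounded_linear_imp_has_derivative[OF linear] linear_expand_axis[of f] linear
    by (simp add: bounded_linear.linear flip: linear_expand_axis)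
  then show ?case by (intro exI[of _ "\<lambda>i x. f (axis i 1)"]) auto
next
  case (const c)
  show ?case by (intro exI[of _ "\<lambda>i x. 0"]) auto
next
  case (add f g)
  then obtain a b where a: "\<And>i. real_polynomial_function (a i)"
      "\<And>x. (f has_derivative (\<lambda>v. \<Sum>i\<in>UNIV. v $ i * a i x)) (at x)"
    and b: "\<And>i. real_polynomial_function (b i)"
      "\<And>x. (g has_derivative (\<lambda>v. \<Sum>i\<in>UNIV. v $ i * b i x)) (at x)" by blast
  have "((\<lambda>x. f x + g x) has_derivative (\<lambda>v. \<Sum>i\<in>UNIV. v $ i * (a i x + b i x))) (at x)" for x
    using has_derivative_add[OF a(2) b(2)] by (simp add: distrib_left sum.distrib)
  then show ?case using a(1) b(1) by (intro exI[of _ "\<lambda>i x. a i x + b i x"]) (simp add: poly_add)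
next
  case (mult f g)
  then obtain a b where a: "\<And>i. real_polynomial_function (a i)"
      "\<And>x. (f has_derivative (\<lambda>v. \<Sum>i\<in>UNIV. v $ i * a i x)) (at x)"
    and b: "\<And>i. real_polynomial_function (b i)"
      "\<And>x. (g has_derivative (\<lambda>v. \<Sum>i\<in>UNIV. v $ i * b i x)) (at x)" by blast
  have "((\<lambda>x. f x * g x) has_derivative (\<lambda>v. \<Sum>i\<in>UNIV. v $ i * (f x * b i x + a i x * g x))) (at x)" for x
    using has_derivative_mult[OF a(2) b(2)]
    by (simp add: distrib_left sum.distrib sum_distrib_left sum_distrib_right mult_ac)
  then show ?case using a(1) b(1) mult(1,2)
    by (intro exI[of _ "\<lambda>i x. f x * b i x + a i x * g x"]) (simp add: poly_add poly_mult)
qed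

lemma partial_eqI:
  assumes "(p has_derivative (\<lambda>v. \<Sum>i\<in>UNIV. v $ i * q i x)) (at x)"
  shows "partial i p x = q i x"
proof -
  have "((\<lambda>t. x + t *\<^sub>R axis i 1) has_derivative (\<lambda>t. t *\<^sub>R axis i (1::real))) (at 0)"
    by (auto intro!: derivative_eq_intros)
  moreover have "(p has_derivative (\<lambda>v. \<Sum>i\<in>UNIV. v $ i * q i x)) (at (x + 0 *\<^sub>R axis i 1))"
    using assms by simp
  ultimately have "((\<lambda>t. p (x + t *\<^sub>R axis i 1)) has_derivative
      (\<lambda>t. \<Sum>j\<in>UNIV. (t *\<^sub>R axis i (1::real)) $ j * q j x)) (at 0)"
    by (rule has_derivative_compose)
  also have "(\<lambda>t. \<Sum>j\<in>UNIV. (t *\<^sub>R axis i (1::real)) $ j * q j x) = (*) (q i x)"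
    by (auto simp: fun_eq_iff axis_def if_distrib if_distribR sum.delta cong: if_cong)
  finally show ?thesis
    unfolding partial_def has_field_derivative_def[symmetric] by (rule DERIV_imp_deriv)
qed

lemma
  fixes p :: "real^'n \<Rightarrow> real"
  assumes "real_polynomial_function p"
  shows polynomial_partial [intro]: "real_polynomial_function (partial i p)"
    and has_derivative_partial: "(p has_derivative (\<lambda>v. \<Sum>i\<in>UNIV. v $ i * partial i p x)) (at x)"
proof -
  obtain q where q: "\<And>i. real_polynomial_function (q i)"
     "\<And>x. (p has_derivative (\<lambda>v. \<Sum>i\<in>UNIV. v $ i * q i x)) (at x)"
    using polynomial_gradient_exists[OF assms] by blast
  have "partial i p = q i" for i
    by (rule ext) (rule partial_eqI[OF q(2)])
  then show "real_polynomial_function (partial i p)"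
    "(p has_derivative (\<lambda>v. \<Sum>i\<in>UNIV. v $ i * partial i p x)) (at x)" using q by simp_all
qed

lemma polynomial_coordinate [intro]: "real_polynomial_function (\<lambda>x::real^'n. x $ i)"
  by (rule poly_linear) (rule bounded_linear_vec_nth)

lemma partial_linear: "bounded_linear f \<Longrightarrow> partial i f = (\<lambda>x. f (axis i 1))"
  using bounded_linear_imp_has_derivative[of f]
  by (intro ext partial_eqI[where q="\<lambda>i x. f (axis i 1)"]) (simp add: bounded_linear.linear flip: linear_expand_axis)

lemma partial_coordinate: "partial i (\<lambda>x. x $ j) = (\<lambda>x. if i = j then 1 else 0)"
  by (simp add: partial_linear[OF bounded_linear_vec_nth] axis_def fun_eq_iff)

lemma partial_const: "partial i (\<lambda>x. c) = (\<lambda>x. 0)"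
  using partial_eqI[of "\<lambda>x. c" "\<lambda>i x. 0"] by (auto simp: fun_eq_iff)

lemma partial_add:
  assumes "real_polynomial_function p" "real_polynomial_function q"
  shows "partial i (\<lambda>x. p x + q x) = (\<lambda>x. partial i p x + partial i q x)"
proof
  fix x
  show "partial i (\<lambda>x. p x + q x) x = partial i p x + partial i q x"
    using has_derivative_add[OF has_derivative_partial[OF assms(1)] has_derivative_partial[OF assms(2)], of x]
    by (intro partial_eqI[where q="\<lambda>i x. partial i p x + partial i q x"]) (simp add: distrib_left sum.distrib)
qed

lemma partial_mult:
  assumes "real_polynomial_function p" "real_polynomial_function q"
  shows "partial i (\<lambda>x. p x * q x) = (\<lambda>x. p x * partial i q x + partial i p x * q x)"
proof
  fix x
  show "partial i (\<lambda>x. p x * q x) x = p x * partial i q x + partial i p x * q x"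
    using has_derivative_mult[OF has_derivative_partial[OF assms(1)] has_derivative_partial[OF assms(2)], of x]
    by (intro partial_eqI[where q="\<lambda>i x. p x * partial i q x + partial i p x * q x"])
      (simp add: distrib_left sum.distrib sum_distrib_left sum_distrib_right mult_ac)
qed

lemma partial_cmult:
  assumes "real_polynomial_function p"
  shows "partial i (\<lambda>x. c * p x) = (\<lambda>x. c * partial i p x)"
  using partial_mult[OF poly_const assms, of i c] by (simp add: partial_const)

lemma partial_diff:
  assumes "real_polynomial_function p" "real_polynomial_function q"
  shows "partial i (\<lambda>x. p x - q x) = (\<lambda>x. partial i p x - partial i q x)"
proof -
  have "real_polynomial_function (\<lambda>x. -1 * q x)" using assms by (intro poly_mult poly_const)
  from partial_add[OF assms(1) this, of i] partial_cmult[OF assms(2), of i "-1"] show ?thesis by simp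
qed

lemma partial_sum:
  assumes "\<And>j. j \<in> A \<Longrightarrow> real_polynomial_function (p j)" "finite A"
  shows "partial i (\<lambda>x. \<Sum>j\<in>A. p j x) = (\<lambda>x. \<Sum>j\<in>A. partial i (p j) x)"
  using assms(2,1)
  by (induction A) (simp_all add: partial_const partial_add real_polynomial_function_sum)

lemma partial_commute:
  assumes "real_polynomial_function p"
  shows "partial i (partial j p) = partial j (partial i p)"
  using assms
proof (induction p rule: real_polynomial_function.induct)
  case (linear f)
  then show ?case by (simp add: partial_linear partial_const)
next
  case (const c)
  then show ?case by (simp add: partial_const)
next
  case (add f g)
  then show ?case by (simp add: partial_add polynomial_partial)
next
  case (mult f g)
  then show ?case
    by (simp add: partial_add partial_mult polynomial_partial poly_mult) (simp add: fun_eq_iff add_ac)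
qed

lemma laplacian_eq_sum_partial:
  fixes p :: "real^'n \<Rightarrow> real"
  assumes p: "real_polynomial_function p"
  shows "laplacian p x = (\<Sum>i\<in>UNIV. partial i (partial i p) x)"
proof -
  have der: "deriv (\<lambda>t. q (y + t *\<^sub>R axis i 1)) t = partial i q (y + t *\<^sub>R axis i 1)"
    if "real_polynomial_function q" for q y i t
  proof -
    have "((\<lambda>s. q (y + t *\<^sub>R axis i 1 + s *\<^sub>R axis i 1)) has_real_derivative partial i q (y + t *\<^sub>R axis i 1)) (at 0)"
    proof -
      have "((\<lambda>s. y + t *\<^sub>R axis i 1 + s *\<^sub>R axis i 1) has_derivative (\<lambda>s. s *\<^sub>R axis i (1::real))) (at 0)"
        by (auto intro!: derivative_eq_intros)
      then have "((\<lambda>s. q (y + t *\<^sub>R axis i 1 + s *\<^sub>R axis i 1)) has_derivative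
         (\<lambda>s. \<Sum>j\<in>UNIV. (s *\<^sub>R axis i (1::real)) $ j * partial j q (y + t *\<^sub>R axis i 1))) (at 0)"
        by (rule has_derivative_compose) (simp add: has_derivative_partial[OF that])
      also have "(\<lambda>s. \<Sum>j\<in>UNIV. (s *\<^sub>R axis i (1::real)) $ j * partial j q (y + t *\<^sub>R axis i 1)) =
          (*) (partial i q (y + t *\<^sub>R axis i 1))"
        by (auto simp: fun_eq_iff axis_def if_distrib if_distribR sum.delta cong: if_cong)
      finally show ?thesis unfolding has_field_derivative_def .
    qed
    then have "((\<lambda>s. q (y + (t + s) *\<^sub>R axis i 1)) has_real_derivative partial i q (y + t *\<^sub>R axis i 1)) (at 0)"
      by (simp add: scaleR_add_left add.assoc)
    then show ?thesis
      using DERIV_at_within_shift[of "\<lambda>s. q (y + s *\<^sub>R axis i 1)" "partial i q (y + t *\<^sub>R axis i 1)" t 0 UNIV]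
      by (auto intro!: DERIV_imp_deriv)
  qed
  have d2: "(deriv ^^ 2) (\<lambda>t. p (x + t *\<^sub>R axis i 1)) 0 = partial i (partial i p) x" for i
  proof -
    have "deriv (\<lambda>t. p (x + t *\<^sub>R axis i 1)) = (\<lambda>t. partial i p (x + t *\<^sub>R axis i 1))"
      using der[OF p] by blast
    then show ?thesis using der[of "partial i p" x i 0] p by (simp add: numeral_2_eq_2 polynomial_partial)
  qed
  have B: "(Basis :: (real^'n) set) = range (\<lambda>i. axis i 1)" by (auto simp: Basis_vec_def)
  have "inj (\<lambda>i. axis i 1 :: real^'n)" by (simp add: inj_on_def axis_eq_axis)
  then show ?thesis
    unfolding laplacian_def B by (simp only: sum.reindex o_def d2)
qed

lemma partial_compose_linear:
  fixes p :: "real^'n \<Rightarrow> real"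
  assumes p: "real_polynomial_function p" and U: "linear U"
  shows "partial i (\<lambda>x. p (U x)) x = (\<Sum>j\<in>UNIV. U (axis i 1) $ j * partial j p (U x))"
proof (rule partial_eqI)
  have bl: "bounded_linear U" using U by (simp add: linear_conv_bounded_linear)
  have lin: "linear (\<lambda>v. \<Sum>j\<in>UNIV. U v $ j * partial j p (U x))"
    by (rule linearI) (simp_all add: linear_add[OF U] linear_scale[OF U] distrib_right sum.distrib sum_distrib_left mult.assoc)
  have "((\<lambda>x. p (U x)) has_derivative (\<lambda>v. \<Sum>j\<in>UNIV. U v $ j * partial j p (U x))) (at x)"
    by (rule has_derivative_compose[OF bounded_linear_imp_has_derivative[OF bl] has_derivative_partial[OF p]])
  also have "(\<lambda>v. \<Sum>j\<in>UNIV. U v $ j * partial j p (U x)) =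
     (\<lambda>v. \<Sum>i\<in>UNIV. v $ i * (\<Sum>j\<in>UNIV. U (axis i 1) $ j * partial j p (U x)))"
    by (rule ext) (rule linear_expand_axis[OF lin])
  finally show "((\<lambda>x. p (U x)) has_derivative
     (\<lambda>v. \<Sum>i\<in>UNIV. v $ i * (\<Sum>j\<in>UNIV. U (axis i 1) $ j * partial j p (U x)))) (at x)" .
qed

lemma polynomial_compose_linear:
  "real_polynomial_function p \<Longrightarrow> linear U \<Longrightarrow> real_polynomial_function (\<lambda>x. p (U (x::real^'n)) :: real)"
  using real_polynomial_function_compose[of U p] by (simp add: o_def linear_conv_bounded_linear polynomial_function_bounded_linear)

lemma polynomial_continuous_on: "real_polynomial_function p \<Longrightarrow> continuous_on S p"
  by (simp add: continuous_at_imp_continuous_on continuous_real_polymonial_function)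

section \<open>Homogeneous harmonic polynomials and infinitesimal rotations\<close>

text \<open>The derivative along the rotations of the \<open>(i, j)\<close> coordinate plane (an angular momentum operator).\<close>

definition rotgen :: "'n \<Rightarrow> 'n \<Rightarrow> (real^'n::finite \<Rightarrow> real) \<Rightarrow> real^'n \<Rightarrow> real" where
  "rotgen i j p x = x $ i * partial j p x - x $ j * partial i p x"

lemma polynomial_rotgen [intro]: "real_polynomial_function p \<Longrightarrow> real_polynomial_function (rotgen i j p)"
  unfolding rotgen_def[abs_def]
  by (intro real_polynomial_function_diff poly_mult polynomial_coordinate polynomial_partial)

lemma harmonic_iff:
  fixes p :: "real^'n \<Rightarrow> real"
  shows "p \<in> homogeneous_harmonic_polynomials k \<longleftrightarrow> real_polynomial_function p \<and>
    (\<forall>c x. p (c *\<^sub>R x) = c ^ k * p x) \<and> (\<forall>x. (\<Sum>i\<in>UNIV. partial i (partial i p) x) = 0)"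
  unfolding homogeneous_harmonic_polynomials_def by (auto simp: laplacian_eq_sum_partial)

lemma harmonic_polynomial: "p \<in> homogeneous_harmonic_polynomials k \<Longrightarrow> real_polynomial_function p"
  by (simp add: homogeneous_harmonic_polynomials_def)

text \<open>Euler's identity: differentiate \<open>p (c x) = c\<^sup>k p x\<close> in \<open>c\<close> at \<open>1\<close>.\<close>

lemma euler_homogeneous:
  fixes p :: "real^'n \<Rightarrow> real"
  assumes p: "real_polynomial_function p" and hom: "\<And>c x. p (c *\<^sub>R x) = c ^ k * p x"
  shows "(\<Sum>i\<in>UNIV. x $ i * partial i p x) = real k * p x"
proof -
  have "((\<lambda>c. c *\<^sub>R x) has_derivative (\<lambda>c. c *\<^sub>R x)) (at 1)"
    by (auto intro!: derivative_eq_intros)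
  then have "((\<lambda>c. p (c *\<^sub>R x)) has_derivative (\<lambda>c. \<Sum>i\<in>UNIV. (c *\<^sub>R x) $ i * partial i p x)) (at 1)"
    by (rule has_derivative_compose) (simp add: has_derivative_partial[OF p])
  also have "(\<lambda>c. \<Sum>i\<in>UNIV. (c *\<^sub>R x) $ i * partial i p x) = (*) (\<Sum>i\<in>UNIV. x $ i * partial i p x)"
    by (auto simp: fun_eq_iff sum_distrib_left sum_distrib_right mult_ac)
  finally have "((\<lambda>c. c ^ k * p x) has_real_derivative (\<Sum>i\<in>UNIV. x $ i * partial i p x)) (at 1)"
    by (simp add: hom has_field_derivative_def)
  moreover have "((\<lambda>c. c ^ k * p x) has_real_derivative real k * p x) (at 1)"
    by (auto intro!: derivative_eq_intros)
  ultimately show ?thesis by (rule DERIV_unique)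
qed

text \<open>Each unordered pair of coordinates occurs twice, so the left side is twice the Laplace--Beltrami operator.  In the
  expansion of the squares the second derivatives form the Laplacian, which vanishes, and the radial second derivative;
  the latter and the first order terms are multiples of \<open>p\<close> by Euler's identity for \<open>p\<close> and for its partial derivatives.\<close>

lemma harmonic_casimir:
  fixes p :: "real^'n \<Rightarrow> real"
  assumes p: "p \<in> homogeneous_harmonic_polynomials k"
  shows "(\<Sum>i\<in>UNIV. \<Sum>j\<in>UNIV. rotgen i j (rotgen i j p) x) = - (2 * sphere_eigenvalue TYPE(real^'n) k * p x)"
proof -
  note poly = harmonic_polynomial[OF p]
  define d1 where "d1 i = partial i p x" for i
  define d2 where "d2 i j = partial i (partial j p) x" for i j
  have d2c: "d2 i j = d2 j i" for i j by (simp add: d2_def partial_commute[OF poly])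
  have D1: "partial l (rotgen i j p) x =
     (x $ i * d2 l j + (if l = i then 1 else 0) * d1 j) - (x $ j * d2 l i + (if l = j then 1 else 0) * d1 i)" for l i j
    unfolding rotgen_def[abs_def] d1_def d2_def
    using poly by (subst partial_diff) (auto simp: partial_mult[OF polynomial_coordinate polynomial_partial] partial_coordinate)
  have XX: "rotgen i j (rotgen i j p) x =
      (x$i)^2 * d2 j j + (x$j)^2 * d2 i i - 2 * (x$i * x$j * d2 i j) - x$i * d1 i - x$j * d1 j
      + (if i = j then 2 * (x $ i * d1 i) else 0)" for i j
  proof -
    have "rotgen i j (rotgen i j p) x = x $ i * partial j (rotgen i j p) x - x $ j * partial i (rotgen i j p) x"
      by (simp add: rotgen_def)
    also have "\<dots> = x $ i * ((x $ i * d2 j j + (if j = i then 1 else 0) * d1 j) - (x $ j * d2 j i + d1 i)) -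
        x $ j * ((x $ i * d2 i j + d1 j) - (x $ j * d2 i i + (if i = j then 1 else 0) * d1 i))"
      by (simp only: D1) simp
    also have "\<dots> = (x$i)^2 * d2 j j + (x$j)^2 * d2 i i - 2 * (x$i * x$j * d2 i j) - x$i * d1 i - x$j * d1 j
      + (if i = j then 2 * (x $ i * d1 i) else 0)"
      by (simp add: algebra_simps power2_eq_square d2c[of j i])
    finally show ?thesis .
  qed
  have E1: "(\<Sum>i\<in>UNIV. x $ i * d1 i) = real k * p x"
    unfolding d1_def using p poly by (intro euler_homogeneous) (auto simp: harmonic_iff)
  have E2: "(\<Sum>i\<in>UNIV. \<Sum>j\<in>UNIV. x$i * x$j * d2 i j) = (real k)^2 * p x - real k * p x"
  proof -
    have eq: "(\<lambda>x. \<Sum>i\<in>UNIV. x $ i * partial i p x) = (\<lambda>x. real k * p x)"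
      using p poly by (intro ext euler_homogeneous) (auto simp: harmonic_iff)
    have "partial j (\<lambda>x. \<Sum>i\<in>UNIV. x $ i * partial i p x) x = (\<Sum>i\<in>UNIV. x $ i * d2 j i) + d1 j" for j
      using poly by (subst partial_sum)
        (auto simp: partial_mult[OF polynomial_coordinate polynomial_partial] partial_coordinate d1_def d2_def
          sum.distrib if_one_mult intro!: poly_mult)
    then have "(\<Sum>i\<in>UNIV. x $ i * d2 j i) + d1 j = real k * d1 j" for j
      unfolding eq by (simp add: partial_cmult[OF poly] d1_def)
    then have "(\<Sum>i\<in>UNIV. x $ i * d2 j i) = real k * d1 j - d1 j" for j by (metis add_diff_cancel_right')
    then have "(\<Sum>j\<in>UNIV. x $ j * (\<Sum>i\<in>UNIV. x $ i * d2 j i)) = (\<Sum>j\<in>UNIV. x $ j * (real k * d1 j - d1 j))" by simp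
    also have "\<dots> = real k * (\<Sum>j\<in>UNIV. x $ j * d1 j) - (\<Sum>j\<in>UNIV. x $ j * d1 j)"
      by (simp add: sum_distrib_left sum_subtractf algebra_simps)
    finally show ?thesis by (simp add: E1 sum_distrib_left mult.assoc power2_eq_square)
  qed
  have L: "(\<Sum>i\<in>UNIV. d2 i i) = 0" unfolding d2_def using p by (simp add: harmonic_iff)
  have s1: "(\<Sum>i\<in>UNIV. \<Sum>j\<in>UNIV. (x$i)^2 * d2 j j) = 0"
    by (simp add: sum_distrib_left[symmetric] L)
  have s2: "(\<Sum>i\<in>UNIV. \<Sum>j\<in>UNIV. (x$j)^2 * d2 i i) = 0"
    by (simp add: sum_distrib_right[symmetric] sum_distrib_left[symmetric] L)
  have s3: "(\<Sum>i\<in>UNIV. \<Sum>j\<in>(UNIV::'n set). x$i * d1 i) = real CARD('n) * (real k * p x)"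
    by (simp add: sum_distrib_left[symmetric] E1)
  have s4: "(\<Sum>i\<in>(UNIV::'n set). \<Sum>j\<in>UNIV. x$j * d1 j) = real CARD('n) * (real k * p x)"
    by (simp add: E1)
  have s5: "(\<Sum>i\<in>UNIV. \<Sum>j\<in>(UNIV::'n set). if i = j then 2 * (x $ i * d1 i) else 0) = 2 * (real k * p x)"
    by (simp add: sum.delta' sum_distrib_left[symmetric] E1)
  have s6: "(\<Sum>i\<in>UNIV. \<Sum>j\<in>UNIV. 2 * (x$i * x$j * d2 i j)) = 2 * ((real k)^2 * p x - real k * p x)"
    by (simp only: sum_distrib_left[symmetric] E2)
  have "(\<Sum>i\<in>UNIV. \<Sum>j\<in>UNIV. rotgen i j (rotgen i j p) x) =
     - 2 * ((real k)^2 * p x - real k * p x) - 2 * (real CARD('n) * (real k * p x)) + 2 * (real k * p x)"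
    unfolding XX by (simp only: sum.distrib sum_subtractf s1 s2 s3 s4 s5 s6)
  then show ?thesis
    by (simp add: sphere_eigenvalue_def algebra_simps power2_eq_square)
qed

text \<open>Infinitesimal rotations commute with the Laplacian and with dilations.\<close>

lemma rotgen_harmonic:
  fixes p :: "real^'n \<Rightarrow> real"
  assumes p: "p \<in> homogeneous_harmonic_polynomials k"
  shows "rotgen i j p \<in> homogeneous_harmonic_polynomials k"
  unfolding harmonic_iff
proof (intro conjI allI)
  note poly = harmonic_polynomial[OF p]
  show "real_polynomial_function (rotgen i j p)" using poly by blast
  have hom: "c * partial l p (c *\<^sub>R x) = c ^ k * partial l p x" for c l x
  proof -
    have "partial l (\<lambda>x. p (c *\<^sub>R x)) x = (\<Sum>j\<in>UNIV. (c *\<^sub>R axis l 1 :: real^'n) $ j * partial j p (c *\<^sub>R x))"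
      by (rule partial_compose_linear[OF poly]) (simp add: linear_iff scaleR_add_right)
    also have "\<dots> = c * partial l p (c *\<^sub>R x)"
      by (simp add: axis_def if_distrib if_distribR sum.delta cong: if_cong)
    finally show ?thesis using p by (simp add: harmonic_iff partial_cmult[OF poly])
  qed
  show "rotgen i j p (c *\<^sub>R x) = c ^ k * rotgen i j p x" for c x
  proof -
    have "rotgen i j p (c *\<^sub>R x) = x $ i * (c * partial j p (c *\<^sub>R x)) - x $ j * (c * partial i p (c *\<^sub>R x))"
      by (simp add: rotgen_def)
    then show ?thesis unfolding hom by (simp add: rotgen_def algebra_simps)
  qed
  fix x
  have D1: "partial l (rotgen i j p) = (\<lambda>x. (x $ i * partial l (partial j p) x + (if l = i then 1 else 0) * partial j p x)
      - (x $ j * partial l (partial i p) x + (if l = j then 1 else 0) * partial i p x))" for l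
    unfolding rotgen_def[abs_def]
    using poly by (subst partial_diff) (auto simp: partial_mult[OF polynomial_coordinate polynomial_partial] partial_coordinate)
  have D2: "partial l (partial l (rotgen i j p)) x = x $ i * partial l (partial l (partial j p)) x
      + (if l = i then 2 * partial i (partial j p) x else 0)
      - x $ j * partial l (partial l (partial i p)) x - (if l = j then 2 * partial j (partial i p) x else 0)" for l
    unfolding D1
    using poly by (subst partial_diff)
      (auto simp: partial_add partial_mult[OF polynomial_coordinate polynomial_partial] partial_coordinate partial_cmult polynomial_partial
        poly_add poly_mult poly_const polynomial_coordinate)
  have L: "(\<Sum>l\<in>UNIV. partial l (partial l (partial m p)) x) = 0" for m
  proof -
    have "(\<Sum>l\<in>UNIV. partial l (partial l (partial m p)) x) = (\<Sum>l\<in>UNIV. partial m (partial l (partial l p)) x)"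
      by (simp add: partial_commute[OF poly, of _ m] partial_commute[OF polynomial_partial[OF poly], of _ m])
    also have "\<dots> = partial m (\<lambda>x. \<Sum>l\<in>UNIV. partial l (partial l p) x) x"
      using poly by (subst partial_sum) auto
    also have "\<dots> = 0" using p by (simp add: harmonic_iff partial_const)
    finally show ?thesis .
  qed
  show "(\<Sum>l\<in>UNIV. partial l (partial l (rotgen i j p)) x) = 0"
    unfolding D2 by (simp add: sum.distrib sum_subtractf sum_distrib_left[symmetric] L partial_commute[OF poly, of j i])
qed

lemma compose_orthogonal_harmonic:
  fixes p :: "real^'n \<Rightarrow> real" and U :: "real^'n \<Rightarrow> real^'n"
  assumes p: "p \<in> homogeneous_harmonic_polynomials k" and U: "orthogonal_transformation U"
  shows "(\<lambda>x. p (U x)) \<in> homogeneous_harmonic_polynomials k"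
  unfolding harmonic_iff[of "\<lambda>x. p (U x)"]
proof (intro conjI allI)
  note poly = harmonic_polynomial[OF p]
  have lin: "linear U" using U by (rule orthogonal_transformation_linear)
  show "real_polynomial_function (\<lambda>x. p (U x))" by (rule polynomial_compose_linear[OF poly lin])
  show "p (U (c *\<^sub>R x)) = c ^ k * p (U x)" for c x
    using p by (simp add: harmonic_iff linear_scale[OF lin])
  fix x
  have D2: "partial i (partial i (\<lambda>x. p (U x))) x =
    (\<Sum>j\<in>UNIV. \<Sum>l\<in>UNIV. (U (axis i 1) $ j * U (axis i 1) $ l) * partial l (partial j p) (U x))" for i
  proof -
    have "partial i (partial i (\<lambda>x. p (U x))) x = partial i (\<lambda>x. \<Sum>j\<in>UNIV. U (axis i 1) $ j * partial j p (U x)) x"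
      using partial_compose_linear[OF poly lin] by presburger
    also have "\<dots> = (\<Sum>j\<in>UNIV. U (axis i 1) $ j * partial i (\<lambda>x. partial j p (U x)) x)"
      using poly by (subst partial_sum)
        (auto simp: partial_cmult polynomial_compose_linear[OF _ lin] polynomial_partial
          intro!: poly_mult)
    finally show ?thesis
      using poly by (simp add: partial_compose_linear[OF _ lin] polynomial_partial sum_distrib_left mult.assoc)
  qed
  have orth: "(\<Sum>i\<in>UNIV. U (axis i 1) $ j * U (axis i 1) $ l) = (if j = l then 1 else 0)" for j l
  proof -
    have "matrix U ** transpose (matrix U) = mat 1"
      using U by (simp add: orthogonal_transformation_matrix orthogonal_matrix_def)
    then have "(matrix U ** transpose (matrix U)) $ j $ l = mat 1 $ j $ l" by simp
    then show ?thesis by (simp add: matrix_matrix_mult_def transpose_def matrix_def mat_def)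
  qed
  have "(\<Sum>i\<in>UNIV. partial i (partial i (\<lambda>x. p (U x))) x) =
    (\<Sum>i\<in>UNIV. \<Sum>j\<in>UNIV. \<Sum>l\<in>UNIV. (U (axis i 1) $ j * U (axis i 1) $ l) * partial l (partial j p) (U x))"
    by (simp add: D2)
  also have "\<dots> = (\<Sum>j\<in>UNIV. \<Sum>i\<in>UNIV. \<Sum>l\<in>UNIV. (U (axis i 1) $ j * U (axis i 1) $ l) * partial l (partial j p) (U x))"
    by (rule sum.swap)
  also have "\<dots> = (\<Sum>j\<in>UNIV. \<Sum>l\<in>UNIV. \<Sum>i\<in>UNIV. (U (axis i 1) $ j * U (axis i 1) $ l) * partial l (partial j p) (U x))"
    by (rule sum.cong[OF refl], rule sum.swap)
  also have "\<dots> = (\<Sum>j\<in>UNIV. \<Sum>l\<in>UNIV. (if j = l then 1 else 0) * partial l (partial j p) (U x))"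
    by (simp only: sum_distrib_right[symmetric] orth)
  also have "\<dots> = (\<Sum>j\<in>UNIV. partial j (partial j p) (U x))"
    by (simp add: if_one_mult sum.delta')
  also have "\<dots> = 0" using p by (simp add: harmonic_iff)
  finally show "(\<Sum>i\<in>UNIV. partial i (partial i (\<lambda>x. p (U x))) x) = 0" .
qed

lemma harmonic_add:
  fixes p q :: "real^'n \<Rightarrow> real"
  assumes p: "p \<in> homogeneous_harmonic_polynomials k" and q: "q \<in> homogeneous_harmonic_polynomials k"
  shows "(\<lambda>x. p x + q x) \<in> homogeneous_harmonic_polynomials k"
  unfolding harmonic_iff[of "\<lambda>x. p x + q x"]
proof (intro conjI allI)
  note poly = harmonic_polynomial[OF p] harmonic_polynomial[OF q]
  show "real_polynomial_function (\<lambda>x. p x + q x)" by (rule poly_add[OF poly])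
  show "p (c *\<^sub>R x) + q (c *\<^sub>R x) = c ^ k * (p x + q x)" for c x
    using p q unfolding harmonic_iff by (metis distrib_left)
  have "partial i (partial i (\<lambda>x. p x + q x)) x = partial i (partial i p) x + partial i (partial i q) x" for i x
    by (simp only: partial_add[OF poly] partial_add[OF polynomial_partial[OF poly(1)] polynomial_partial[OF poly(2)]])
  then show "(\<Sum>i\<in>UNIV. partial i (partial i (\<lambda>x. p x + q x)) x) = 0" for x
    using p q unfolding harmonic_iff by (simp only: sum.distrib)
qed

lemma harmonic_cmult:
  fixes p :: "real^'n \<Rightarrow> real"
  assumes p: "p \<in> homogeneous_harmonic_polynomials k"
  shows "(\<lambda>x. c * p x) \<in> homogeneous_harmonic_polynomials k"
  unfolding harmonic_iff[of "\<lambda>x. c * p x"]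
proof (intro conjI allI)
  note poly = harmonic_polynomial[OF p]
  show "real_polynomial_function (\<lambda>x. c * p x)" by (rule poly_mult[OF poly_const poly])
  show "c * p (a *\<^sub>R x) = a ^ k * (c * p x)" for a x
    using p unfolding harmonic_iff by (metis mult.left_commute)
  have "partial i (partial i (\<lambda>x. c * p x)) x = c * partial i (partial i p) x" for i x
    by (simp only: partial_cmult[OF poly] partial_cmult[OF polynomial_partial[OF poly]])
  then show "(\<Sum>i\<in>UNIV. partial i (partial i (\<lambda>x. c * p x)) x) = 0" for x
    using p unfolding harmonic_iff by (simp only: sum_distrib_left[symmetric])
qed

section \<open>Rotations of a coordinate plane\<close>

text \<open>For \<open>i \<noteq> j\<close> this is the rotation by \<open>\<theta>\<close> in the \<open>(i, j)\<close> coordinate plane, written as a perturbation of the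
  identity.\<close>

definition plane_rot :: "'n \<Rightarrow> 'n \<Rightarrow> real \<Rightarrow> real^'n::finite \<Rightarrow> real^'n" where
  "plane_rot i j \<theta> x = x + ((cos \<theta> - 1) * x $ i - sin \<theta> * x $ j) *\<^sub>R axis i 1
     + (sin \<theta> * x $ i + (cos \<theta> - 1) * x $ j) *\<^sub>R axis j 1"

lemma plane_rot_nth:
  "i \<noteq> j \<Longrightarrow> plane_rot i j \<theta> x $ l = (if l = i then cos \<theta> * x $ i - sin \<theta> * x $ j
     else if l = j then sin \<theta> * x $ i + cos \<theta> * x $ j else x $ l)"
  by (auto simp: plane_rot_def axis_def algebra_simps)

lemma inner_plane_rot:
  fixes x :: "real^'n"
  assumes "i \<noteq> j"
  shows "x \<bullet> plane_rot i j \<theta> x = x \<bullet> x - (1 - cos \<theta>) * ((x $ i)^2 + (x $ j)^2)"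
  by (simp add: plane_rot_def inner_add_right inner_axis algebra_simps power2_eq_square)

lemma orthogonal_plane_rot:
  fixes i j :: "'n::finite"
  assumes ij: "i \<noteq> j"
  shows "orthogonal_transformation (plane_rot i j \<theta> :: real^'n \<Rightarrow> real^'n)"
  unfolding orthogonal_transformation
proof (intro conjI allI)
  show "linear (plane_rot i j \<theta>)"
    by (rule linearI) (auto simp: vec_eq_iff plane_rot_nth[OF ij] algebra_simps)
  fix x :: "real^'n"
  have ax: "axis i (1::real) $ j = 0" "axis j (1::real) $ i = 0" "axis i (1::real) $ i = 1" "axis j (1::real) $ j = 1"
    using ij by (auto simp: axis_def)
  define a where "a = (cos \<theta> - 1) * x $ i - sin \<theta> * x $ j"
  define b where "b = sin \<theta> * x $ i + (cos \<theta> - 1) * x $ j"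
  have "plane_rot i j \<theta> x \<bullet> plane_rot i j \<theta> x = x \<bullet> x + (2 * a * x $ i + 2 * b * x $ j + a^2 + b^2)"
    unfolding plane_rot_def a_def[symmetric] b_def[symmetric]
    by (simp add: inner_add_left inner_add_right inner_axis inner_axis' ax power2_eq_square algebra_simps)
  moreover have "2 * a * x $ i + 2 * b * x $ j + a^2 + b^2 = 0"
    using sin_cos_squared_add[of \<theta>] unfolding a_def b_def by algebra
  ultimately show "norm (plane_rot i j \<theta> x) = norm x" by (simp add: norm_eq_sqrt_inner)
qed

lemma plane_rot_minus [simp]: "i \<noteq> j \<Longrightarrow> plane_rot i j (- \<theta>) (plane_rot i j \<theta> x) = x"
proof -
  assume ij: "i \<noteq> j"
  have "cos \<theta> * (cos \<theta> * a - sin \<theta> * b) + sin \<theta> * (sin \<theta> * a + cos \<theta> * b) = a"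
    "cos \<theta> * (sin \<theta> * a + cos \<theta> * b) - sin \<theta> * (cos \<theta> * a - sin \<theta> * b) = b" for a b
    using sin_cos_squared_add[of \<theta>] by algebra+
  then show ?thesis using ij by (auto simp: vec_eq_iff plane_rot_nth)
qed

lemma plane_rot_0 [simp]: "plane_rot i j 0 x = x"
  by (simp add: plane_rot_def)

lemma plane_rot_deriv:
  fixes p :: "real^'n \<Rightarrow> real"
  assumes p: "real_polynomial_function p" and ij: "i \<noteq> j"
  shows "((\<lambda>\<theta>. p (plane_rot i j \<theta> x)) has_real_derivative rotgen i j p (plane_rot i j \<theta> x)) (at \<theta>)"
proof -
  let ?v = "(- (plane_rot i j \<theta> x $ j)) *\<^sub>R axis i 1 + (plane_rot i j \<theta> x $ i) *\<^sub>R axis j (1::real)"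
  have ax: "axis i (1::real) $ j = 0" "axis j (1::real) $ i = 0" "axis i (1::real) $ i = 1" "axis j (1::real) $ j = 1"
    using ij by (auto simp: axis_def)
  have "((\<lambda>\<theta>. plane_rot i j \<theta> x) has_derivative (\<lambda>t. t *\<^sub>R ?v)) (at \<theta>)"
    unfolding plane_rot_nth[OF ij] plane_rot_def[abs_def]
    using ij by (auto intro!: derivative_eq_intros simp: fun_eq_iff algebra_simps ax)
  then have "((\<lambda>\<theta>. p (plane_rot i j \<theta> x)) has_derivative
     (\<lambda>t. \<Sum>l\<in>UNIV. (t *\<^sub>R ?v) $ l * partial l p (plane_rot i j \<theta> x))) (at \<theta>)"
    by (rule has_derivative_compose[OF _ has_derivative_partial[OF p]])
  moreover have "(\<Sum>l\<in>UNIV. (t *\<^sub>R ?v) $ l * partial l p (plane_rot i j \<theta> x)) = rotgen i j p (plane_rot i j \<theta> x) * t" for t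
  proof -
    have "(\<Sum>l\<in>UNIV. (t *\<^sub>R ?v) $ l * partial l p y) =
      (\<Sum>l\<in>UNIV. if l = i then - t * plane_rot i j \<theta> x $ j * partial l p y else 0) +
      (\<Sum>l\<in>UNIV. if l = j then t * plane_rot i j \<theta> x $ i * partial l p y else 0)" for y
      using ij by (subst sum.distrib[symmetric], intro sum.cong) (auto simp: axis_def)
    note sum_eq = this
    show ?thesis unfolding sum_eq by (simp add: rotgen_def) (simp add: algebra_simps)
  qed
  ultimately show ?thesis by (simp add: has_field_derivative_def mult_commute_abs)
qed


section \<open>The inner product of the sphere\<close>

definition sip :: "('a::euclidean_space \<Rightarrow> real) \<Rightarrow> ('a \<Rightarrow> real) \<Rightarrow> real" where
  "sip f g = (LINT x|sphere_measure. f x * g x)"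

abbreviation sphere_continuous :: "('a::euclidean_space \<Rightarrow> real) \<Rightarrow> bool" where
  "sphere_continuous f \<equiv> continuous_on (sphere 0 1) f"

lemma sip_commute: "sip f g = sip g f"
  by (simp add: sip_def mult.commute)

lemma sip_cong:
  assumes "\<And>x. x \<in> sphere 0 1 \<Longrightarrow> f x = f' x" "\<And>x. x \<in> sphere 0 1 \<Longrightarrow> g x = g' x"
  shows "sip f g = sip f' g'"
  unfolding sip_def by (rule Bochner_Integration.integral_cong) (use assms in auto)

lemma sip_integrable:
  assumes "sphere_continuous f" "sphere_continuous g"
  shows "integrable sphere_measure (\<lambda>x. f x * g x)"
  by (intro integrable_sphere_continuous continuous_on_mult assms)

lemma sip_diff_left:
  assumes "sphere_continuous f" "sphere_continuous g" "sphere_continuous h"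
  shows "sip (\<lambda>x. f x - g x) h = sip f h - sip g h"
  unfolding sip_def left_diff_distrib
  by (intro Bochner_Integration.integral_diff sip_integrable assms)

lemma sip_cmult_left: "sip (\<lambda>x. c * f x) h = c * sip f h"
  unfolding sip_def by (simp add: mult.assoc)

lemma sip_cmult_right: "sip h (\<lambda>x. c * f x) = c * sip h f"
  by (simp add: sip_commute[of h] sip_cmult_left)

lemma sip_diff_right:
  assumes "sphere_continuous f" "sphere_continuous g" "sphere_continuous h"
  shows "sip h (\<lambda>x. f x - g x) = sip h f - sip h g"
  using sip_diff_left[OF assms] by (simp only: sip_commute)

lemma sip_sum_left:
  assumes "\<And>a. a \<in> A \<Longrightarrow> sphere_continuous (f a)" "sphere_continuous h"
  shows "sip (\<lambda>x. \<Sum>a\<in>A. f a x) h = (\<Sum>a\<in>A. sip (f a) h)"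
  unfolding sip_def sum_distrib_right
  by (rule Bochner_Integration.integral_sum) (intro sip_integrable assms)

lemma sip_diff_diff:
  assumes "sphere_continuous f" "sphere_continuous g"
  shows "sip (\<lambda>x. f x - g x) (\<lambda>x. f x - g x) = sip f f - 2 * sip f g + sip g g"
proof -
  have c: "sphere_continuous (\<lambda>x. f x - g x)" using assms by (intro continuous_intros)
  show ?thesis
    by (simp add: sip_diff_left[OF assms c] sip_diff_right[OF assms assms(1)] sip_diff_right[OF assms assms(2)] sip_commute[of g f])
qed

lemma sip_nonneg: "0 \<le> sip f f"
  unfolding sip_def by (rule Bochner_Integration.integral_nonneg) auto

lemma sip_eq_0_imp:
  assumes "sphere_continuous f" "sip f f = 0" "x \<in> sphere 0 1" shows "f x = 0"
  using integral_sphere_eq_0_imp[of "\<lambda>x. f x * f x" x] assms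
  by (auto simp: sip_def continuous_on_mult)

lemma sip_orthogonal:
  fixes U :: "'a::euclidean_space \<Rightarrow> 'a"
  assumes "orthogonal_transformation U" "sphere_continuous f" "sphere_continuous g"
  shows "sip (\<lambda>x. f (U x)) (\<lambda>x. g (U x)) = sip f g"
  unfolding sip_def
  by (rule integral_sphere_orthogonal[OF assms(1), of "\<lambda>x. f x * g x"]) (intro continuous_on_mult assms)

lemma sip_Cauchy_Schwarz:
  assumes f: "sphere_continuous f" and g: "sphere_continuous g"
  shows "(sip f g)^2 \<le> sip f f * sip g g"
proof (cases "sip g g = 0")
  case True
  then have "sip f g = sip f (\<lambda>x. 0)" by (intro sip_cong) (use sip_eq_0_imp[OF g] in auto)
  then show ?thesis by (simp add: sip_def)
next
  case False
  then have pos: "sip g g > 0" using sip_nonneg[of g] by simp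
  define t where "t = sip f g / sip g g"
  have c: "sphere_continuous (\<lambda>x. t * g x)" using g by (intro continuous_intros)
  have "0 \<le> sip f f - 2 * sip f (\<lambda>x. t * g x) + sip (\<lambda>x. t * g x) (\<lambda>x. t * g x)"
    unfolding sip_diff_diff[OF f c, symmetric] by (rule sip_nonneg)
  then have "0 \<le> sip f f - 2 * t * sip f g + t * t * sip g g"
    by (simp add: sip_cmult_left sip_cmult_right)
  also have "\<dots> = sip f f - (sip f g)^2 / sip g g"
    using False by (simp add: t_def power2_eq_square)
  finally show ?thesis using pos by (simp add: field_simps)
qed

lemma polynomial_sphere_continuous: "real_polynomial_function p \<Longrightarrow> sphere_continuous p"
  by (rule polynomial_continuous_on)

section \<open>The spectral gap of plane rotations on spherical harmonics\<close>

lemma polynomial_compose_rot: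
  fixes i j :: "'n::finite"
  assumes "i \<noteq> j"
  shows "real_polynomial_function p \<Longrightarrow> real_polynomial_function (\<lambda>x. p (plane_rot i j \<theta> x))"
  by (rule polynomial_compose_linear) (auto intro: orthogonal_transformation_linear orthogonal_plane_rot[OF assms])

lemma polynomial_rotgen_funpow: "real_polynomial_function p \<Longrightarrow> real_polynomial_function ((rotgen i j ^^ m) p)"
  by (induction m) auto

lemma plane_rot_taylor:
  fixes i j :: "'n::finite"
  assumes ij: "i \<noteq> j" and p: "real_polynomial_function p"
  shows "\<exists>t. p (plane_rot i j (\<theta> + h) x) = p (plane_rot i j \<theta> x) + h * rotgen i j p (plane_rot i j \<theta> x)
     + rotgen i j (rotgen i j p) (plane_rot i j t x) / 2 * h^2"
proof -
  define D where "D m s = (rotgen i j ^^ m) p (plane_rot i j (\<theta> + s) x)" for m s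
  have "\<forall>m s. DERIV (D m) s :> D (Suc m) s"
  proof (intro allI)
    fix m s
    have "((\<lambda>\<theta>. (rotgen i j ^^ m) p (plane_rot i j \<theta> x)) has_real_derivative
        rotgen i j ((rotgen i j ^^ m) p) (plane_rot i j (\<theta> + s) x)) (at (\<theta> + s))"
      by (rule plane_rot_deriv[OF polynomial_rotgen_funpow[OF p] ij])
    then show "DERIV (D m) s :> D (Suc m) s"
      using DERIV_shift[of "\<lambda>u. (rotgen i j ^^ m) p (plane_rot i j u x)" _ s \<theta>]
      by (simp add: D_def[abs_def] add.commute[of \<theta>])
  qed
  from Maclaurin_all_le[OF refl this, of h 2] obtain t where
    "D 0 h = (\<Sum>m<2. D m 0 / fact m * h ^ m) + D 2 t / fact 2 * h ^ 2" by blast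
  then show ?thesis by (intro exI[of _ "\<theta> + t"]) (simp add: D_def numeral_2_eq_2 mult.commute)
qed

text \<open>Differentiation under the integral: the second order Taylor remainder along a rotation is bounded uniformly on the
  sphere.\<close>

lemma sip_plane_rot_deriv:
  fixes i j :: "'n::finite"
  assumes ij: "i \<noteq> j" and p: "real_polynomial_function p" and q: "real_polynomial_function q"
  shows "((\<lambda>\<theta>. sip (\<lambda>x. p (plane_rot i j \<theta> x)) q) has_real_derivative
     sip (\<lambda>x. rotgen i j p (plane_rot i j \<theta> x)) q) (at \<theta>)"
proof -
  let ?R = "plane_rot i j"
  let ?G = "\<lambda>\<theta>. sip (\<lambda>x. p (?R \<theta> x)) q"
  let ?D = "sip (\<lambda>x. rotgen i j p (?R \<theta> x)) q"
  have cont: "sphere_continuous (\<lambda>x. r (?R s x))" if "real_polynomial_function r" for r s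
    by (intro polynomial_sphere_continuous polynomial_compose_rot ij that)
  obtain B where B: "B > 0" "\<And>x. x \<in> sphere 0 1 \<Longrightarrow> \<bar>rotgen i j (rotgen i j p) x\<bar> \<le> B"
    using continuous_on_sphere_bounded[OF polynomial_sphere_continuous[OF polynomial_rotgen[OF polynomial_rotgen[OF p]]]]
    by blast
  obtain Q where Q: "Q > 0" "\<And>x. x \<in> sphere 0 1 \<Longrightarrow> \<bar>q x\<bar> \<le> Q"
    using continuous_on_sphere_bounded[OF polynomial_sphere_continuous[OF q]] by blast
  define K where "K = B * Q * measure sphere_measure (sphere (0::real^'n) 1)"
  have est: "\<bar>?G (\<theta> + h) - ?G \<theta> - h * ?D\<bar> \<le> K * h^2" for h
  proof -
    let ?E = "\<lambda>x. p (?R (\<theta> + h) x) - p (?R \<theta> x) - h * rotgen i j p (?R \<theta> x)"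
    have c: "sphere_continuous ?E" by (intro continuous_intros cont p polynomial_rotgen)
    have "?G (\<theta> + h) - ?G \<theta> - h * ?D = sip ?E q"
      using p q by (simp add: sip_diff_left sip_cmult_left cont polynomial_rotgen polynomial_sphere_continuous continuous_intros)
    also have "\<bar>\<dots>\<bar> \<le> (LINT x|sphere_measure. \<bar>?E x * q x\<bar>)"
      unfolding sip_def by (rule integral_abs_bound)
    also have "\<dots> \<le> (LINT x|(sphere_measure :: (real^'n) measure). B * h^2 * Q)"
    proof (rule Bochner_Integration.integral_mono)
      show "integrable sphere_measure (\<lambda>x. \<bar>?E x * q x\<bar>)"
        by (intro integrable_abs sip_integrable c polynomial_sphere_continuous q)
      show "integrable (sphere_measure :: (real^'n) measure) (\<lambda>x. B * h^2 * Q)" by simp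
      fix x :: "real^'n" assume "x \<in> space sphere_measure"
      then have x: "x \<in> sphere 0 1" by simp
      obtain t where "p (?R (\<theta> + h) x) = p (?R \<theta> x) + h * rotgen i j p (?R \<theta> x)
         + rotgen i j (rotgen i j p) (?R t x) / 2 * h^2" using plane_rot_taylor[OF ij p] by blast
      then have "\<bar>?E x\<bar> = \<bar>rotgen i j (rotgen i j p) (?R t x)\<bar> / 2 * h^2" by (simp add: abs_mult)
      also have "\<dots> \<le> B * h^2"
      proof (rule mult_right_mono)
        have "\<bar>rotgen i j (rotgen i j p) (?R t x)\<bar> \<le> B"
          using x by (intro B) (simp add: orthogonal_transformation_norm[OF orthogonal_plane_rot[OF ij]])
        then show "\<bar>rotgen i j (rotgen i j p) (?R t x)\<bar> / 2 \<le> B" using B by linarith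
      qed simp
      finally show "\<bar>?E x * q x\<bar> \<le> B * h^2 * Q"
        unfolding abs_mult using Q x B by (intro mult_mono) auto
    qed
    also have "\<dots> = K * h^2" by (simp add: K_def)
    finally show ?thesis .
  qed
  have "((\<lambda>h. (?G (\<theta> + h) - ?G \<theta>) / h - ?D) \<longlongrightarrow> 0) (at 0)"
  proof (rule Lim_null_comparison)
    show "\<forall>\<^sub>F h in at 0. norm ((?G (\<theta> + h) - ?G \<theta>) / h - ?D) \<le> K * \<bar>h\<bar>"
    proof (rule eventually_at_topological[THEN iffD2], intro exI[of _ UNIV] conjI ballI impI)
      fix h :: real assume h: "h \<noteq> 0"
      have "(?G (\<theta> + h) - ?G \<theta>) / h - ?D = (?G (\<theta> + h) - ?G \<theta> - h * ?D) / h"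
        using h by (simp add: field_simps)
      then have "norm ((?G (\<theta> + h) - ?G \<theta>) / h - ?D) = \<bar>?G (\<theta> + h) - ?G \<theta> - h * ?D\<bar> / \<bar>h\<bar>"
        by (simp only: real_norm_def abs_divide)
      also have "\<dots> \<le> K * h^2 / \<bar>h\<bar>" by (intro divide_right_mono est) simp
      also have "\<dots> = K * \<bar>h\<bar>" using h by (simp add: power2_eq_square abs_if)
      finally show "norm ((?G (\<theta> + h) - ?G \<theta>) / h - ?D) \<le> K * \<bar>h\<bar>" .
    qed auto
    show "((\<lambda>h. K * \<bar>h\<bar>) \<longlongrightarrow> 0) (at 0)" by (auto intro!: tendsto_eq_intros)
  qed
  then show ?thesis unfolding DERIV_def by (rule LIM_zero_cancel)
qed

text \<open>Both sides differentiate \<open>\<langle>p \<circ> R\<^sub>s, q\<rangle> = \<langle>p, q \<circ> R\<^bsub>-s\<^esub>\<rangle>\<close>, which is the invariance of the measure.\<close>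

lemma rotgen_antisym:
  fixes i j :: "'n::finite"
  assumes ij: "i \<noteq> j" and p: "real_polynomial_function p" and q: "real_polynomial_function q"
  shows "sip (\<lambda>x. rotgen i j p (plane_rot i j \<theta> x)) q = - sip (\<lambda>x. p (plane_rot i j \<theta> x)) (rotgen i j q)"
proof -
  let ?R = "plane_rot i j"
  have move: "sip f (\<lambda>x. g (?R (- s) x)) = sip (\<lambda>x. f (?R s x)) g"
    if "real_polynomial_function f" "real_polynomial_function g" for f g s
    using sip_orthogonal[OF orthogonal_plane_rot[OF ij], of f "\<lambda>x. g (?R (- s) x)" s] ij that
    by (simp add: polynomial_sphere_continuous polynomial_compose_rot)
  have "((\<lambda>s. sip (\<lambda>x. q (?R s x)) p) has_real_derivative sip (\<lambda>x. rotgen i j q (?R (-\<theta>) x)) p) (at (-\<theta>))"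
    by (rule sip_plane_rot_deriv[OF ij q p])
  then have "((\<lambda>s. sip (\<lambda>x. q (?R (-s) x)) p) has_real_derivative - sip (\<lambda>x. rotgen i j q (?R (-\<theta>) x)) p) (at \<theta>)"
    by (subst (asm) DERIV_mirror)
  then have "((\<lambda>s. sip (\<lambda>x. p (?R s x)) q) has_real_derivative - sip (\<lambda>x. p (?R \<theta> x)) (rotgen i j q)) (at \<theta>)"
    using p q by (simp add: move polynomial_rotgen flip: sip_commute[of p])
  then show ?thesis using sip_plane_rot_deriv[OF ij p q] DERIV_unique by blast
qed

lemma rotgen_antisym0:
  assumes p: "real_polynomial_function p" and q: "real_polynomial_function q"
  shows "sip (rotgen i j p) q = - sip p (rotgen i j q)"
proof (cases "i = j")
  case True
  then have "rotgen i j r = (\<lambda>x. 0)" for r by (simp add: rotgen_def fun_eq_iff)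
  then show ?thesis by (simp add: sip_def)
next
  case False
  from rotgen_antisym[OF this p q, of 0] show ?thesis by simp
qed

text \<open>The Casimir identity, integrated by parts.\<close>

lemma harmonic_energy:
  fixes h g :: "real^'n \<Rightarrow> real"
  assumes h: "h \<in> homogeneous_harmonic_polynomials k" and g: "real_polynomial_function g"
  shows "(\<Sum>i\<in>UNIV. \<Sum>j\<in>UNIV. sip (rotgen i j h) (rotgen i j g)) = 2 * sphere_eigenvalue TYPE(real^'n) k * sip h g"
proof -
  note ph = harmonic_polynomial[OF h]
  note ch = polynomial_sphere_continuous
  have "2 * sphere_eigenvalue TYPE(real^'n) k * sip h g =
     - sip (\<lambda>x. - (2 * sphere_eigenvalue TYPE(real^'n) k) * h x) g"
    unfolding sip_cmult_left by simp
  also have "sip (\<lambda>x. - (2 * sphere_eigenvalue TYPE(real^'n) k) * h x) g =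
     sip (\<lambda>x. \<Sum>i\<in>UNIV. \<Sum>j\<in>UNIV. rotgen i j (rotgen i j h) x) g"
    by (rule sip_cong) (simp_all add: harmonic_casimir[OF h])
  also have "\<dots> = (\<Sum>i\<in>UNIV. sip (\<lambda>x. \<Sum>j\<in>UNIV. rotgen i j (rotgen i j h) x) g)"
    using ph g by (intro sip_sum_left continuous_on_sum ch polynomial_rotgen) auto
  also have "\<dots> = (\<Sum>i\<in>UNIV. \<Sum>j\<in>UNIV. sip (rotgen i j (rotgen i j h)) g)"
    using ph g by (intro sum.cong refl sip_sum_left ch polynomial_rotgen) auto
  also have "\<dots> = (\<Sum>i\<in>UNIV. \<Sum>j\<in>UNIV. - sip (rotgen i j h) (rotgen i j g))"
    using ph g by (simp add: rotgen_antisym0 polynomial_rotgen)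
  finally show ?thesis by (simp add: sum_negf)
qed

lemma sphere_eigenvalue_strict_mono:
  assumes D: "CARD('n::finite) \<ge> 2" and kl: "k < l"
  shows "sphere_eigenvalue TYPE(real^'n) k < sphere_eigenvalue TYPE(real^'n) l"
proof -
  have D: "real CARD('n) \<ge> 2" using D by simp
  have "real k * (real k + (real CARD('n) - 2)) \<le> real k * (real l + (real CARD('n) - 2))"
    using kl by (intro mult_left_mono) auto
  also have "\<dots> < real l * (real l + (real CARD('n) - 2))"
    using kl D by (intro mult_strict_right_mono) auto
  finally show ?thesis by (simp add: sphere_eigenvalue_def algebra_simps)
qed

lemma sphere_eigenvalue_ge_square:
  assumes D: "CARD('n::finite) \<ge> 2"
  shows "(real k)^2 \<le> sphere_eigenvalue TYPE(real^'n) k"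
proof -
  have "real k * real k \<le> real k * (real k + (real CARD('n) - 2))"
    using D by (intro mult_left_mono) auto
  then show ?thesis by (simp add: sphere_eigenvalue_def power2_eq_square algebra_simps)
qed

text \<open>The energy form is symmetric, but \<open>h\<close> and \<open>g\<close> have different eigenvalues.\<close>

lemma harmonic_orthogonal:
  fixes h g :: "real^'n \<Rightarrow> real"
  assumes D: "CARD('n) \<ge> 2" and h: "h \<in> homogeneous_harmonic_polynomials k"
    and g: "g \<in> homogeneous_harmonic_polynomials l" and kl: "k \<noteq> l"
  shows "sip h g = 0"
proof -
  have "2 * sphere_eigenvalue TYPE(real^'n) k * sip h g = 2 * sphere_eigenvalue TYPE(real^'n) l * sip g h"
  proof -
    have "(\<Sum>i\<in>UNIV. \<Sum>j\<in>UNIV. sip (rotgen i j h) (rotgen i j g)) = (\<Sum>i\<in>UNIV. \<Sum>j\<in>UNIV. sip (rotgen i j g) (rotgen i j h))"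
      by (intro sum.cong refl sip_commute)
    then show ?thesis
      using harmonic_energy[OF h harmonic_polynomial[OF g]] harmonic_energy[OF g harmonic_polynomial[OF h]] by simp
  qed
  moreover have "sphere_eigenvalue TYPE(real^'n) k \<noteq> sphere_eigenvalue TYPE(real^'n) l"
    using kl sphere_eigenvalue_strict_mono[OF D] by (metis less_irrefl linorder_neqE_nat)
  ultimately show ?thesis by (metis mult_right_cancel mult_cancel_left sip_commute zero_neq_numeral)
qed

lemma harmonic_energy_single:
  fixes h :: "real^'n \<Rightarrow> real"
  assumes h: "h \<in> homogeneous_harmonic_polynomials k"
  shows "sip (rotgen i j h) (rotgen i j h) \<le> 2 * sphere_eigenvalue TYPE(real^'n) k * sip h h"
proof -
  have "sip (rotgen i j h) (rotgen i j h) \<le> (\<Sum>j\<in>UNIV. sip (rotgen i j h) (rotgen i j h))"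
    by (rule member_le_sum) (auto simp: sip_nonneg)
  also have "\<dots> \<le> (\<Sum>i\<in>UNIV. \<Sum>j\<in>UNIV. sip (rotgen i j h) (rotgen i j h))"
    by (rule member_le_sum[where f="\<lambda>i. \<Sum>j\<in>UNIV. sip (rotgen i j h) (rotgen i j h)"])
      (auto simp: sip_nonneg intro!: sum_nonneg)
  finally show ?thesis using harmonic_energy[OF h harmonic_polynomial[OF h]] by simp
qed

text \<open>The left and right sides agree to leading order in \<open>\<theta>\<close>, up to the factor \<open>1/2\<close>.  Let
  \<open>g(\<theta>) = \<langle>h \<circ> R\<^sub>\<theta>, h\<rangle>\<close> and let \<open>X\<close> be the generator of the rotations \<open>R\<^sub>\<theta>\<close>.  By antisymmetry the odd derivatives of \<open>g\<close>
  at \<open>0\<close> vanish and the second one is \<open>- \<parallel>X h\<parallel>\<^sup>2\<close>.  The fourth derivative is at most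
  \<open>\<parallel>X\<^sup>2 h\<parallel>\<^sup>2 \<le> 2 \<lambda> \<parallel>X h\<parallel>\<^sup>2\<close> everywhere, because \<open>X h\<close> is again a harmonic of eigenvalue \<open>\<lambda>\<close>; the condition
  \<open>\<theta>\<^sup>2 \<lambda> \<le> 1\<close> absorbs it.\<close>

lemma plane_rot_displacement:
  fixes h :: "real^'n \<Rightarrow> real"
  assumes ij: "i \<noteq> j" and h: "h \<in> homogeneous_harmonic_polynomials k"
    and small: "\<theta>^2 * sphere_eigenvalue TYPE(real^'n) k \<le> 1"
  shows "\<theta>^2 / 2 * sip (rotgen i j h) (rotgen i j h) \<le>
    sip (\<lambda>x. h (plane_rot i j \<theta> x) - h x) (\<lambda>x. h (plane_rot i j \<theta> x) - h x)"
proof -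
  let ?R = "plane_rot i j" and ?X = "rotgen i j" and ?l = "sphere_eigenvalue TYPE(real^'n) k"
  note ph = harmonic_polynomial[OF h]
  have pX: "real_polynomial_function ((?X ^^ m) h)" for m by (rule polynomial_rotgen_funpow[OF ph])
  have pX1: "real_polynomial_function (?X h)" "real_polynomial_function (?X (?X h))" "real_polynomial_function (?X (?X (?X h)))"
    using ph by auto
  define g where "g m s = sip (\<lambda>x. (?X ^^ m) h (?R s x)) h" for m s
  have "\<forall>m s. DERIV (g m) s :> g (Suc m) s"
    unfolding g_def using sip_plane_rot_deriv[OF ij pX ph] by simp
  from Maclaurin_all_le[OF refl this, of \<theta> 4] obtain t where
    t: "g 0 \<theta> = (\<Sum>m<4. g m 0 / fact m * \<theta> ^ m) + g 4 t / fact 4 * \<theta> ^ 4" by blast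
  have self: "sip (?X f) f = 0" if "real_polynomial_function f" for f
    using rotgen_antisym0[OF that that, of i j] by (simp add: sip_commute)
  let ?a = "sip (?X h) (?X h)" and ?b = "sip (?X (?X h)) (?X (?X h))"
  have g0: "g 0 0 = sip h h" by (simp add: g_def)
  have g1: "g 1 0 = 0" by (simp add: g_def self[OF ph])
  have g2: "g 2 0 = - ?a"
    using rotgen_antisym0[OF pX1(1) ph, of i j] by (simp add: g_def numeral_2_eq_2)
  have g3: "g 3 0 = 0"
    using rotgen_antisym0[OF pX1(2) ph, of i j] self[OF pX1(1)] by (simp add: g_def numeral_3_eq_3)
  have g4: "g 4 t \<le> ?b"
  proof -
    have "g 4 t = sip (\<lambda>x. ?X (?X (?X (?X h))) (?R t x)) h"
      by (simp add: g_def eval_nat_numeral)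
    also have "\<dots> = sip (\<lambda>x. ?X (?X h) (?R t x)) (?X (?X h))"
      using rotgen_antisym[OF ij pX1(3) ph, of t] rotgen_antisym[OF ij pX1(2) pX1(1), of t] by simp
    also have "\<dots> \<le> \<bar>\<dots>\<bar>" by simp
    also have "\<dots> \<le> ?b"
    proof (rule power2_le_imp_le[OF _ sip_nonneg])
      have "(sip (\<lambda>x. ?X (?X h) (?R t x)) (?X (?X h)))^2 \<le>
        sip (\<lambda>x. ?X (?X h) (?R t x)) (\<lambda>x. ?X (?X h) (?R t x)) * ?b"
        by (intro sip_Cauchy_Schwarz polynomial_sphere_continuous polynomial_compose_rot[OF ij] pX1)
      also have "sip (\<lambda>x. ?X (?X h) (?R t x)) (\<lambda>x. ?X (?X h) (?R t x)) = ?b"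
        by (intro sip_orthogonal orthogonal_plane_rot[OF ij] polynomial_sphere_continuous pX1)
      finally show "\<bar>sip (\<lambda>x. ?X (?X h) (?R t x)) (?X (?X h))\<bar>\<^sup>2 \<le> ?b\<^sup>2" by (simp add: power2_eq_square)
    qed
    finally show ?thesis .
  qed
  have gt: "g 0 \<theta> = sip h h - ?a / 2 * \<theta>^2 + g 4 t / 24 * \<theta>^4"
    unfolding t by (simp add: eval_nat_numeral g0 g1[simplified] g2[simplified numeral_2_eq_2] g3[simplified numeral_3_eq_3] fact_numeral)
  have "sip (\<lambda>x. h (?R \<theta> x) - h x) (\<lambda>x. h (?R \<theta> x) - h x) =
     sip (\<lambda>x. h (?R \<theta> x)) (\<lambda>x. h (?R \<theta> x)) - 2 * g 0 \<theta> + sip h h"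
    unfolding g_def funpow_0
    by (rule sip_diff_diff) (intro polynomial_sphere_continuous polynomial_compose_rot[OF ij] ph)+
  also have "sip (\<lambda>x. h (?R \<theta> x)) (\<lambda>x. h (?R \<theta> x)) = sip h h"
    by (intro sip_orthogonal orthogonal_plane_rot[OF ij] polynomial_sphere_continuous ph)
  finally have eq: "sip (\<lambda>x. h (?R \<theta> x) - h x) (\<lambda>x. h (?R \<theta> x) - h x) = ?a * \<theta>^2 - g 4 t / 12 * \<theta>^4"
    by (simp add: gt)
  have a0: "0 \<le> ?a * \<theta>^2" by (intro mult_nonneg_nonneg sip_nonneg) simp
  have "?b \<le> 2 * ?l * ?a" by (rule harmonic_energy_single[OF rotgen_harmonic[OF h]])
  then have "g 4 t / 12 * \<theta>^4 \<le> 2 * ?l * ?a / 12 * \<theta>^4"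
    using g4 by (intro mult_right_mono divide_right_mono) auto
  also have "\<dots> = (\<theta>^2 * ?l) * (?a * \<theta>^2 / 6)" by (simp add: power4_eq_xxxx power2_eq_square)
  also have "\<dots> \<le> 1 * (?a * \<theta>^2 / 6)"
    using small a0 by (intro mult_right_mono) auto
  finally have "g 4 t / 12 * \<theta>^4 \<le> ?a * \<theta>^2 / 6" by simp
  moreover note a0
  ultimately show ?thesis unfolding eq by (simp add: mult.commute)
qed

text \<open>A harmonic of eigenvalue \<open>\<lambda>\<close> oscillates at the scale \<open>\<lambda>\<^bsup>-1/2\<^esup>\<close>, and at least one of the
  coordinate rotations by a comparable angle detects this.  The total displacement is summed with the help of the Casimir
  identity.\<close>

lemma harmonic_rotation_gap:
  fixes h :: "real^'n \<Rightarrow> real"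
  assumes h: "h \<in> homogeneous_harmonic_polynomials k"
    and small: "\<theta>^2 * sphere_eigenvalue TYPE(real^'n) k \<le> 1"
  shows "\<theta>^2 * sphere_eigenvalue TYPE(real^'n) k * sip h h \<le>
    (\<Sum>(i,j)\<in>{(i,j). i \<noteq> j}. sip (\<lambda>x. h (plane_rot i j \<theta> x) - h x) (\<lambda>x. h (plane_rot i j \<theta> x) - h x))"
proof -
  have "(\<Sum>i\<in>UNIV. \<Sum>j\<in>UNIV. sip (rotgen i j h) (rotgen i j h)) =
     (\<Sum>(i,j)\<in>UNIV. sip (rotgen i j h) (rotgen i j h))"
    by (simp add: sum.cartesian_product)
  also have "\<dots> = (\<Sum>(i,j)\<in>{(i,j). i \<noteq> j}. sip (rotgen i j h) (rotgen i j h))"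
  proof (rule sum.mono_neutral_right)
    have "rotgen i i h = (\<lambda>x. 0)" for i by (simp add: rotgen_def fun_eq_iff)
    then show "\<forall>ij\<in>UNIV - {(i, j). i \<noteq> j}. (case ij of (i, j) \<Rightarrow> sip (rotgen i j h) (rotgen i j h)) = 0"
      by (auto simp: sip_def)
  qed auto
  finally have "(\<Sum>(i,j)\<in>{(i,j). i \<noteq> j}. sip (rotgen i j h) (rotgen i j h)) = 2 * sphere_eigenvalue TYPE(real^'n) k * sip h h"
    using harmonic_energy[OF h harmonic_polynomial[OF h]] by simp
  then have "\<theta>^2 * sphere_eigenvalue TYPE(real^'n) k * sip h h =
     \<theta>^2 / 2 * (\<Sum>(i,j)\<in>{(i,j). i \<noteq> j}. sip (rotgen i j h) (rotgen i j h))" by simp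
  also have "\<dots> = (\<Sum>(i,j)\<in>{(i,j). i \<noteq> j}. \<theta>^2 / 2 * sip (rotgen i j h) (rotgen i j h))"
    by (simp only: sum_distrib_left case_prod_unfold)
  also have "\<dots> \<le> (\<Sum>(i,j)\<in>{(i,j). i \<noteq> j}. sip (\<lambda>x. h (plane_rot i j \<theta> x) - h x) (\<lambda>x. h (plane_rot i j \<theta> x) - h x))"
    by (rule sum_mono) (use plane_rot_displacement[OF _ h small] in auto)
  finally show ?thesis .
qed

lemma geodist_plane_rot:
  fixes x :: "real^'n"
  assumes ij: "i \<noteq> j" and x: "x \<in> sphere 0 1" and \<theta>: "0 \<le> \<theta>" "\<theta> \<le> pi"
  shows "geodist x (plane_rot i j \<theta> x) \<le> \<theta>" "0 \<le> geodist x (plane_rot i j \<theta> x)"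
proof -
  have "(\<Sum>l\<in>{i,j}. (x $ l)^2) \<le> (\<Sum>l\<in>UNIV. (x $ l)^2)" by (rule sum_mono2) auto
  moreover have "x \<bullet> x = 1" using x by (simp add: power2_norm_eq_inner[symmetric])
  ultimately have s: "(x $ i)^2 + (x $ j)^2 \<le> 1"
    using ij by (simp add: inner_vec_def power2_eq_square)
  have "(1 - cos \<theta>) * ((x $ i)^2 + (x $ j)^2) \<le> (1 - cos \<theta>) * 1"
    using s by (intro mult_left_mono) auto
  then have ge: "cos \<theta> \<le> x \<bullet> plane_rot i j \<theta> x"
    using inner_plane_rot[OF ij, of x \<theta>] \<open>x \<bullet> x = 1\<close> by simp
  have le: "\<bar>x \<bullet> plane_rot i j \<theta> x\<bar> \<le> 1"
    using Cauchy_Schwarz_ineq2[of x "plane_rot i j \<theta> x"] x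
    by (simp add: orthogonal_transformation_norm[OF orthogonal_plane_rot[OF ij]])
  have "arccos (x \<bullet> plane_rot i j \<theta> x) \<le> arccos (cos \<theta>)"
    using ge le by (intro arccos_le_arccos) (auto simp: abs_le_iff)
  then show "geodist x (plane_rot i j \<theta> x) \<le> \<theta>" using \<theta> by (simp add: geodist_def arccos_cos)
  show "0 \<le> geodist x (plane_rot i j \<theta> x)"
    using le arccos_lbound[of "x \<bullet> plane_rot i j \<theta> x"] by (simp add: geodist_def abs_le_iff)
qed


section \<open>Orthonormal bases of function spaces on the sphere\<close>

text \<open>Elements are functions on the whole space, of which only the values on the sphere matter.\<close>

definition function_space :: "('a::euclidean_space \<Rightarrow> real) set \<Rightarrow> bool" where
  "function_space V \<longleftrightarrow> (\<forall>f\<in>V. sphere_continuous f) \<and> (\<lambda>x. 0) \<in> V \<and>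
     (\<forall>f\<in>V. \<forall>g\<in>V. (\<lambda>x. f x + g x) \<in> V) \<and> (\<forall>f\<in>V. \<forall>c. (\<lambda>x. c * f x) \<in> V)"

lemma
  assumes "function_space V" "f \<in> V"
  shows function_space_continuous: "sphere_continuous f"
    and function_space_add: "g \<in> V \<Longrightarrow> (\<lambda>x. f x + g x) \<in> V"
    and function_space_cmult: "(\<lambda>x. c * f x) \<in> V"
  using assms by (simp_all add: function_space_def)

lemma function_space_sum:
  assumes "function_space V" "\<And>a. a \<in> A \<Longrightarrow> f a \<in> V" "finite A"
  shows "(\<lambda>x. \<Sum>a\<in>A. c a * f a x) \<in> V"
  using assms(3,2)
proof (induction A)
  case empty
  then show ?case using assms(1) by (simp add: function_space_def)
next
  case (insert a A)
  have "(\<lambda>x. c a * f a x) \<in> V" "(\<lambda>x. \<Sum>a\<in>A. c a * f a x) \<in> V"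
    using insert assms(1) by (auto simp: function_space_def)
  then have "(\<lambda>x. c a * f a x + (\<Sum>a\<in>A. c a * f a x)) \<in> V"
    by (rule function_space_add[OF assms(1)])
  then show ?case using insert by simp
qed

lemma function_space_diff:
  assumes V: "function_space V" and "f \<in> V" "g \<in> V" shows "(\<lambda>x. f x - g x) \<in> V"
proof -
  have "(\<lambda>x. (-1) * g x) \<in> V" by (rule function_space_cmult[OF V assms(3)])
  then have "(\<lambda>x. f x + (-1) * g x) \<in> V" by (rule function_space_add[OF V assms(2)])
  then show ?thesis by simp
qed

text \<open>Functions that agree on the sphere cannot be told apart by \<open>sip\<close>; the expansion is therefore required on the
  sphere only.\<close>

definition orthonormal_basis :: "('a::euclidean_space \<Rightarrow> real) set \<Rightarrow> nat \<Rightarrow> (nat \<Rightarrow> 'a \<Rightarrow> real) \<Rightarrow> bool" where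
  "orthonormal_basis V N e \<longleftrightarrow> (\<forall>a<N. e a \<in> V) \<and>
     (\<forall>a<N. \<forall>b<N. sip (e a) (e b) = (if a = b then 1 else 0)) \<and>
     (\<forall>f\<in>V. \<forall>x\<in>sphere 0 1. f x = (\<Sum>a<N. sip f (e a) * e a x))"

lemma sip_expansion:
  fixes N :: nat
  assumes on: "\<And>a b. a < N \<Longrightarrow> b < N \<Longrightarrow> sip (e a) (e b) = (if a = b then 1 else 0)"
    and c: "\<And>a. a < N \<Longrightarrow> sphere_continuous (e a)"
    and f: "\<And>x. x \<in> sphere 0 1 \<Longrightarrow> f x = (\<Sum>a<N. d a * e a x)" and b: "b < N"
  shows "sip f (e b) = d b"
proof -
  have "sip f (e b) = sip (\<lambda>x. \<Sum>a<N. d a * e a x) (e b)" by (rule sip_cong) (use f in auto)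
  also have "\<dots> = (\<Sum>a<N. sip (\<lambda>x. d a * e a x) (e b))"
    using c b by (intro sip_sum_left continuous_on_mult continuous_on_const) auto
  also have "\<dots> = (\<Sum>a<N. if a = b then d a else 0)"
    using on b by (intro sum.cong) (auto simp: sip_cmult_left)
  finally show ?thesis using b sum.delta[of "{..<N}" b d] by simp
qed

text \<open>Gram--Schmidt, by induction on the size of the spanning family.  The functions that can be expressed without the
  new generator form a subspace \<open>V'\<close> of codimension at most one.  The generators themselves may lie outside \<open>V\<close>.\<close>

lemma orthonormal_basis_exists:
  fixes g :: "'i \<Rightarrow> 'a::euclidean_space \<Rightarrow> real"
  assumes "finite A" "function_space V"
    and "\<And>f. f \<in> V \<Longrightarrow> \<exists>c. \<forall>x\<in>sphere 0 1. f x = (\<Sum>a\<in>A. c a * g a x)"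
  shows "\<exists>N e. N \<le> card A \<and> orthonormal_basis V N e"
  using assms
proof (induction A arbitrary: V rule: finite_induct)
  case empty
  then show ?case by (intro exI[of _ 0]) (auto simp: orthonormal_basis_def)
next
  case (insert i A)
  note V = insert.prems(1) and span = insert.prems(2)
  have cont: "sphere_continuous f" if "f \<in> V" for f using V that by (auto simp: function_space_def)
  define V' where "V' = {f \<in> V. \<exists>c. \<forall>x\<in>sphere 0 1. f x = (\<Sum>a\<in>A. c a * g a x)}"
  have V': "function_space V'"
    unfolding function_space_def
  proof (intro conjI ballI allI)
    show "sphere_continuous f" if "f \<in> V'" for f using that cont by (auto simp: V'_def)
    show "(\<lambda>x. 0) \<in> V'"
      using V by (auto simp: V'_def function_space_def intro!: exI[of _ "\<lambda>_. 0"])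
    fix f assume f: "f \<in> V'"
    then obtain cf where cf: "\<forall>x\<in>sphere 0 1. f x = (\<Sum>a\<in>A. cf a * g a x)" by (auto simp: V'_def)
    show "(\<lambda>x. f x + h x) \<in> V'" if h: "h \<in> V'" for h
    proof -
      obtain ch where "\<forall>x\<in>sphere 0 1. h x = (\<Sum>a\<in>A. ch a * g a x)" using h by (auto simp: V'_def)
      with cf have "\<forall>x\<in>sphere 0 1. f x + h x = (\<Sum>a\<in>A. (cf a + ch a) * g a x)"
        by (simp add: distrib_right sum.distrib)
      moreover have "(\<lambda>x. f x + h x) \<in> V" using f h V by (auto simp: V'_def function_space_def)
      ultimately show ?thesis
        unfolding V'_def by (intro CollectI conjI exI[of _ "\<lambda>a. cf a + ch a"])
    qed
    show "(\<lambda>x. c * f x) \<in> V'" for c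
    proof -
      have "\<forall>x\<in>sphere 0 1. c * f x = (\<Sum>a\<in>A. (c * cf a) * g a x)"
        using cf by (simp add: sum_distrib_left mult.assoc)
      moreover have "(\<lambda>x. c * f x) \<in> V" using f V by (auto simp: V'_def function_space_def)
      ultimately show ?thesis
        unfolding V'_def by (intro CollectI conjI exI[of _ "\<lambda>a. c * cf a"])
    qed
  qed
  obtain N e where N: "N \<le> card A" and e: "orthonormal_basis V' N e"
    using insert.IH[OF V'] by (auto simp: V'_def)
  have eV: "e a \<in> V" "e a \<in> V'" if "a < N" for a using e that by (auto simp: orthonormal_basis_def V'_def)
  have on: "sip (e a) (e b) = (if a = b then 1 else 0)" if "a < N" "b < N" for a b
    using e that by (auto simp: orthonormal_basis_def)
  show ?case
  proof (cases "V \<subseteq> V'")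
    case True
    then have "V = V'" by (auto simp: V'_def)
    then show ?thesis using N e insert.hyps by (intro exI[of _ N] exI[of _ e]) auto
  next
    case False
    then obtain v where v: "v \<in> V" "v \<notin> V'" by blast
    define u where "u = (\<lambda>x. v x - (\<Sum>a<N. sip v (e a) * e a x))"
    have sumV': "(\<lambda>x. \<Sum>a<N. d a * e a x) \<in> V'" for d
      by (rule function_space_sum[OF V']) (use eV in auto)
    then have sumV: "(\<lambda>x. \<Sum>a<N. d a * e a x) \<in> V" for d by (auto simp: V'_def)
    have uV: "u \<in> V" unfolding u_def by (rule function_space_diff[OF V v(1) sumV])
    have ue: "sip u (e b) = 0" if b: "b < N" for b
    proof -
      have "sip u (e b) = sip v (e b) - sip (\<lambda>x. \<Sum>a<N. sip v (e a) * e a x) (e b)"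
        unfolding u_def by (intro sip_diff_left cont v sumV eV b)
      also have "sip (\<lambda>x. \<Sum>a<N. sip v (e a) * e a x) (e b) = sip v (e b)"
        by (rule sip_expansion[where N=N]) (use on cont eV b in auto)
      finally show ?thesis by simp
    qed
    have "sip u u \<noteq> 0"
    proof
      assume "sip u u = 0"
      then have "v x = (\<Sum>a<N. sip v (e a) * e a x)" if "x \<in> sphere 0 1" for x
        using sip_eq_0_imp[OF cont[OF uV]] that by (simp add: u_def)
      with sumV'[of "\<lambda>a. sip v (e a)"] have "v \<in> V'"
        using v(1) by (auto simp: V'_def)
      then show False using v by simp
    qed
    then have uu: "sip u u > 0" using sip_nonneg[of u] by simp
    define e' where "e' = (\<lambda>a. if a = N then (\<lambda>x. inverse (sqrt (sip u u)) * u x) else e a)"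
    have e'V: "e' a \<in> V" if "a < Suc N" for a
      using that eV uV V by (auto simp: e'_def function_space_def less_Suc_eq)
    have on': "sip (e' a) (e' b) = (if a = b then 1 else 0)" if "a < Suc N" "b < Suc N" for a b
    proof -
      define s where "s = sqrt (sip u u)"
      have s: "s \<noteq> 0" "sip u u = s * s" using uu by (simp_all add: s_def)
      have "sip (e' N) (e' N) = inverse s * (inverse s * sip u u)"
        by (simp only: e'_def sip_cmult_left sip_cmult_right s_def if_True simp_thms)
      also have "\<dots> = 1" using s by (simp add: field_simps)
      finally have "sip (e' N) (e' N) = 1" .
      moreover have "sip (e' N) (e c) = 0" if "c < N" for c
        using ue[OF that] by (simp add: e'_def sip_cmult_left)
      moreover have "sip (e c) (e' N) = 0" if "c < N" for c
        using calculation(2)[OF that] by (simp add: sip_commute[of "e c" "e' N"])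
      moreover have "e' c = e c" if "c < N" for c using that by (simp add: e'_def)
      ultimately show ?thesis using that on by (cases "a = N"; cases "b = N") (auto simp: less_Suc_eq)
    qed
    have span': "f x = (\<Sum>a<Suc N. sip f (e' a) * e' a x)" if f: "f \<in> V" and x: "x \<in> sphere 0 1" for f x
    proof -
      obtain cf where cf: "\<forall>x\<in>sphere 0 1. f x = (\<Sum>a\<in>insert i A. cf a * g a x)" using span[OF f] by blast
      obtain cv where cv: "\<forall>x\<in>sphere 0 1. v x = (\<Sum>a\<in>insert i A. cv a * g a x)" using span[OF v(1)] by blast
      have "cv i \<noteq> 0"
      proof
        assume "cv i = 0"
        then have "\<forall>x\<in>sphere 0 1. v x = (\<Sum>a\<in>A. cv a * g a x)" using cv insert.hyps by simp
        then show False using v by (auto simp: V'_def)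
      qed
      define r where "r = cf i / cv i"
      define w where "w = (\<lambda>x. f x - r * v x)"
      have "(\<lambda>x. r * v x) \<in> V" using V v by (auto simp: function_space_def)
      then have "w \<in> V" unfolding w_def by (rule function_space_diff[OF V f])
      moreover have "\<forall>x\<in>sphere 0 1. w x = (\<Sum>a\<in>A. (cf a - r * cv a) * g a x)"
      proof
        fix y :: 'a assume y: "y \<in> sphere 0 1"
        have rc: "r * cv i = cf i" using \<open>cv i \<noteq> 0\<close> by (simp add: r_def)
        have "w y = (cf i * g i y + (\<Sum>a\<in>A. cf a * g a y)) - r * (cv i * g i y + (\<Sum>a\<in>A. cv a * g a y))"
          using cf cv y insert.hyps by (simp add: w_def)
        also have "\<dots> = (cf i - r * cv i) * g i y + (\<Sum>a\<in>A. (cf a - r * cv a) * g a y)"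
          by (simp only: left_diff_distrib distrib_left sum_subtractf sum_distrib_left mult.assoc)
        finally show "w y = (\<Sum>a\<in>A. (cf a - r * cv a) * g a y)" by (simp add: rc)
      qed
      ultimately have w: "w \<in> V'" by (auto simp: V'_def)
      define d where "d a = (if a = N then r * sqrt (sip u u) else sip w (e a) + r * sip v (e a))" for a
      have fd: "f y = (\<Sum>a<Suc N. d a * e' a y)" if y: "y \<in> sphere 0 1" for y
      proof -
        have "w y = (\<Sum>a<N. sip w (e a) * e a y)" using e w y by (auto simp: orthonormal_basis_def)
        moreover have "r * v y = r * u y + (\<Sum>a<N. r * sip v (e a) * e a y)"
          by (simp add: u_def algebra_simps sum_distrib_left)
        moreover have "(\<Sum>a<Suc N. d a * e' a y) = (\<Sum>a<N. (sip w (e a) + r * sip v (e a)) * e a y) + r * u y"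
          using uu by (simp add: d_def e'_def)
        ultimately show ?thesis by (simp add: w_def distrib_right sum.distrib)
      qed
      have "sip f (e' b) = d b" if "b < Suc N" for b
        by (rule sip_expansion[where N="Suc N", OF on' cont[OF e'V] fd that])
      then show ?thesis using fd[OF x] by simp
    qed
    have "orthonormal_basis V (Suc N) e'"
      using e'V on' span' unfolding orthonormal_basis_def by blast
    then show ?thesis using N insert.hyps by (intro exI[of _ "Suc N"] exI[of _ e']) auto
  qed
qed

lemma orthonormal_basis_norm:
  assumes V: "function_space V" and e: "orthonormal_basis V N e"
  shows "sip (\<lambda>x. \<Sum>a<N. d a * e a x) (\<lambda>x. \<Sum>a<N. d a * e a x) = (\<Sum>a<N. (d a)^2)"
proof -
  have c: "sphere_continuous (e a)" if "a < N" for a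
    using V e that by (auto simp: function_space_def orthonormal_basis_def)
  have cs: "sphere_continuous (\<lambda>x. \<Sum>a<N. d a * e a x)" using c by (intro continuous_intros) auto
  have "sip (\<lambda>x. \<Sum>a<N. d a * e a x) (\<lambda>x. \<Sum>a<N. d a * e a x) =
    (\<Sum>b<N. d b * sip (e b) (\<lambda>x. \<Sum>a<N. d a * e a x))"
    using c cs by (subst sip_sum_left) (auto intro!: continuous_intros simp: sip_cmult_left)
  also have "\<dots> = (\<Sum>b<N. d b * d b)"
    using e c by (intro sum.cong refl, subst sip_commute, subst sip_expansion[where N=N and d=d])
      (auto simp: orthonormal_basis_def)
  finally show ?thesis by (simp add: power2_eq_square)
qed

text \<open>The diagonal of the reproducing kernel of a rotation invariant space is constant, hence equal
  to the dimension divided by the total mass; Cauchy--Schwarz gives the bound.\<close>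

lemma invariant_space_sup_bound:
  fixes V :: "(real^'n \<Rightarrow> real) set"
  assumes V: "function_space V" and e: "orthonormal_basis V N e"
    and inv: "\<And>U f. orthogonal_transformation U \<Longrightarrow> f \<in> V \<Longrightarrow> (\<lambda>x. f (U x)) \<in> V"
    and f: "f \<in> V" and x: "x \<in> sphere 0 1"
  shows "(f x)^2 * measure sphere_measure (sphere (0::real^'n) 1) \<le> real N * sip f f"
proof -
  let ?m = "measure sphere_measure (sphere (0::real^'n) 1)"
  have c: "sphere_continuous g" if "g \<in> V" for g using V that by (auto simp: function_space_def)
  have eV: "e a \<in> V" if "a < N" for a using e that by (auto simp: orthonormal_basis_def)
  define R where "R y = (\<Sum>a<N. (e a y)^2)" for y
  have R0: "R y \<ge> 0" for y by (simp add: R_def sum_nonneg)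
  have bound: "(g y)^2 \<le> R y * sip g g" if g: "g \<in> V" and y: "y \<in> sphere 0 1" for g y
  proof -
    have eq: "g z = (\<Sum>a<N. sip g (e a) * e a z)" if "z \<in> sphere 0 1" for z
      using e g that by (auto simp: orthonormal_basis_def)
    have "(g y)^2 \<le> (\<Sum>a<N. (sip g (e a))^2) * R y"
      unfolding eq[OF y] R_def by (rule Cauchy_Schwarz_ineq_sum)
    also have "(\<Sum>a<N. (sip g (e a))^2) = sip g g"
      unfolding orthonormal_basis_norm[OF V e, symmetric] by (rule sip_cong) (simp_all add: eq)
    finally show ?thesis by (simp add: mult.commute)
  qed
  have le: "R y \<le> R z" if y: "y \<in> sphere 0 1" and z: "z \<in> sphere 0 1" for y z
  proof (cases "R y = 0")
    case False
    then have pos: "R y > 0" using R0[of y] by simp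
    have "norm z = norm y" using y z by simp
    then obtain U where U: "orthogonal_transformation U" "U z = y"
      by (rule orthogonal_transformation_exists)
    \<comment> \<open>The reproducing kernel at \<open>y\<close>, whose value at \<open>y\<close> and squared norm are both \<open>R y\<close>.\<close>
    define q where "q = (\<lambda>w. \<Sum>a<N. e a y * e a w)"
    have q: "q \<in> V" unfolding q_def by (rule function_space_sum[OF V]) (use eV in auto)
    have "q (U z) = R y" unfolding q_def U R_def by (simp add: power2_eq_square)
    moreover have "sip (\<lambda>w. q (U w)) (\<lambda>w. q (U w)) = R y"
      using sip_orthogonal[OF U(1) c[OF q] c[OF q]] orthonormal_basis_norm[OF V e, of "\<lambda>a. e a y"]
      by (simp add: q_def R_def)
    ultimately have "(R y)^2 \<le> R z * R y" using bound[OF inv[OF U(1) q] z] by simp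
    then show ?thesis using pos by (simp add: power2_eq_square)
  qed (use R0 in simp)
  have "R x * ?m = (LINT y|(sphere_measure :: (real^'n) measure). R x)" by simp
  also have "\<dots> = (LINT y|sphere_measure. R y)"
    by (rule Bochner_Integration.integral_cong) (use le x in \<open>auto intro: antisym\<close>)
  also have "\<dots> = (\<Sum>a<N. sip (e a) (e a))"
    unfolding R_def sip_def power2_eq_square
    by (rule Bochner_Integration.integral_sum) (use c eV in \<open>auto intro!: sip_integrable\<close>)
  also have "\<dots> = real N" using e by (simp add: orthonormal_basis_def)
  finally have Rm: "R x * ?m = real N" .
  have "(f x)^2 * ?m \<le> (R x * sip f f) * ?m" by (intro mult_right_mono bound f x) simp
  then show ?thesis by (simp add: Rm[symmetric] mult_ac)
qed

section \<open>Polynomials of bounded degree\<close>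

text \<open>The type of polynomial functions carries no degree.  A polynomial has degree at most \<open>m\<close> iff its restrictions to
  all lines through the origin do.\<close>

definition polys :: "nat \<Rightarrow> (real^'n::finite \<Rightarrow> real) set" where
  "polys m = {p. real_polynomial_function p \<and> (\<forall>x. \<exists>b. \<forall>t. p (t *\<^sub>R x) = (\<Sum>k\<le>m. b k * t ^ k))}"

lemma polynomial_monomials:
  fixes p :: "real^'n \<Rightarrow> real"
  assumes "real_polynomial_function p"
  shows "\<exists>A c. finite A \<and> (\<forall>x. p x = (\<Sum>a\<in>A. c a * (\<Prod>i\<in>UNIV. (x $ i) ^ (a i :: nat))))"
  using assms
proof (induction p rule: real_polynomial_function.induct)
  case (linear f)
  let ?d = "\<lambda>i l. if l = i then 1 else 0 :: nat"
  have inj: "inj ?d"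
    by (rule injI) (metis zero_neq_one)
  have mono: "(\<Prod>l\<in>UNIV. (x $ l) ^ ?d i l) = x $ i" for x :: "real^'n" and i
  proof -
    have "(\<Prod>l\<in>UNIV. (x $ l) ^ ?d i l) = (\<Prod>l\<in>UNIV. if l = i then x $ l else 1)"
      by (rule prod.cong) auto
    then show ?thesis by simp
  qed
  have "f x = (\<Sum>a\<in>range ?d. f (axis (the_inv ?d a) 1) * (\<Prod>l\<in>UNIV. (x $ l) ^ a l))" for x
  proof -
    have "f x = (\<Sum>i\<in>UNIV. x $ i * f (axis i 1))"
      using linear linear_expand_axis bounded_linear.linear by blast
    then show ?thesis by (simp add: sum.reindex[OF inj] the_inv_f_f[OF inj] mono mult.commute)
  qed
  then show ?case
    by (intro exI[of _ "range ?d"] exI[of _ "\<lambda>a. f (axis (the_inv ?d a) 1)"] conjI allI finite_imageI finite)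
next
  case (const c)
  show ?case by (intro exI[of _ "{\<lambda>_. 0}"] exI[of _ "\<lambda>_. c"]) simp
next
  case (add f g)
  then obtain A c B d where A: "finite A" "\<And>x. f x = (\<Sum>a\<in>A. c a * (\<Prod>i\<in>UNIV. (x $ i) ^ (a i :: nat)))"
    and B: "finite B" "\<And>x. g x = (\<Sum>a\<in>B. d a * (\<Prod>i\<in>UNIV. (x $ i) ^ (a i :: nat)))" by blast
  have "f x + g x = (\<Sum>a\<in>A \<union> B. ((if a \<in> A then c a else 0) + (if a \<in> B then d a else 0)) * (\<Prod>i\<in>UNIV. (x $ i) ^ a i))" for x
  proof -
    have "f x = (\<Sum>a\<in>A \<union> B. (if a \<in> A then c a else 0) * (\<Prod>i\<in>UNIV. (x $ i) ^ a i))"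
      unfolding A(2) by (rule sum.mono_neutral_cong_left) (use A B in auto)
    moreover have "g x = (\<Sum>a\<in>A \<union> B. (if a \<in> B then d a else 0) * (\<Prod>i\<in>UNIV. (x $ i) ^ a i))"
      unfolding B(2) by (rule sum.mono_neutral_cong_left) (use A B in auto)
    ultimately show ?thesis by (simp add: distrib_right sum.distrib)
  qed
  then show ?case using A(1) B(1)
    by (intro exI[of _ "A \<union> B"] exI[of _ "\<lambda>a. (if a \<in> A then c a else 0) + (if a \<in> B then d a else 0)"]) simp
next
  case (mult f g)
  then obtain A c B d where A: "finite A" "\<And>x. f x = (\<Sum>a\<in>A. c a * (\<Prod>i\<in>UNIV. (x $ i) ^ (a i :: nat)))"
    and B: "finite B" "\<And>x. g x = (\<Sum>a\<in>B. d a * (\<Prod>i\<in>UNIV. (x $ i) ^ (a i :: nat)))" by blast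
  define s where "s = (\<lambda>(a, b). (\<lambda>i. a i + b i) :: 'n \<Rightarrow> nat)"
  let ?C = "\<lambda>e. \<Sum>ab\<in>{ab \<in> A \<times> B. s ab = e}. c (fst ab) * d (snd ab)"
  have "f x * g x = (\<Sum>e\<in>s ` (A \<times> B). ?C e * (\<Prod>i\<in>UNIV. (x $ i) ^ e i))" for x
  proof -
    have "f x * g x = (\<Sum>ab\<in>A \<times> B. c (fst ab) * d (snd ab) * (\<Prod>i\<in>UNIV. (x $ i) ^ s ab i))"
      unfolding A(2) B(2) sum_product sum.cartesian_product
      by (rule sum.cong) (auto simp: s_def power_add prod.distrib)
    also have "\<dots> = (\<Sum>e\<in>s ` (A \<times> B). \<Sum>ab\<in>{ab \<in> A \<times> B. s ab = e}. c (fst ab) * d (snd ab) * (\<Prod>i\<in>UNIV. (x $ i) ^ s ab i))"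
      by (rule sum.image_gen) (use A B in auto)
    also have "\<dots> = (\<Sum>e\<in>s ` (A \<times> B). ?C e * (\<Prod>i\<in>UNIV. (x $ i) ^ e i))"
      by (rule sum.cong[OF refl]) (auto simp: sum_distrib_right intro!: sum.cong)
    finally show ?thesis .
  qed
  then show ?case using A(1) B(1)
    by (intro exI[of _ "s ` (A \<times> B)"] exI[of _ ?C]) auto
qed

text \<open>Comparing the coefficients of \<open>t\<close> in \<open>p (t x)\<close> shows that the terms of total degree above \<open>m\<close> cancel at
  every \<open>x\<close>.\<close>

lemma polys_span:
  fixes p :: "real^'n \<Rightarrow> real"
  assumes p: "p \<in> polys m"
  shows "\<exists>c. \<forall>x. p x = (\<Sum>a\<in>{a. \<forall>i. a i \<le> m}. c a * (\<Prod>i\<in>UNIV. (x $ i) ^ (a i :: nat)))"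
proof -
  obtain A c where A: "finite A" and pA: "\<And>x. p x = (\<Sum>a\<in>A. c a * (\<Prod>i\<in>UNIV. (x $ i) ^ (a i :: nat)))"
    using p polynomial_monomials[of p] by (auto simp: polys_def)
  let ?mon = "\<lambda>x a. c a * (\<Prod>i\<in>UNIV. (x $ i) ^ (a i :: nat))"
  let ?deg = "\<lambda>a. \<Sum>i\<in>(UNIV::'n set). a i"
  have fin: "finite {a. \<forall>i. (a :: 'n \<Rightarrow> nat) i \<le> m}"
    using finite_PiE[of "UNIV :: 'n set" "\<lambda>_. {..m}"] by (simp add: PiE_def Pi_def)
  have "p x = (\<Sum>a\<in>{a \<in> A. ?deg a \<le> m}. ?mon x a)" for x
  proof -
    obtain M where M: "M \<ge> m" "\<And>a. a \<in> A \<Longrightarrow> ?deg a \<le> M"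
      using A finite_nat_set_iff_bounded_le[of "?deg ` A"] by (metis finite_imageI imageI max.cobounded1 max.coboundedI2)
    obtain b where b: "\<And>t. p (t *\<^sub>R x) = (\<Sum>k\<le>m. b k * t ^ k)" using p unfolding polys_def by blast
    define d where "d k = (\<Sum>a\<in>{a \<in> A. ?deg a = k}. ?mon x a)" for k
    have "p (t *\<^sub>R x) = (\<Sum>k\<le>M. d k * t ^ k)" for t
    proof -
      have "p (t *\<^sub>R x) = (\<Sum>a\<in>A. ?mon x a * t ^ ?deg a)"
        unfolding pA by (rule sum.cong) (auto simp: power_mult_distrib prod.distrib power_sum mult_ac)
      also have "\<dots> = (\<Sum>k\<le>M. \<Sum>a\<in>{a \<in> A. ?deg a = k}. ?mon x a * t ^ ?deg a)"
        by (rule sum.group[symmetric]) (use A M in auto)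
      also have "\<dots> = (\<Sum>k\<le>M. d k * t ^ k)"
        by (rule sum.cong[OF refl]) (auto simp: d_def sum_distrib_right intro!: sum.cong)
      finally show ?thesis .
    qed
    moreover have "(\<Sum>k\<le>m. b k * t ^ k) = (\<Sum>k\<le>M. (if k \<le> m then b k else 0) * t ^ k)" for t
      by (rule sum.mono_neutral_cong_left) (use M in auto)
    ultimately have "\<forall>t. (\<Sum>k\<le>M. d k * t ^ k) = (\<Sum>k\<le>M. (if k \<le> m then b k else 0) * t ^ k)" using b by simp
    then have "\<forall>k\<le>M. d k = (if k \<le> m then b k else 0)" by (simp only: polyfun_eq_coeffs)
    then have d0: "d k = 0" if "m < k" "k \<le> M" for k using that by auto
    \<comment> \<open>Now put \<open>t = 1\<close> and group the monomials by total degree.\<close>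
    have "p x = (\<Sum>a\<in>A. ?mon x a)" by (rule pA)
    also have "\<dots> = (\<Sum>k\<le>M. d k)"
      unfolding d_def by (rule sum.group[symmetric]) (use A M in auto)
    also have "\<dots> = (\<Sum>k\<le>m. d k)"
      by (rule sum.mono_neutral_right) (use M d0 in auto)
    also have "\<dots> = (\<Sum>a\<in>{a \<in> A. ?deg a \<le> m}. ?mon x a)"
    proof -
      have "(\<Sum>k\<le>m. d k) = (\<Sum>k\<le>m. \<Sum>a\<in>{a \<in> {a \<in> A. ?deg a \<le> m}. ?deg a = k}. ?mon x a)"
        unfolding d_def by (intro sum.cong) auto
      also have "\<dots> = (\<Sum>a\<in>{a \<in> A. ?deg a \<le> m}. ?mon x a)"
        by (rule sum.group) (use A in auto)
      finally show ?thesis .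
    qed
    finally show ?thesis .
  qed
  also have "(\<Sum>a\<in>{a \<in> A. ?deg a \<le> m}. ?mon x a) =
     (\<Sum>a\<in>{a. \<forall>i. a i \<le> m}. (if a \<in> A \<and> ?deg a \<le> m then c a else 0) * (\<Prod>i\<in>UNIV. (x $ i) ^ a i))" for x
  proof (rule sum.mono_neutral_cong_left[OF fin])
    show "{a \<in> A. ?deg a \<le> m} \<subseteq> {a. \<forall>i. a i \<le> m}"
    proof safe
      fix a :: "'n \<Rightarrow> nat" and i assume "?deg a \<le> m"
      moreover have "a i \<le> ?deg a" by (rule member_le_sum) auto
      ultimately show "a i \<le> m" by linarith
    qed
  qed auto
  finally show ?thesis by (intro exI allI)
qed

lemma polys_function_space: "function_space (polys m :: (real^'n \<Rightarrow> real) set)"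
  unfolding function_space_def
proof (intro conjI ballI allI)
  show "sphere_continuous f" if "f \<in> polys m" for f :: "real^'n \<Rightarrow> real"
    using that by (auto simp: polys_def polynomial_sphere_continuous)
  show "(\<lambda>x. 0) \<in> polys m" by (auto simp: polys_def intro!: exI[of _ "\<lambda>_. 0"])
  fix f :: "real^'n \<Rightarrow> real" assume f: "f \<in> polys m"
  show "(\<lambda>x. f x + g x) \<in> polys m" if g: "g \<in> polys m" for g
    unfolding polys_def mem_Collect_eq
  proof (intro conjI allI)
    show "real_polynomial_function (\<lambda>x. f x + g x)" using f g by (auto simp: polys_def)
    fix x
    obtain b b' where "\<forall>t. f (t *\<^sub>R x) = (\<Sum>k\<le>m. b k * t ^ k)" "\<forall>t. g (t *\<^sub>R x) = (\<Sum>k\<le>m. b' k * t ^ k)"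
      using f g unfolding polys_def by blast
    then show "\<exists>b. \<forall>t. f (t *\<^sub>R x) + g (t *\<^sub>R x) = (\<Sum>k\<le>m. b k * t ^ k)"
      by (intro exI[of _ "\<lambda>k. b k + b' k"]) (simp add: distrib_right sum.distrib)
  qed
  show "(\<lambda>x. c * f x) \<in> polys m" for c
    unfolding polys_def mem_Collect_eq
  proof (intro conjI allI)
    show "real_polynomial_function (\<lambda>x. c * f x)" using f by (auto simp: polys_def)
    fix x
    obtain b where "\<forall>t. f (t *\<^sub>R x) = (\<Sum>k\<le>m. b k * t ^ k)"
      using f unfolding polys_def by blast
    then show "\<exists>b. \<forall>t. c * f (t *\<^sub>R x) = (\<Sum>k\<le>m. b k * t ^ k)"
      by (intro exI[of _ "\<lambda>k. c * b k"]) (simp add: sum_distrib_left mult.assoc)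
  qed
qed

lemma polys_mult:
  assumes f: "f \<in> polys m" and g: "g \<in> polys l"
  shows "(\<lambda>x. f x * g x) \<in> polys (m + l)"
  unfolding polys_def mem_Collect_eq
proof (intro conjI allI)
  show "real_polynomial_function (\<lambda>x. f x * g x)" using f g by (auto simp: polys_def)
  fix x
  obtain b b' where b: "\<forall>t. f (t *\<^sub>R x) = (\<Sum>k\<le>m. b k * t ^ k)" "\<forall>t. g (t *\<^sub>R x) = (\<Sum>k\<le>l. b' k * t ^ k)"
    using f g unfolding polys_def by blast
  have "f (t *\<^sub>R x) * g (t *\<^sub>R x) = (\<Sum>r\<le>m+l. (\<Sum>k\<in>{k. k \<le> r \<and> k \<le> m \<and> r - k \<le> l}. b k * b' (r - k)) * t ^ r)" for t
  proof -
    have "f (t *\<^sub>R x) * g (t *\<^sub>R x) = (\<Sum>kl\<in>{..m} \<times> {..l}. b (fst kl) * b' (snd kl) * t ^ (fst kl + snd kl))"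
      unfolding b[rule_format] sum_product sum.cartesian_product
      by (rule sum.cong) (auto simp: power_add)
    also have "\<dots> = (\<Sum>r\<le>m+l. \<Sum>kl\<in>{kl \<in> {..m} \<times> {..l}. fst kl + snd kl = r}. b (fst kl) * b' (snd kl) * t ^ (fst kl + snd kl))"
      by (rule sum.group[symmetric]) auto
    also have "\<dots> = (\<Sum>r\<le>m+l. (\<Sum>k\<in>{k. k \<le> r \<and> k \<le> m \<and> r - k \<le> l}. b k * b' (r - k)) * t ^ r)"
    proof (rule sum.cong[OF refl])
      fix r
      have "(\<Sum>kl\<in>{kl \<in> {..m} \<times> {..l}. fst kl + snd kl = r}. b (fst kl) * b' (snd kl) * t ^ (fst kl + snd kl)) =
         (\<Sum>k\<in>{k. k \<le> r \<and> k \<le> m \<and> r - k \<le> l}. b k * b' (r - k) * t ^ r)"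
        by (rule sum.reindex_bij_witness[of _ "\<lambda>k. (k, r - k)" fst]) auto
      then show "(\<Sum>kl\<in>{kl \<in> {..m} \<times> {..l}. fst kl + snd kl = r}. b (fst kl) * b' (snd kl) * t ^ (fst kl + snd kl)) =
         (\<Sum>k\<in>{k. k \<le> r \<and> k \<le> m \<and> r - k \<le> l}. b k * b' (r - k)) * t ^ r" by (simp add: sum_distrib_right)
    qed
    finally show ?thesis .
  qed
  then show "\<exists>b. \<forall>t. f (t *\<^sub>R x) * g (t *\<^sub>R x) = (\<Sum>k\<le>m+l. b k * t ^ k)" by (intro exI allI)
qed

lemma polys_power: "f \<in> polys m \<Longrightarrow> (\<lambda>x. f x ^ p) \<in> polys (p * m)"
proof (induction p)
  case 0
  show ?case by (auto simp: polys_def intro!: exI[of _ "\<lambda>_. 1"])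
next
  case (Suc p)
  then show ?case using polys_mult[of f m "\<lambda>x. f x ^ p" "p * m"] by simp
qed

lemma polys_compose_orthogonal:
  assumes "orthogonal_transformation U" "f \<in> polys m"
  shows "(\<lambda>x. f (U x)) \<in> polys m"
  using assms orthogonal_transformation_linear[OF assms(1)]
  by (auto simp: polys_def polynomial_compose_linear linear_scale)

lemma harmonic_polys: "h \<in> homogeneous_harmonic_polynomials k \<Longrightarrow> k \<le> m \<Longrightarrow> h \<in> polys m"
  unfolding polys_def mem_Collect_eq
proof (intro conjI allI)
  assume h: "h \<in> homogeneous_harmonic_polynomials k" and k: "k \<le> m"
  show "real_polynomial_function h" by (rule harmonic_polynomial[OF h])
  show "\<exists>b. \<forall>t. h (t *\<^sub>R x) = (\<Sum>l\<le>m. b l * t ^ l)" for x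
    using h k by (intro exI[of _ "\<lambda>l. if l = k then h x else 0"])
      (auto simp: harmonic_iff if_distrib if_distribR sum.delta cong: if_cong)
qed

lemma card_exponents: "finite {a. \<forall>i. (a :: 'n::finite \<Rightarrow> nat) i \<le> m}"
  "card {a. \<forall>i. (a :: 'n::finite \<Rightarrow> nat) i \<le> m} = (m + 1) ^ CARD('n)"
proof -
  have eq: "{a. \<forall>i. (a :: 'n \<Rightarrow> nat) i \<le> m} = PiE UNIV (\<lambda>_. {..m})" by (auto simp: PiE_def Pi_def)
  show "finite {a. \<forall>i. (a :: 'n \<Rightarrow> nat) i \<le> m}" unfolding eq by (rule finite_PiE) auto
  show "card {a. \<forall>i. (a :: 'n \<Rightarrow> nat) i \<le> m} = (m + 1) ^ CARD('n)"
    unfolding eq by (simp add: card_PiE)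
qed

lemma polys_sup_bound:
  fixes f :: "real^'n \<Rightarrow> real"
  assumes f: "f \<in> polys m" and x: "x \<in> sphere 0 1"
  shows "(f x)^2 * measure sphere_measure (sphere (0::real^'n) 1) \<le> real ((m + 1) ^ CARD('n)) * sip f f"
proof -
  obtain N e where N: "N \<le> card {a. \<forall>i. (a :: 'n \<Rightarrow> nat) i \<le> m}" and e: "orthonormal_basis (polys m :: (real^'n \<Rightarrow> real) set) N e"
    using orthonormal_basis_exists[OF card_exponents(1) polys_function_space, of m "\<lambda>a x. \<Prod>i\<in>UNIV. (x $ i) ^ (a i :: nat)"] polys_span
    by blast
  have "(f x)^2 * measure sphere_measure (sphere (0::real^'n) 1) \<le> real N * sip f f"
    by (rule invariant_space_sup_bound[OF polys_function_space e _ f x]) (rule polys_compose_orthogonal)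
  also have "\<dots> \<le> real ((m + 1) ^ CARD('n)) * sip f f"
    using N by (intro mult_right_mono sip_nonneg) (simp only: card_exponents(2) of_nat_le_iff)
  finally show ?thesis .
qed

text \<open>Applying the sup bound to the power \<open>f\<^sup>p\<close> makes the loss in the degree as small as desired.\<close>

lemma polys_sup_moment_bound:
  fixes f :: "real^'n \<Rightarrow> real"
  assumes f: "f \<in> polys m" and x: "x \<in> sphere 0 1"
  shows "(f x) ^ (2 * p) * measure sphere_measure (sphere (0::real^'n) 1) \<le>
    real ((p * m + 1) ^ CARD('n)) * (LINT y|sphere_measure. (f y) ^ (2 * p))"
proof -
  have "((f x) ^ p)^2 = (f x) ^ (2 * p)" by (simp only: power_mult[symmetric] mult.commute)
  moreover have "sip (\<lambda>x. f x ^ p) (\<lambda>x. f x ^ p) = (LINT y|sphere_measure. (f y) ^ (2 * p))"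
    by (simp only: sip_def power_add[symmetric] mult_2)
  ultimately show ?thesis using polys_sup_bound[OF polys_power[OF f, of p] x] by simp
qed


section \<open>Projections onto spherical harmonics\<close>

lemma harmonic_function_space: "function_space (homogeneous_harmonic_polynomials k :: (real^'n \<Rightarrow> real) set)"
proof -
  have "(\<lambda>x. 0) \<in> (homogeneous_harmonic_polynomials k :: (real^'n \<Rightarrow> real) set)"
    unfolding harmonic_iff[of "\<lambda>x. 0"] by (simp add: partial_const poly_const)
  then show ?thesis
    unfolding function_space_def
    by (auto intro: harmonic_add harmonic_cmult polynomial_sphere_continuous harmonic_polynomial)
qed

text \<open>An orthonormal basis of the harmonics of degree \<open>k\<close>, paired with its length, is fixed once and for all; this makes
  the projection an explicit finite sum.\<close>

definition hbasis :: "nat \<Rightarrow> nat \<times> (nat \<Rightarrow> real^'n::finite \<Rightarrow> real)" where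
  "hbasis k = (SOME b. orthonormal_basis (homogeneous_harmonic_polynomials k) (fst b) (snd b))"

definition hdim :: "'n::finite itself \<Rightarrow> nat \<Rightarrow> nat" where
  "hdim _ k = fst (hbasis k :: nat \<times> (nat \<Rightarrow> real^'n \<Rightarrow> real))"

definition hfun :: "nat \<Rightarrow> nat \<Rightarrow> real^'n::finite \<Rightarrow> real" where
  "hfun k = snd (hbasis k)"

lemma hbasis: "orthonormal_basis (homogeneous_harmonic_polynomials k :: (real^'n::finite \<Rightarrow> real) set) (hdim TYPE('n) k) (hfun k)"
proof -
  let ?A = "{a. \<forall>i. (a :: 'n \<Rightarrow> nat) i \<le> k}"
  have "\<exists>N e. N \<le> card ?A \<and> orthonormal_basis (homogeneous_harmonic_polynomials k :: (real^'n \<Rightarrow> real) set) N e"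
  proof (rule orthonormal_basis_exists[OF card_exponents(1) harmonic_function_space])
    fix f :: "real^'n \<Rightarrow> real" assume f: "f \<in> homogeneous_harmonic_polynomials k"
    show "\<exists>c. \<forall>x\<in>sphere 0 1. f x = (\<Sum>a\<in>?A. c a * (\<Prod>i\<in>UNIV. (x $ i) ^ a i))"
      using polys_span[OF harmonic_polys[OF f order_refl]] by blast
  qed
  then have "\<exists>b. orthonormal_basis (homogeneous_harmonic_polynomials k :: (real^'n \<Rightarrow> real) set) (fst b) (snd b)" by auto
  then show ?thesis unfolding hbasis_def hdim_def hfun_def by (rule someI_ex)
qed

lemma
  assumes "a < hdim TYPE('n::finite) k"
  shows hfun_harmonic: "(hfun k a :: real^'n \<Rightarrow> real) \<in> homogeneous_harmonic_polynomials k"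
    and hfun_continuous: "sphere_continuous (hfun k a :: real^'n \<Rightarrow> real)"
proof -
  show "(hfun k a :: real^'n \<Rightarrow> real) \<in> homogeneous_harmonic_polynomials k"
    using hbasis[where k=k and 'n='n] assms by (auto simp: orthonormal_basis_def)
  then show "sphere_continuous (hfun k a :: real^'n \<Rightarrow> real)"
    by (rule function_space_continuous[OF harmonic_function_space])
qed

definition hproj :: "nat \<Rightarrow> (real^'n::finite \<Rightarrow> real) \<Rightarrow> real^'n \<Rightarrow> real" where
  "hproj k f x = (\<Sum>a<hdim TYPE('n) k. sip f (hfun k a) * hfun k a x)"

lemma hproj_harmonic: "hproj k (f :: real^'n \<Rightarrow> real) \<in> homogeneous_harmonic_polynomials k"
proof -
  have "hproj k f = (\<lambda>x. \<Sum>a<hdim TYPE('n) k. sip f (hfun k a) * hfun k a x)"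
    by (simp add: hproj_def fun_eq_iff)
  also have "\<dots> \<in> homogeneous_harmonic_polynomials k"
    by (rule function_space_sum[OF harmonic_function_space]) (use hfun_harmonic in auto)
  finally show ?thesis .
qed

lemma hproj_continuous: "sphere_continuous (hproj k f)"
  by (intro polynomial_sphere_continuous harmonic_polynomial[OF hproj_harmonic])

lemma harmonic_continuous: "h \<in> homogeneous_harmonic_polynomials k \<Longrightarrow> sphere_continuous h"
  by (intro polynomial_sphere_continuous harmonic_polynomial)

lemma sip_hproj:
  fixes f :: "real^'n \<Rightarrow> real"
  assumes f: "sphere_continuous f" and h: "h \<in> homogeneous_harmonic_polynomials k"
  shows "sip (hproj k f) h = sip f h"
proof -
  define N where "N = hdim TYPE('n) k"
  define e where "e = (hfun k :: nat \<Rightarrow> real^'n \<Rightarrow> real)"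
  have onb: "orthonormal_basis (homogeneous_harmonic_polynomials k) N e"
    unfolding N_def e_def by (rule hbasis)
  have c: "sphere_continuous (e a)" if "a < N" for a
    using onb that harmonic_continuous by (auto simp: orthonormal_basis_def)
  have expand: "h x = (\<Sum>a<N. sip h (e a) * e a x)" if "x \<in> sphere 0 1" for x
    using onb h that by (auto simp: orthonormal_basis_def)
  have *: "sip g h = (\<Sum>a<N. sip h (e a) * sip g (e a))" if g: "sphere_continuous g" for g
  proof -
    have "sip g h = sip (\<lambda>x. \<Sum>a<N. sip h (e a) * e a x) g"
      by (subst sip_commute) (rule sip_cong, simp_all add: expand)
    also have "\<dots> = (\<Sum>a<N. sip h (e a) * sip (e a) g)"
      using c g by (subst sip_sum_left) (auto intro!: continuous_intros simp: sip_cmult_left)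
    also have "\<dots> = (\<Sum>a<N. sip h (e a) * sip g (e a))" by (intro sum.cong refl arg_cong2[where f="(*)"] sip_commute)
    finally show ?thesis .
  qed
  have "sip (hproj k f) (e b) = sip f (e b)" if "b < N" for b
    by (rule sip_expansion[where N=N and e=e]) (use onb c that in \<open>auto simp: orthonormal_basis_def hproj_def N_def e_def\<close>)
  then show ?thesis unfolding *[OF f] *[OF hproj_continuous] by simp
qed

lemma hproj_unique:
  assumes f: "sphere_continuous f" and p: "p \<in> homogeneous_harmonic_polynomials k"
    and eq: "\<And>h. h \<in> homogeneous_harmonic_polynomials k \<Longrightarrow> sip p h = sip f h" and x: "x \<in> sphere 0 1"
  shows "p x = hproj k f x"
proof -
  let ?d = "\<lambda>x. p x - hproj k f x"
  have d: "?d \<in> homogeneous_harmonic_polynomials k"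
    by (rule function_space_diff[OF harmonic_function_space p hproj_harmonic])
  have "sip ?d ?d = sip p ?d - sip (hproj k f) ?d"
    by (rule sip_diff_left[OF harmonic_continuous[OF p] hproj_continuous harmonic_continuous[OF d]])
  then have "sip ?d ?d = 0" by (simp add: eq[OF d] sip_hproj[OF f d])
  from sip_eq_0_imp[OF harmonic_continuous[OF d] this x] show ?thesis by simp
qed

text \<open>Elements of \<open>spherical_harmonics k\<close> are restrictions, with an unspecified value off the sphere.\<close>

lemma harmonic_proj_eq_hproj:
  fixes f :: "real^'n \<Rightarrow> real"
  assumes f: "sphere_continuous f" and x: "x \<in> sphere 0 1"
  shows "harmonic_proj k f x = hproj k f x"
proof -
  have int: "(LINT x|sphere_measure. (f x - restrict p (sphere 0 1) x) * restrict h (sphere 0 1) x) = sip f h - sip p h"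
    if "p \<in> homogeneous_harmonic_polynomials k" "h \<in> homogeneous_harmonic_polynomials k" for p h
  proof -
    have "(LINT x|sphere_measure. (f x - restrict p (sphere 0 1) x) * restrict h (sphere 0 1) x) = sip (\<lambda>x. f x - p x) h"
      unfolding sip_def by (rule Bochner_Integration.integral_cong) auto
    then show ?thesis using sip_diff_left[OF f harmonic_continuous harmonic_continuous] that by simp
  qed
  have "harmonic_proj k f = restrict (hproj k f) (sphere 0 1)"
    unfolding harmonic_proj_def
  proof (rule the_equality)
    show "restrict (hproj k f) (sphere 0 1) \<in> spherical_harmonics k \<and>
      (\<forall>h\<in>spherical_harmonics k. (LINT x|sphere_measure. (f x - restrict (hproj k f) (sphere 0 1) x) * h x) = 0)"
      by (auto simp: spherical_harmonics_def int hproj_harmonic sip_hproj[OF f] simp del: restrict_apply)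
  next
    fix g assume g: "g \<in> spherical_harmonics k \<and>
      (\<forall>h\<in>spherical_harmonics k. (LINT x|sphere_measure. (f x - g x) * h x) = 0)"
    then obtain p where p: "p \<in> homogeneous_harmonic_polynomials k" and gp: "g = restrict p (sphere 0 1)"
      by (auto simp: spherical_harmonics_def)
    have "sip p h = sip f h" if h: "h \<in> homogeneous_harmonic_polynomials k" for h
      using g h int[OF p h] by (auto simp: gp spherical_harmonics_def)
    from hproj_unique[OF f p this] show "g = restrict (hproj k f) (sphere 0 1)"
      by (auto simp: gp restrict_def fun_eq_iff)
  qed
  then show ?thesis using x by simp
qed

text \<open>The harmonics of degree \<open>k\<close> and their inner product are rotation invariant, and the projection is
  determined by them.\<close>

lemma hproj_orthogonal:
  fixes f :: "real^'n \<Rightarrow> real" and U :: "real^'n \<Rightarrow> real^'n"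
  assumes U: "orthogonal_transformation U" and f: "sphere_continuous f" and x: "x \<in> sphere 0 1"
  shows "hproj k (\<lambda>x. f (U x)) x = hproj k f (U x)"
proof (rule hproj_unique[symmetric, OF continuous_on_compose_orthogonal[OF U f] _ _ x])
  show "(\<lambda>x. hproj k f (U x)) \<in> homogeneous_harmonic_polynomials k"
    by (rule compose_orthogonal_harmonic[OF hproj_harmonic U])
  fix h :: "real^'n \<Rightarrow> real" assume h: "h \<in> homogeneous_harmonic_polynomials k"
  have U': "orthogonal_transformation (inv U)" using U by (rule orthogonal_transformation_inv)
  define h' where "h' = (\<lambda>x. h (inv U x))"
  have h': "h' \<in> homogeneous_harmonic_polynomials k" unfolding h'_def by (rule compose_orthogonal_harmonic[OF h U'])
  have hh: "h = (\<lambda>x. h' (U x))"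
    unfolding h'_def by (simp add: orthogonal_transformation_inj[OF U])
  show "sip (\<lambda>x. hproj k f (U x)) h = sip (\<lambda>x. f (U x)) h"
    unfolding hh sip_orthogonal[OF U hproj_continuous harmonic_continuous[OF h']]
      sip_orthogonal[OF U f harmonic_continuous[OF h']] by (rule sip_hproj[OF f h'])
qed

lemma hproj_diff:
  fixes f :: "real^'n \<Rightarrow> real"
  assumes f: "sphere_continuous f" and g: "sphere_continuous g"
  shows "hproj k (\<lambda>x. f x - g x) x = hproj k f x - hproj k g x"
proof -
  have "sip (\<lambda>x. f x - g x) (hfun k a) = sip f (hfun k a) - sip g (hfun k a)"
    if "a < hdim TYPE('n) k" for a
    by (rule sip_diff_left[OF f g hfun_continuous[OF that]])
  then show ?thesis unfolding hproj_def by (simp add: left_diff_distrib sum_subtractf)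
qed

lemma hproj_sum:
  fixes f :: "'i \<Rightarrow> real^'n \<Rightarrow> real"
  assumes f: "\<And>i. i \<in> I \<Longrightarrow> sphere_continuous (f i)"
  shows "hproj k (\<lambda>x. \<Sum>i\<in>I. z i * f i x) x = (\<Sum>i\<in>I. z i * hproj k (f i) x)"
proof -
  let ?N = "hdim TYPE('n) k" and ?e = "hfun k :: nat \<Rightarrow> real^'n \<Rightarrow> real"
  have "sip (\<lambda>x. \<Sum>i\<in>I. z i * f i x) (?e a) = (\<Sum>i\<in>I. z i * sip (f i) (?e a))" if "a < ?N" for a
    using hfun_continuous[OF that] f by (subst sip_sum_left) (auto simp: sip_cmult_left intro!: continuous_intros)
  then have "hproj k (\<lambda>x. \<Sum>i\<in>I. z i * f i x) x = (\<Sum>a<?N. \<Sum>i\<in>I. z i * (sip (f i) (?e a) * ?e a x))"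
    unfolding hproj_def by (simp add: sum_distrib_right mult.assoc)
  also have "\<dots> = (\<Sum>i\<in>I. \<Sum>a<?N. z i * (sip (f i) (?e a) * ?e a x))" by (rule sum.swap)
  finally show ?thesis by (simp add: hproj_def sum_distrib_left)
qed

text \<open>The projection has finite rank and a continuous kernel.  The bound depends on \<open>k\<close> and serves only to pass uniform
  limits through the projection.\<close>

lemma hproj_bounded:
  "\<exists>B\<ge>0. \<forall>f s x. sphere_continuous (f :: real^'n \<Rightarrow> real) \<longrightarrow> (\<forall>y\<in>sphere 0 1. \<bar>f y\<bar> \<le> s) \<longrightarrow> x \<in> sphere (0::real^'n) 1 \<longrightarrow> \<bar>hproj k f x\<bar> \<le> B * s"
proof -
  let ?N = "hdim TYPE('n) k" and ?e = "hfun k :: nat \<Rightarrow> real^'n \<Rightarrow> real"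
  have c: "sphere_continuous (?e a)" if "a < ?N" for a
    by (rule hfun_continuous[OF that])
  have "\<forall>a. \<exists>b. a < ?N \<longrightarrow> 0 \<le> b \<and> (\<forall>x\<in>sphere 0 1. \<bar>?e a x\<bar> \<le> b)"
    using continuous_on_sphere_bounded[OF c] by (metis less_imp_le)
  then obtain b where b: "\<And>a. a < ?N \<Longrightarrow> 0 \<le> b a" "\<And>a x. a < ?N \<Longrightarrow> x \<in> sphere 0 1 \<Longrightarrow> \<bar>?e a x\<bar> \<le> b a" by metis
  let ?m = "measure sphere_measure (sphere (0::real^'n) 1)"
  define B where "B = (\<Sum>a<?N. (b a * ?m) * b a)"
  have "\<bar>hproj k f x\<bar> \<le> B * s"
    if f: "sphere_continuous f" and s: "\<forall>y\<in>sphere 0 1. \<bar>f y\<bar> \<le> s" and x: "x \<in> sphere 0 1" for f :: "real^'n \<Rightarrow> real" and s x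
  proof -
    have s0: "0 \<le> s" using s x by (metis abs_ge_zero order_trans)
    have sb: "\<bar>sip f (?e a)\<bar> \<le> s * b a * ?m" if a: "a < ?N" for a
    proof -
      have "\<bar>sip f (?e a)\<bar> \<le> (LINT x|sphere_measure. \<bar>f x * ?e a x\<bar>)"
        unfolding sip_def by (rule integral_abs_bound)
      also have "\<dots> \<le> (LINT x|(sphere_measure :: (real^'n) measure). s * b a)"
      proof (rule Bochner_Integration.integral_mono)
        show "integrable sphere_measure (\<lambda>x. \<bar>f x * ?e a x\<bar>)" by (intro integrable_abs sip_integrable f c a)
        show "integrable (sphere_measure :: (real^'n) measure) (\<lambda>x. s * b a)" by simp
        show "\<bar>f x * ?e a x\<bar> \<le> s * b a" if "x \<in> space sphere_measure" for x :: "real^'n"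
          unfolding abs_mult using that s s0 b[OF a] by (intro mult_mono) auto
      qed
      finally show ?thesis by (simp add: mult_ac)
    qed
    have "\<bar>hproj k f x\<bar> \<le> (\<Sum>a<?N. \<bar>sip f (?e a) * ?e a x\<bar>)" unfolding hproj_def by (rule sum_abs)
    also have "\<dots> \<le> (\<Sum>a<?N. (s * b a * ?m) * b a)"
      by (rule sum_mono) (use sb b x s0 in \<open>auto simp: abs_mult intro!: mult_mono mult_nonneg_nonneg\<close>)
    also have "\<dots> = B * s" unfolding B_def sum_distrib_right by (intro sum.cong refl) (simp add: mult_ac)
    finally show ?thesis .
  qed
  moreover have "B \<ge> 0" unfolding B_def by (intro sum_nonneg mult_nonneg_nonneg b) auto
  ultimately show ?thesis by blast
qed

section \<open>Spectral multipliers\<close>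

definition multiplier :: "(nat \<Rightarrow> real) \<Rightarrow> nat \<Rightarrow> (real^'n::finite \<Rightarrow> real) \<Rightarrow> real^'n \<Rightarrow> real" where
  "multiplier c m f x = (\<Sum>k\<le>m. c k * hproj k f x)"

lemma multiplier_polys: "multiplier c m f \<in> polys m"
proof -
  have "multiplier c m f = (\<lambda>x. \<Sum>k\<le>m. c k * hproj k f x)" by (simp add: multiplier_def fun_eq_iff)
  also have "\<dots> \<in> polys m"
    by (rule function_space_sum[OF polys_function_space]) (auto intro: harmonic_polys hproj_harmonic)
  finally show ?thesis .
qed

lemma multiplier_continuous: "sphere_continuous (multiplier c m f)"
  using function_space_continuous[OF polys_function_space multiplier_polys] .

lemma multiplier_orthogonal:
  fixes f :: "real^'n \<Rightarrow> real" and U :: "real^'n \<Rightarrow> real^'n"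
  assumes U: "orthogonal_transformation U" and f: "sphere_continuous f" and x: "x \<in> sphere 0 1"
  shows "multiplier c m (\<lambda>x. f (U x)) x = multiplier c m f (U x)"
  unfolding multiplier_def by (simp add: hproj_orthogonal[OF U f x])

lemma multiplier_diff:
  assumes f: "sphere_continuous f" and g: "sphere_continuous g"
  shows "multiplier c m (\<lambda>x. f x - g x) x = multiplier c m f x - multiplier c m g x"
  unfolding multiplier_def by (simp add: hproj_diff[OF f g] right_diff_distrib sum_subtractf)

lemma multiplier_sum:
  assumes f: "\<And>i. i \<in> I \<Longrightarrow> sphere_continuous (f i)"
  shows "multiplier c m (\<lambda>x. \<Sum>i\<in>I. z i * f i x) x = (\<Sum>i\<in>I. z i * multiplier c m (f i) x)"
proof -
  have "multiplier c m (\<lambda>x. \<Sum>i\<in>I. z i * f i x) x = (\<Sum>k\<le>m. \<Sum>i\<in>I. z i * (c k * hproj k (f i) x))"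
    unfolding multiplier_def by (simp add: hproj_sum[OF f] sum_distrib_left mult.left_commute)
  also have "\<dots> = (\<Sum>i\<in>I. \<Sum>k\<le>m. z i * (c k * hproj k (f i) x))" by (rule sum.swap)
  finally show ?thesis by (simp add: multiplier_def sum_distrib_left)
qed

lemma multiplier_bounded:
  "\<exists>B\<ge>0. \<forall>f s x. sphere_continuous (f :: real^'n \<Rightarrow> real) \<longrightarrow> (\<forall>y\<in>sphere 0 1. \<bar>f y\<bar> \<le> s) \<longrightarrow> x \<in> sphere (0::real^'n) 1 \<longrightarrow> \<bar>multiplier c m f x\<bar> \<le> B * s"
proof -
  have "\<forall>k. \<exists>B. 0 \<le> B \<and> (\<forall>f s x. sphere_continuous f \<longrightarrow> (\<forall>y\<in>sphere 0 1. \<bar>f y\<bar> \<le> s) \<longrightarrow> x \<in> sphere (0::real^'n) 1 \<longrightarrow> \<bar>hproj k f x\<bar> \<le> B * s)"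
    using hproj_bounded by blast
  then obtain B where B0: "\<And>k. 0 \<le> B k" and B: "\<And>k f s x. sphere_continuous f \<Longrightarrow> (\<forall>y\<in>sphere 0 1. \<bar>f y\<bar> \<le> s) \<Longrightarrow>
      x \<in> sphere (0::real^'n) 1 \<Longrightarrow> \<bar>hproj k f x\<bar> \<le> B k * s" by metis
  have "\<bar>multiplier c m f x\<bar> \<le> (\<Sum>k\<le>m. \<bar>c k\<bar> * B k) * s"
    if "sphere_continuous f" "\<forall>y\<in>sphere 0 1. \<bar>f y\<bar> \<le> s" "x \<in> sphere (0::real^'n) 1" for f s x
  proof -
    have "\<bar>multiplier c m f x\<bar> \<le> (\<Sum>k\<le>m. \<bar>c k * hproj k f x\<bar>)" unfolding multiplier_def by (rule sum_abs)
    also have "\<dots> \<le> (\<Sum>k\<le>m. \<bar>c k\<bar> * (B k * s))"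
      unfolding abs_mult by (intro sum_mono mult_left_mono B that) auto
    finally show ?thesis by (simp add: sum_distrib_right mult.assoc)
  qed
  moreover have "0 \<le> (\<Sum>k\<le>m. \<bar>c k\<bar> * B k)" by (intro sum_nonneg mult_nonneg_nonneg B0) auto
  ultimately show ?thesis by blast
qed

lemma multiplier_norm:
  fixes f :: "real^'n \<Rightarrow> real"
  assumes D: "CARD('n) \<ge> 2"
  shows "sip (multiplier c m f) (multiplier c m f) = (\<Sum>k\<le>m. (c k)^2 * sip (hproj k f) (hproj k f))"
proof -
  have "sip (multiplier c m f) (multiplier c m f) = sip (\<lambda>x. \<Sum>k\<le>m. c k * hproj k f x) (multiplier c m f)"
    by (rule sip_cong) (simp_all add: multiplier_def)
  also have "\<dots> = (\<Sum>k\<le>m. c k * sip (hproj k f) (multiplier c m f))"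
    using hproj_continuous multiplier_continuous
    by (subst sip_sum_left) (auto simp: sip_cmult_left intro!: continuous_intros)
  also have "\<dots> = (\<Sum>k\<le>m. c k * (c k * sip (hproj k f) (hproj k f)))"
  proof (rule sum.cong[OF refl])
    fix k assume k: "k \<in> {..m}"
    have "sip (hproj k f) (multiplier c m f) = sip (\<lambda>x. \<Sum>l\<le>m. c l * hproj l f x) (hproj k f)"
      by (subst sip_commute) (rule sip_cong, simp_all add: multiplier_def)
    also have "\<dots> = (\<Sum>l\<le>m. c l * sip (hproj l f) (hproj k f))"
      using hproj_continuous by (subst sip_sum_left) (auto simp: sip_cmult_left intro!: continuous_intros)
    also have "\<dots> = (\<Sum>l\<le>m. if l = k then c k * sip (hproj k f) (hproj k f) else 0)"
      by (rule sum.cong[OF refl]) (use harmonic_orthogonal[OF D hproj_harmonic hproj_harmonic] in auto)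
    also have "\<dots> = c k * sip (hproj k f) (hproj k f)" using k by (subst sum.delta) auto
    finally show "c k * sip (hproj k f) (multiplier c m f) = c k * (c k * sip (hproj k f) (hproj k f))" by simp
  qed
  finally show ?thesis by (simp add: power2_eq_square mult.assoc)
qed

lemma bessel_harmonics:
  fixes f :: "real^'n \<Rightarrow> real"
  assumes D: "CARD('n) \<ge> 2" and f: "sphere_continuous f"
  shows "(\<Sum>k\<le>m. sip (hproj k f) (hproj k f)) \<le> sip f f"
proof -
  let ?g = "multiplier (\<lambda>_. 1) m f"
  have "sip f ?g = sip (\<lambda>x. \<Sum>k\<le>m. 1 * hproj k f x) f"
    by (subst sip_commute) (rule sip_cong, simp_all add: multiplier_def)
  also have "\<dots> = (\<Sum>k\<le>m. sip (hproj k f) f)"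
    using hproj_continuous f by (subst sip_sum_left) (auto intro!: continuous_intros)
  also have "\<dots> = (\<Sum>k\<le>m. sip (hproj k f) (hproj k f))"
    by (rule sum.cong[OF refl]) (simp add: sip_hproj[OF f hproj_harmonic] sip_commute[of f])
  finally have "sip f ?g = (\<Sum>k\<le>m. sip (hproj k f) (hproj k f))" .
  moreover have "sip ?g ?g = (\<Sum>k\<le>m. sip (hproj k f) (hproj k f))"
    by (simp add: multiplier_norm[OF D])
  moreover have "0 \<le> sip f f - 2 * sip f ?g + sip ?g ?g"
    unfolding sip_diff_diff[OF f multiplier_continuous, symmetric] by (rule sip_nonneg)
  ultimately show ?thesis by simp
qed

text \<open>All frequencies selected by \<open>c\<close> are comparable to \<open>1/\<theta>\<close>, so the rotation gap applies to each of them with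
  the same angle.  Rotations commute with the projections, and Bessel's inequality sums the displacements over the degrees.\<close>

lemma dyadic_multiplier_bound:
  fixes f :: "real^'n \<Rightarrow> real"
  assumes D: "CARD('n) \<ge> 2" and f: "sphere_continuous f"
    and c: "\<And>k. \<bar>c k\<bar> \<le> 1" and \<theta>: "\<theta> \<noteq> 0"
    and low: "\<And>k. c k \<noteq> 0 \<Longrightarrow> 1/16 \<le> \<theta>^2 * sphere_eigenvalue TYPE(real^'n) k"
    and high: "\<And>k. c k \<noteq> 0 \<Longrightarrow> \<theta>^2 * sphere_eigenvalue TYPE(real^'n) k \<le> 1"
  shows "sip (multiplier c m f) (multiplier c m f) \<le>
    16 * (\<Sum>(i,j)\<in>{(i,j). i \<noteq> j}. sip (\<lambda>x. f (plane_rot i j \<theta> x) - f x) (\<lambda>x. f (plane_rot i j \<theta> x) - f x))"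
proof -
  let ?d = "\<lambda>i j g x. g (plane_rot i j \<theta> x) - g x :: real"
  let ?l = "sphere_eigenvalue TYPE(real^'n)"
  have rot: "orthogonal_transformation (plane_rot i j \<theta> :: real^'n \<Rightarrow> real^'n)" if "i \<noteq> j" for i j
    by (rule orthogonal_plane_rot[OF that])
  have fd: "sphere_continuous (?d i j f)" if "i \<noteq> j" for i j
    by (rule continuous_on_diff[OF continuous_on_compose_orthogonal[OF rot[OF that] f] f])
  have pd: "sip (?d i j (hproj k f)) (?d i j (hproj k f)) = sip (hproj k (?d i j f)) (hproj k (?d i j f))"
    if "i \<noteq> j" for i j k
  proof -
    have "?d i j (hproj k f) x = hproj k (?d i j f) x" if "x \<in> sphere 0 1" for x
      using hproj_diff[OF continuous_on_compose_orthogonal[OF rot[OF \<open>i \<noteq> j\<close>] f] f]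
        hproj_orthogonal[OF rot[OF \<open>i \<noteq> j\<close>] f that] by simp
    then show ?thesis by (intro sip_cong)
  qed
  have "sip (multiplier c m f) (multiplier c m f) = (\<Sum>k\<le>m. (c k)^2 * sip (hproj k f) (hproj k f))"
    by (rule multiplier_norm[OF D])
  also have "\<dots> \<le> (\<Sum>k\<le>m. 16 * (\<Sum>(i,j)\<in>{(i,j). i \<noteq> j}. sip (hproj k (?d i j f)) (hproj k (?d i j f))))"
  proof (rule sum_mono)
    fix k
    have s0: "0 \<le> (\<Sum>(i,j)\<in>{(i::'n,j). i \<noteq> j}. sip (hproj k (?d i j f)) (hproj k (?d i j f)))"
      by (rule sum_nonneg) (auto simp: sip_nonneg)
    show "(c k)^2 * sip (hproj k f) (hproj k f) \<le> 16 * (\<Sum>(i,j)\<in>{(i,j). i \<noteq> j}. sip (hproj k (?d i j f)) (hproj k (?d i j f)))"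
    proof (cases "c k = 0")
      case True
      then show ?thesis using s0 by simp
    next
      case False
      have "(c k)^2 \<le> 1" using c[of k] by (simp add: abs_square_le_1)
      then have "(c k)^2 * sip (hproj k f) (hproj k f) \<le> 1 * sip (hproj k f) (hproj k f)"
        by (intro mult_right_mono sip_nonneg)
      also have "\<dots> \<le> 16 * (\<theta>^2 * ?l k) * sip (hproj k f) (hproj k f)"
        using low[OF False] by (intro mult_right_mono sip_nonneg) simp
      also have "\<dots> \<le> 16 * (\<Sum>(i,j)\<in>{(i,j). i \<noteq> j}. sip (?d i j (hproj k f)) (?d i j (hproj k f)))"
        using harmonic_rotation_gap[OF hproj_harmonic high[OF False], of f] by simp
      also have "(\<Sum>(i,j)\<in>{(i,j). i \<noteq> j}. sip (?d i j (hproj k f)) (?d i j (hproj k f))) =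
         (\<Sum>(i,j)\<in>{(i,j). i \<noteq> j}. sip (hproj k (?d i j f)) (hproj k (?d i j f)))"
        by (rule sum.cong) (auto simp: pd)
      finally show ?thesis .
    qed
  qed
  also have "\<dots> = 16 * (\<Sum>(i,j)\<in>{(i,j). i \<noteq> j}. \<Sum>k\<le>m. sip (hproj k (?d i j f)) (hproj k (?d i j f)))"
    unfolding sum_distrib_left[symmetric] case_prod_unfold by (subst sum.swap) (rule refl)
  also have "\<dots> \<le> 16 * (\<Sum>(i,j)\<in>{(i,j). i \<noteq> j}. sip (?d i j f) (?d i j f))"
    by (intro mult_left_mono sum_mono) (auto intro!: bessel_harmonics[OF D] fd)
  finally show ?thesis .
qed

section \<open>Littlewood--Paley blocks\<close>

lemma smooth_cutoff_zero:
  assumes "smooth_cutoff \<Phi>" "\<bar>r\<bar> > 2" shows "\<Phi> r = 0"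
proof (rule ccontr)
  assume "\<Phi> r \<noteq> 0"
  then have "r \<in> closure {x. \<Phi> x \<noteq> 0}" by (intro subsetD[OF closure_subset]) simp
  moreover have "closure {x. \<Phi> x \<noteq> 0} \<subseteq> {-2..2}" using assms(1) by (simp add: smooth_cutoff_def)
  ultimately have "r \<in> {-2..2}" by (rule rev_subsetD)
  then show False using assms(2) by auto
qed

lemma
  assumes \<Phi>: "smooth_cutoff \<Phi>" and r: "0 \<le> r"
  shows dyadic_cutoff_bound: "\<bar>dyadic_cutoff \<Phi> j r\<bar> \<le> 1"
    and dyadic_cutoff_high: "2 ^ (j + 1) < r \<Longrightarrow> dyadic_cutoff \<Phi> j r = 0"
    and dyadic_cutoff_low: "1 \<le> j \<Longrightarrow> r < 2 ^ j / 2 \<Longrightarrow> dyadic_cutoff \<Phi> j r = 0"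
proof -
  have b: "0 \<le> \<Phi> x \<and> \<Phi> x \<le> 1" for x using \<Phi> by (auto simp: smooth_cutoff_def)
  show "\<bar>dyadic_cutoff \<Phi> j r\<bar> \<le> 1"
    using b[of r] b[of "r / 2^j"] b[of "2 * (r / 2^j)"] by (auto simp: dyadic_cutoff_def abs_le_iff)
  show "dyadic_cutoff \<Phi> j r = 0" if "2 ^ (j + 1) < r"
  proof -
    have "2 < r / 2 ^ j" using that by (simp add: field_simps)
    moreover have "(2::real) * 1 \<le> 2 * 2 ^ j" by (intro mult_left_mono) auto
    moreover have "\<Phi> x = 0" if "2 < x" for x using smooth_cutoff_zero[OF \<Phi>, of x] that by simp
    ultimately show ?thesis using that by (cases "j = 0") (auto simp: dyadic_cutoff_def)
  qed
  show "dyadic_cutoff \<Phi> j r = 0" if "1 \<le> j" "r < 2 ^ j / 2"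
  proof -
    have 0: "0 \<le> r / 2 ^ j" and 1: "2 * (r / 2 ^ j) \<le> 1" using that r by (simp_all add: field_simps)
    have one: "\<Phi> x = 1" if "0 \<le> x" "x \<le> 1" for x using \<Phi> that by (simp add: smooth_cutoff_def)
    have "\<Phi> (r / 2 ^ j) = 1" using 0 1 by (intro one) linarith+
    moreover have "\<Phi> (2 * (r / 2 ^ j)) = 1" using 0 1 by (intro one) linarith+
    ultimately have "\<Phi> (r / 2 ^ j) = 1" "\<Phi> (2 * (r / 2 ^ j)) = 1" .
    then show ?thesis using that by (simp add: dyadic_cutoff_def)
  qed
qed

definition block_coeff :: "(real \<Rightarrow> real) \<Rightarrow> nat \<Rightarrow> 'n::finite itself \<Rightarrow> nat \<Rightarrow> real" where
  "block_coeff \<Phi> j _ k = dyadic_cutoff \<Phi> j (sqrt (sphere_eigenvalue TYPE(real^'n) k))"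

text \<open>The eigenvalue of degree \<open>k\<close> is at least \<open>k\<^sup>2\<close>, so degrees above \<open>2\<^bsup>j+1\<^esup>\<close> lie outside the
  support of the cutoff.\<close>

lemma littlewood_paley_eq_multiplier:
  fixes f :: "real^'n \<Rightarrow> real"
  assumes D: "CARD('n) \<ge> 2" and \<Phi>: "smooth_cutoff \<Phi>" and f: "sphere_continuous f" and x: "x \<in> sphere 0 1"
  shows "littlewood_paley \<Phi> j f x = multiplier (block_coeff \<Phi> j TYPE('n)) (2 ^ (j + 1)) f x"
proof -
  have "block_coeff \<Phi> j TYPE('n) k = 0" if k: "k \<notin> {..2 ^ (j + 1)}" for k
    unfolding block_coeff_def
  proof (rule dyadic_cutoff_high[OF \<Phi>])
    have sq: "(real k)^2 \<le> sphere_eigenvalue TYPE(real^'n) k" by (rule sphere_eigenvalue_ge_square[OF D])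
    show "0 \<le> sqrt (sphere_eigenvalue TYPE(real^'n) k)"
      using sq by (intro real_sqrt_ge_zero) (meson order_trans zero_le_power2)
    have "2 ^ (j + 1) < real k"
      using k by (metis atMost_iff not_le of_nat_less_iff of_nat_numeral of_nat_power)
    also have "real k \<le> sqrt (sphere_eigenvalue TYPE(real^'n) k)" by (rule real_le_rsqrt[OF sq])
    finally show "2 ^ (j + 1) < sqrt (sphere_eigenvalue TYPE(real^'n) k)" .
  qed
  then have "littlewood_paley \<Phi> j f x = (\<Sum>k\<le>2 ^ (j + 1). block_coeff \<Phi> j TYPE('n) k * harmonic_proj k f x)"
    unfolding littlewood_paley_def block_coeff_def by (intro suminf_finite) auto
  then show ?thesis by (simp add: multiplier_def harmonic_proj_eq_hproj[OF f x])
qed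

text \<open>On the support of the cutoff \<open>\<surd>\<lambda>\<close> lies between \<open>2\<^bsup>j-1\<^esup>\<close> and \<open>2\<^bsup>j+1\<^esup>\<close>, hence \<open>\<theta>\<^sup>2 \<lambda>\<close>
  between \<open>1/16\<close> and \<open>1\<close>.\<close>

lemma block_energy_bound:
  fixes f :: "real^'n \<Rightarrow> real"
  assumes D: "CARD('n) \<ge> 2" and \<Phi>: "smooth_cutoff \<Phi>" and f: "sphere_continuous f" and j: "1 \<le> j"
    and \<theta>: "\<theta> = 1 / 2 ^ (j + 1)"
  shows "sip (multiplier (block_coeff \<Phi> j TYPE('n)) m f) (multiplier (block_coeff \<Phi> j TYPE('n)) m f) \<le>
    16 * (\<Sum>(i,l)\<in>{(i,l). i \<noteq> l}. sip (\<lambda>x. f (plane_rot i l \<theta> x) - f x) (\<lambda>x. f (plane_rot i l \<theta> x) - f x))"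
proof (rule dyadic_multiplier_bound[OF D f])
  let ?l = "sphere_eigenvalue TYPE(real^'n)"
  have l0: "0 \<le> ?l k" for k using sphere_eigenvalue_ge_square[OF D, of k] by (meson order_trans zero_le_power2)
  show "\<bar>block_coeff \<Phi> j TYPE('n) k\<bar> \<le> 1" for k
    unfolding block_coeff_def by (rule dyadic_cutoff_bound[OF \<Phi>]) (simp add: l0)
  show "\<theta> \<noteq> 0" by (simp add: \<theta>)
  fix k assume k: "block_coeff \<Phi> j TYPE('n) k \<noteq> 0"
  have low: "2 ^ j / 2 \<le> sqrt (?l k)"
    using k dyadic_cutoff_low[OF \<Phi> real_sqrt_ge_zero[OF l0] j] unfolding block_coeff_def by (meson not_le)
  have high: "sqrt (?l k) \<le> 2 ^ (j + 1)"
    using k dyadic_cutoff_high[OF \<Phi> real_sqrt_ge_zero[OF l0]] unfolding block_coeff_def by (meson not_le)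
  have "(2 ^ j / 2)^2 \<le> (sqrt (?l k))^2" by (rule power_mono[OF low]) simp
  then have "(2 ^ j / 2)^2 \<le> ?l k" by (simp add: l0)
  then have "\<theta>^2 * (2 ^ j / 2)^2 \<le> \<theta>^2 * ?l k" by (rule mult_left_mono) simp
  moreover have "\<theta>^2 * (2 ^ j / 2)^2 = 1/16" by (simp add: \<theta> power_divide power_mult_distrib)
  ultimately show "1/16 \<le> \<theta>^2 * ?l k" by simp
  have "(sqrt (?l k))^2 \<le> (2 ^ (j + 1))^2" by (rule power_mono[OF high]) (simp add: l0)
  then have "?l k \<le> (2 ^ (j + 1))^2" by (simp add: l0)
  then have "\<theta>^2 * ?l k \<le> \<theta>^2 * (2 ^ (j + 1))^2" by (rule mult_left_mono) simp
  moreover have "\<theta>^2 * (2 ^ (j + 1))^2 = 1" by (simp add: \<theta> power_divide)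
  ultimately show "\<theta>^2 * ?l k \<le> 1" by simp
qed


section \<open>Moments of Gaussian variables\<close>

text \<open>The moment of order \<open>2p\<close> of the standard normal distribution, \<open>(2p - 1)!!\<close>.\<close>

definition gauss_moment :: "nat \<Rightarrow> real" where
  "gauss_moment p = fact (2 * p) / (2 ^ p * fact p)"

lemma gauss_moment_nonneg: "0 \<le> gauss_moment p"
  by (simp add: gauss_moment_def)

lemma (in prob_space) gaussian_variable_power_integrable:
  assumes X: "gaussian_variable M X"
  shows "integrable M (\<lambda>w. X w ^ k)"
proof -
  have [measurable]: "X \<in> borel_measurable M" using X by (simp add: gaussian_variable_def)
  from X consider (normal) m \<sigma> where "\<sigma> > 0" "distributed M lborel X (\<lambda>x. ennreal (normal_density m \<sigma> x))"
    | (const) m where "AE w in M. X w = m" by (auto simp: gaussian_variable_def)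
  then show ?thesis
  proof cases
    case normal
    have shifted: "integrable M (\<lambda>w. (X w - m) ^ l)" for l
      using distributed_integrable[OF normal(2), of "\<lambda>x. (x - m) ^ l"] integrable_normal_moment[OF normal(1), of m l]
      by simp
    have "X w ^ k = (\<Sum>l\<le>k. of_nat (k choose l) * (X w - m) ^ l * m ^ (k - l))" for w
      using binomial_ring[of "X w - m" m k] by simp
    moreover have "integrable M (\<lambda>w. \<Sum>l\<le>k. of_nat (k choose l) * (X w - m) ^ l * m ^ (k - l))"
      by (intro Bochner_Integration.integrable_sum integrable_mult_left integrable_mult_right shifted)
    ultimately show ?thesis by simp
  next
    case const
    then have ae: "AE w in M. X w ^ k = m ^ k" by auto
    show ?thesis by (rule integrable_cong_AE_imp[of _ "\<lambda>_. m ^ k"]) (use ae in auto)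
  qed
qed

lemma (in prob_space) centered_gaussian_even_moment:
  assumes X: "gaussian_variable M X" and mean: "expectation X = 0"
  shows "expectation (\<lambda>w. X w ^ (2 * p)) = gauss_moment p * (expectation (\<lambda>w. X w ^ 2)) ^ p"
proof -
  have [measurable]: "X \<in> borel_measurable M" using X by (simp add: gaussian_variable_def)
  from X consider (normal) m \<sigma> where "\<sigma> > 0" "distributed M lborel X (\<lambda>x. ennreal (normal_density m \<sigma> x))"
    | (const) m where "AE w in M. X w = m" by (auto simp: gaussian_variable_def)
  then show ?thesis
  proof cases
    case normal
    have "expectation X = m"
      using distributed_integral[OF normal(2), of "\<lambda>x. x"] integral_normal_moment_nz_1[OF normal(1), of m] by simp
    then have m: "m = 0" using mean by simp
    have mom: "expectation (\<lambda>w. X w ^ (2 * q)) = gauss_moment q * (\<sigma>\<^sup>2) ^ q" for q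
    proof -
      have "expectation (\<lambda>w. X w ^ (2 * q)) = fact (2 * q) / ((2 / \<sigma>\<^sup>2) ^ q * fact q)"
        using distributed_integral[OF normal(2), of "\<lambda>x. x ^ (2 * q)"] integral_normal_moment_even[OF normal(1), of 0 q]
        by (simp add: m)
      then show ?thesis by (simp add: gauss_moment_def power_divide)
    qed
    have "expectation (\<lambda>w. X w ^ 2) = \<sigma>\<^sup>2" using mom[of 1] by (simp add: gauss_moment_def fact_2)
    then show ?thesis using mom[of p] by simp
  next
    case const
    have "expectation X = expectation (\<lambda>_. m)" by (rule integral_cong_AE) (use const in auto)
    then have "m = 0" using mean by (simp add: prob_space)
    then have X0: "AE w in M. X w = 0" using const by simp
    show ?thesis
    proof (cases "p = 0")
      case True
      then show ?thesis by (simp add: gauss_moment_def prob_space)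
    next
      case False
      have "expectation (\<lambda>w. X w ^ (2 * q)) = expectation (\<lambda>_. 0)" if "q \<noteq> 0" for q
        by (rule integral_cong_AE) (use X0 that in auto)
      from this[of p] this[of 1] show ?thesis using False by simp
    qed
  qed
qed

section \<open>Linear combinations of a Gaussian process\<close>

locale gaussian_field = prob_space M for M :: "'w measure" +
  fixes S :: "'a set" and Z :: "'a \<Rightarrow> 'w \<Rightarrow> real" and K :: "'a \<Rightarrow> 'a \<Rightarrow> real"
  assumes process: "centered_gaussian_process M S Z K"
begin

lemma gaussian_combination:
  assumes N: "finite N" "N \<subseteq> S"
  shows "gaussian_variable M (\<lambda>w. \<Sum>y\<in>N. a y * Z y w)"
proof -
  obtain h where h: "bij_betw h {..<card N} N"
    using ex_bij_betw_nat_finite[OF N(1)] by (auto simp: atLeast0LessThan)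
  have hS: "h i \<in> S" if "i < card N" for i
    using h N(2) that by (auto simp: bij_betw_def)
  have "gaussian_variable M (\<lambda>w. \<Sum>i<card N. a (h i) * Z (h i) w)"
    using process hS unfolding centered_gaussian_process_def by (auto dest: spec[of _ "card N"])
  moreover have "(\<Sum>i<card N. a (h i) * Z (h i) w) = (\<Sum>y\<in>N. a y * Z y w)" for w
    by (rule sum.reindex_bij_betw[OF h])
  ultimately show ?thesis by simp
qed

lemma gaussian_single: "y \<in> S \<Longrightarrow> gaussian_variable M (Z y)"
  using gaussian_combination[of "{y}" "\<lambda>_. 1"] by simp

lemma Z_measurable: "y \<in> S \<Longrightarrow> Z y \<in> borel_measurable M"
  using gaussian_single by (simp add: gaussian_variable_def)

lemma covariance: "x \<in> S \<Longrightarrow> y \<in> S \<Longrightarrow> expectation (\<lambda>w. Z x w * Z y w) = K x y"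
  using process unfolding centered_gaussian_process_def by meson

lemma product_integrable:
  assumes "x \<in> S" "y \<in> S"
  shows "integrable M (\<lambda>w. Z x w * Z y w)"
proof (rule Bochner_Integration.integrable_bound)
  show "integrable M (\<lambda>w. (Z x w)^2 + (Z y w)^2)"
    by (intro Bochner_Integration.integrable_add gaussian_variable_power_integrable gaussian_single assms)
  show "(\<lambda>w. Z x w * Z y w) \<in> borel_measurable M"
    using Z_measurable[OF assms(1)] Z_measurable[OF assms(2)] by measurable
  have "\<bar>a * b\<bar> \<le> a^2 + b^2" for a b :: real
  proof -
    have "0 \<le> (\<bar>a\<bar> - \<bar>b\<bar>)^2" by simp
    then have "2 * (\<bar>a\<bar> * \<bar>b\<bar>) \<le> a^2 + b^2" by (simp add: power2_diff)
    moreover have "0 \<le> \<bar>a\<bar> * \<bar>b\<bar>" by simp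
    ultimately show ?thesis unfolding abs_mult by linarith
  qed
  then show "AE w in M. norm (Z x w * Z y w) \<le> norm ((Z x w)^2 + (Z y w)^2)"
    by (simp add: abs_of_nonneg)
qed

definition variance_form :: "'a set \<Rightarrow> ('a \<Rightarrow> real) \<Rightarrow> real" where
  "variance_form N a = (\<Sum>y\<in>N. \<Sum>z\<in>N. a y * a z * K y z)"

lemma combination_second_moment:
  assumes N: "finite N" "N \<subseteq> S"
  shows "expectation (\<lambda>w. (\<Sum>y\<in>N. a y * Z y w)^2) = variance_form N a"
proof -
  have int: "integrable M (\<lambda>w. (a y * a z) * (Z y w * Z z w))" if "y \<in> N" "z \<in> N" for y z
    using that N(2) by (intro integrable_mult_right product_integrable) auto
  have cov: "expectation (\<lambda>w. Z y w * Z z w) = K y z" if "y \<in> N" "z \<in> N" for y z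
    using that N(2) by (intro covariance) auto
  have "expectation (\<lambda>w. (\<Sum>y\<in>N. a y * Z y w)^2) =
     expectation (\<lambda>w. \<Sum>y\<in>N. \<Sum>z\<in>N. (a y * a z) * (Z y w * Z z w))"
    by (simp add: power2_eq_square sum_product mult_ac)
  also have "\<dots> = (\<Sum>y\<in>N. expectation (\<lambda>w. \<Sum>z\<in>N. (a y * a z) * (Z y w * Z z w)))"
    by (rule Bochner_Integration.integral_sum) (intro Bochner_Integration.integrable_sum int)
  also have "\<dots> = (\<Sum>y\<in>N. \<Sum>z\<in>N. expectation (\<lambda>w. (a y * a z) * (Z y w * Z z w)))"
    by (intro sum.cong refl Bochner_Integration.integral_sum int)
  also have "\<dots> = variance_form N a"
    unfolding variance_form_def
    by (intro sum.cong refl) (use cov in simp)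
  finally show ?thesis .
qed

lemma variance_form_nonneg: "finite N \<Longrightarrow> N \<subseteq> S \<Longrightarrow> 0 \<le> variance_form N a"
  using Bochner_Integration.integral_nonneg[of M "\<lambda>w. (\<Sum>y\<in>N. a y * Z y w)^2"] combination_second_moment[of N a] by simp

lemma combination_moment:
  assumes N: "finite N" "N \<subseteq> S"
  shows "(\<integral>\<^sup>+w. ennreal ((\<Sum>y\<in>N. a y * Z y w) ^ (2 * p)) \<partial>M) = ennreal (gauss_moment p * variance_form N a ^ p)"
proof -
  let ?X = "\<lambda>w. \<Sum>y\<in>N. a y * Z y w"
  have X: "gaussian_variable M ?X" by (rule gaussian_combination[OF N])
  have "expectation ?X = (\<Sum>y\<in>N. expectation (\<lambda>w. a y * Z y w))"
    using N gaussian_variable_power_integrable[OF gaussian_single, of _ 1]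
    by (intro Bochner_Integration.integral_sum) auto
  also have "\<dots> = 0"
    using N process by (intro sum.neutral) (auto simp: centered_gaussian_process_def)
  finally have mean: "expectation ?X = 0" .
  have "expectation (\<lambda>w. ?X w ^ (2 * p)) = gauss_moment p * variance_form N a ^ p"
    using centered_gaussian_even_moment[OF X mean, of p] combination_second_moment[OF N] by simp
  moreover have "(\<integral>\<^sup>+w. ennreal (?X w ^ (2 * p)) \<partial>M) = ennreal (expectation (\<lambda>w. ?X w ^ (2 * p)))"
    by (rule nn_integral_eq_integral[OF gaussian_variable_power_integrable[OF X]])
      (simp add: power_mult)
  ultimately show ?thesis by simp
qed

lemma increment_moment:
  assumes "x \<in> S" "y \<in> S"
  shows "(\<integral>\<^sup>+w. ennreal ((Z x w - Z y w) ^ (2 * p)) \<partial>M) =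
    ennreal (gauss_moment p * (K x x - 2 * K x y + K y y) ^ p)"
proof (cases "x = y")
  case True
  show ?thesis
  proof (cases "p = 0")
    case True
    then show ?thesis by (simp add: gauss_moment_def emeasure_space_1)
  next
    case False
    then show ?thesis using \<open>x = y\<close> by (simp add: power_0_left)
  qed
next
  case False
  define a where "a = (\<lambda>z. if z = x then 1 else - 1 :: real)"
  have "K x y = K y x"
  proof -
    have "expectation (\<lambda>w. Z x w * Z y w) = K x y" "expectation (\<lambda>w. Z y w * Z x w) = K y x"
      using process assms by (auto simp: centered_gaussian_process_def)
    then show ?thesis by (simp add: mult.commute)
  qed
  then have "variance_form {x, y} a = K x x - 2 * K x y + K y y"
    using False by (simp add: variance_form_def a_def)
  moreover have "(\<Sum>z\<in>{x, y}. a z * Z z w) = Z x w - Z y w" for w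
    using False by (simp add: a_def)
  ultimately show ?thesis using combination_moment[of "{x, y}" a p] assms by simp
qed

end


section \<open>Almost sure bounds from moments\<close>

text \<open>The series of the expectations converges, so the series of the variables is almost surely finite.  This is
  how moment bounds become bounds for trajectories below.\<close>

lemma (in prob_space) AE_bounded_of_geometric_moments:
  fixes V :: "nat \<Rightarrow> 'a \<Rightarrow> ennreal"
  assumes [measurable]: "\<And>n. V n \<in> borel_measurable M"
    and le: "\<And>n. (\<integral>\<^sup>+w. V n w \<partial>M) \<le> ennreal (A * q ^ n)" and q: "0 \<le> q" "q < 1" and A: "0 \<le> A"
  shows "AE w in M. \<exists>B>0. \<forall>n. V n w \<le> ennreal B"
proof -
  have "(\<integral>\<^sup>+w. (\<Sum>n. V n w) \<partial>M) = (\<Sum>n. \<integral>\<^sup>+w. V n w \<partial>M)"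
    by (rule nn_integral_suminf) simp
  also have "\<dots> \<le> (\<Sum>n. ennreal (A * q ^ n))"
    by (rule suminf_le) (auto intro: le)
  also have "\<dots> = ennreal (\<Sum>n. A * q ^ n)"
    by (rule suminf_ennreal2) (use A q in \<open>auto intro!: summable_mult\<close>)
  also have "\<dots> < \<infinity>" by simp
  finally have "(\<integral>\<^sup>+w. (\<Sum>n. V n w) \<partial>M) \<noteq> \<infinity>" by simp
  then have "AE w in M. (\<Sum>n. V n w) \<noteq> \<infinity>"
    by (intro nn_integral_PInf_AE) simp_all
  then show ?thesis
  proof (rule AE_mp, intro AE_I2 impI)
    fix w assume fin: "(\<Sum>n. V n w) \<noteq> \<infinity>"
    define B where "B = enn2real (\<Sum>n. V n w) + 1"
    have "V n w \<le> ennreal B" for n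
    proof -
      have "V n w = (\<Sum>k\<in>{n}. V k w)" by simp
      also have "\<dots> \<le> (\<Sum>n. V n w)" by (rule sum_le_suminf) auto
      also have "\<dots> = ennreal (enn2real (\<Sum>n. V n w))" using fin by (simp add: less_top)
      also have "\<dots> \<le> ennreal B" by (rule ennreal_leI) (simp add: B_def)
      finally show ?thesis .
    qed
    moreover have "B > 0" unfolding B_def using enn2real_nonneg[of "\<Sum>n. V n w"] by linarith
    ultimately show "\<exists>B>0. \<forall>n. V n w \<le> ennreal B" by blast
  qed
qed

section \<open>Nets and partitions of unity on the sphere\<close>

definition cell :: "nat \<Rightarrow> real^'n \<Rightarrow> 'n \<Rightarrow> int" where
  "cell m x = (\<lambda>i. \<lfloor>real m * x $ i\<rfloor>)"

text \<open>One point of the sphere from every cell of the cubic grid of mesh \<open>1/m\<close> that meets the sphere.\<close>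

definition net :: "nat \<Rightarrow> (real^'n::finite) set" where
  "net m = (\<lambda>c. SOME y. y \<in> sphere 0 1 \<and> cell m y = c) ` (cell m ` sphere 0 1)"

lemma cells_bounded: "cell m ` sphere (0::real^'n) 1 \<subseteq> PiE UNIV (\<lambda>_. {- int m..int m})"
proof (intro image_subsetI PiE_I)
  fix x :: "real^'n" and i assume "x \<in> sphere 0 1"
  then have "\<bar>x $ i\<bar> \<le> 1" using component_le_norm_cart[of x i] by simp
  then have "\<bar>real m * x $ i\<bar> \<le> real m" by (simp add: abs_mult mult_left_le)
  then have "- real m \<le> real m * x $ i" "real m * x $ i \<le> real m" by (simp_all add: abs_le_iff)
  then show "cell m x i \<in> {- int m..int m}"
    unfolding cell_def by (auto simp: le_floor_iff floor_le_iff)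
qed auto

lemma finite_cells: "finite (cell m ` sphere (0::real^'n::finite) 1)"
  by (rule finite_subset[OF cells_bounded]) (simp add: finite_PiE)

lemma finite_net: "finite (net m :: (real^'n::finite) set)"
  unfolding net_def by (rule finite_imageI) (rule finite_cells)

lemma card_net: "card (net m :: (real^'n::finite) set) \<le> (2 * m + 1) ^ CARD('n)"
proof -
  have "card (net m :: (real^'n) set) \<le> card (cell m ` sphere (0::real^'n) 1)"
    unfolding net_def by (rule card_image_le) (rule finite_cells)
  also have "\<dots> \<le> card (PiE (UNIV :: 'n set) (\<lambda>_. {- int m..int m}))"
    by (rule card_mono[OF _ cells_bounded]) (simp add: finite_PiE)
  also have "\<dots> = (2 * m + 1) ^ CARD('n)"
  proof -
    have "card {- int m..int m} = 2 * m + 1" by simp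
    then show ?thesis by (simp only: card_PiE[OF finite] prod_constant)
  qed
  finally show ?thesis .
qed

lemma net_cell:
  assumes "c \<in> cell m ` sphere (0::real^'n) 1"
  shows "(SOME y. y \<in> sphere 0 1 \<and> cell m y = c) \<in> sphere (0::real^'n) 1"
    "cell m (SOME y. y \<in> sphere (0::real^'n) 1 \<and> cell m y = c) = c"
proof -
  have "\<exists>y. y \<in> sphere (0::real^'n) 1 \<and> cell m y = c" using assms by blast
  from someI_ex[OF this] show "(SOME y. y \<in> sphere 0 1 \<and> cell m y = c) \<in> sphere (0::real^'n) 1"
    "cell m (SOME y. y \<in> sphere (0::real^'n) 1 \<and> cell m y = c) = c" by auto
qed

lemma net_subset: "net m \<subseteq> sphere (0::real^'n) 1"
  unfolding net_def by (rule image_subsetI) (rule net_cell(1))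

lemma dist_same_cell:
  fixes x y :: "real^'n"
  assumes m: "0 < m" and eq: "cell m x = cell m y"
  shows "dist x y \<le> real CARD('n) / real m"
proof -
  have "\<bar>x $ i - y $ i\<bar> \<le> 1 / real m" for i
  proof -
    have "\<lfloor>real m * x $ i\<rfloor> = \<lfloor>real m * y $ i\<rfloor>" using eq by (auto simp: cell_def dest: fun_cong[of _ _ i])
    then have "\<bar>real m * x $ i - real m * y $ i\<bar> \<le> 1" by linarith
    then have "real m * \<bar>x $ i - y $ i\<bar> \<le> 1" by (simp add: abs_mult flip: right_diff_distrib)
    then show ?thesis using m by (simp add: field_simps)
  qed
  then have "(\<Sum>i\<in>UNIV. \<bar>(x - y) $ i\<bar>) \<le> (\<Sum>i\<in>(UNIV::'n set). 1 / real m)" by (intro sum_mono) simp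
  then show ?thesis using norm_le_l1_cart[of "x - y"] by (simp add: dist_norm)
qed

lemma net_close:
  fixes x :: "real^'n"
  assumes "0 < m" "x \<in> sphere 0 1"
  shows "\<exists>y\<in>net m. dist x y \<le> real CARD('n) / real m"
proof -
  let ?y = "SOME y. y \<in> sphere (0::real^'n) 1 \<and> cell m y = cell m x"
  have "cell m x \<in> cell m ` sphere 0 1" using assms by blast
  moreover from net_cell(2)[OF this] have "dist x ?y \<le> real CARD('n) / real m"
    by (intro dist_same_cell assms) simp
  ultimately show ?thesis unfolding net_def by blast
qed

text \<open>The radius is twice the distance within which the net meets every point, so some hat is positive at each point of
  the sphere.\<close>

definition hat :: "nat \<Rightarrow> real^'n::finite \<Rightarrow> real^'n \<Rightarrow> real" where
  "hat m y x = max 0 (2 * real CARD('n) / real m - dist x y)"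

definition pou :: "nat \<Rightarrow> real^'n::finite \<Rightarrow> real^'n \<Rightarrow> real" where
  "pou m y x = hat m y x / (\<Sum>z\<in>net m. hat m z x)"

lemma hat_sum_pos:
  fixes x :: "real^'n"
  assumes m: "0 < m" and x: "x \<in> sphere 0 1"
  shows "0 < (\<Sum>z\<in>net m. hat m z x)"
proof -
  obtain y where y: "y \<in> net m" "dist x y \<le> real CARD('n) / real m" using net_close[OF assms] by blast
  have "0 < real CARD('n) / real m" using m by simp
  then have "0 < 2 * real CARD('n) / real m - dist x y" using y(2) by simp
  then have "0 < hat m y x" by (simp add: hat_def)
  also have "\<dots> \<le> (\<Sum>z\<in>net m. hat m z x)"
    by (rule member_le_sum[OF y(1)]) (auto simp: hat_def finite_net)
  finally show ?thesis .
qed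

lemma pou_nonneg: "0 \<le> pou m y x"
  unfolding pou_def by (intro divide_nonneg_nonneg sum_nonneg) (auto simp: hat_def)

lemma pou_sum: "0 < m \<Longrightarrow> x \<in> sphere 0 1 \<Longrightarrow> (\<Sum>y\<in>net m. pou m y (x::real^'n)) = 1"
  using hat_sum_pos[of m x] unfolding pou_def sum_divide_distrib[symmetric] by simp

lemma pou_nz_dist: "pou m y (x::real^'n::finite) \<noteq> 0 \<Longrightarrow> dist x y \<le> 2 * real CARD('n) / real m"
  by (auto simp: pou_def hat_def max_def split: if_splits)

lemma pou_continuous: "0 < m \<Longrightarrow> continuous_on (sphere 0 1) (pou m (y::real^'n::finite))"
proof -
  assume m: "0 < m"
  have "continuous_on (sphere 0 1) (hat m z)" for z :: "real^'n"
    unfolding hat_def[abs_def] by (intro continuous_intros)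
  then show ?thesis
    unfolding pou_def[abs_def]
  proof (intro continuous_on_divide continuous_on_sum ballI)
    fix x :: "real^'n" assume "x \<in> sphere 0 1"
    from hat_sum_pos[OF m this] show "(\<Sum>z\<in>net m. hat m z x) \<noteq> 0" by simp
  qed
qed

section \<open>Construction of a continuous modification\<close>

locale hoelder_field = gaussian_field M "sphere (0::real^'n::finite) 1" Z K
  for M :: "'w measure" and Z :: "real^'n \<Rightarrow> 'w \<Rightarrow> real" and K +
  fixes L \<alpha> :: real
  assumes \<alpha>: "0 < \<alpha>" and L: "0 \<le> L"
    and increment: "x \<in> sphere 0 1 \<Longrightarrow> y \<in> sphere 0 1 \<Longrightarrow> K x x - 2 * K x y + K y y \<le> L * dist x y powr \<alpha>"
begin

text \<open>The interpolation of the process between the points of a net: a continuous function of \<open>x\<close> built from finitely many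
  of the given variables.\<close>

definition approx :: "nat \<Rightarrow> 'w \<Rightarrow> real^'n \<Rightarrow> real" where
  "approx n w x = (\<Sum>y\<in>net (2^n). pou (2^n) y x * Z y w)"

lemma approx_continuous: "continuous_on (sphere 0 1) (approx n w)"
  unfolding approx_def[abs_def]
  by (intro continuous_on_sum continuous_on_mult continuous_on_const pou_continuous) simp

lemma approx_measurable: "(\<lambda>w. approx n w x) \<in> borel_measurable M"
  unfolding approx_def
proof (rule borel_measurable_sum)
  fix y :: "real^'n" assume "y \<in> net (2^n)"
  then have "y \<in> sphere 0 1" using net_subset by blast
  from Z_measurable[OF this] show "(\<lambda>w. pou (2^n) y x * Z y w) \<in> borel_measurable M"
    by (rule borel_measurable_times[OF borel_measurable_const])
qed

lemma increment_moment_le: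
  assumes "x \<in> sphere 0 1" "y \<in> sphere 0 1" "dist x y \<le> r" "0 \<le> r"
  shows "(\<integral>\<^sup>+w. ennreal ((Z x w - Z y w) ^ (2 * p)) \<partial>M) \<le> ennreal (gauss_moment p * (L * r powr \<alpha>) ^ p)"
proof -
  have "0 \<le> K x x - 2 * K x y + K y y"
  proof -
    have eq: "(Z x w - Z y w)^2 = Z x w * Z x w + Z y w * Z y w - 2 * (Z x w * Z y w)" for w
      by (simp add: power2_eq_square algebra_simps)
    have "expectation (\<lambda>w. (Z x w - Z y w)^2) =
        expectation (\<lambda>w. Z x w * Z x w + Z y w * Z y w - 2 * (Z x w * Z y w))" by (simp only: eq)
    also have "\<dots> = K x x + K y y - 2 * K x y"
      using product_integrable[OF assms(1,1)] product_integrable[OF assms(2,2)] product_integrable[OF assms(1,2)]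
      by (simp add: covariance[OF assms(1,1)] covariance[OF assms(2,2)] covariance[OF assms(1,2)])
    finally have "expectation (\<lambda>w. (Z x w - Z y w)^2) = K x x + K y y - 2 * K x y" .
    then show ?thesis using Bochner_Integration.integral_nonneg[of M "\<lambda>w. (Z x w - Z y w)^2"] by simp
  qed
  moreover have "K x x - 2 * K x y + K y y \<le> L * r powr \<alpha>"
  proof -
    have "dist x y powr \<alpha> \<le> r powr \<alpha>" using \<alpha> assms by (intro powr_mono2) auto
    then show ?thesis using increment[OF assms(1,2)] L by (meson mult_left_mono order_trans)
  qed
  ultimately show ?thesis
    unfolding increment_moment[OF assms(1,2)]
    by (intro ennreal_leI mult_left_mono power_mono gauss_moment_nonneg)
qed

text \<open>These are the pairs of points of two consecutive nets that can both have a nonzero weight at a common \<open>x\<close>; the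
  constant is \<open>2 D / 2\<^sup>n + 2 D / 2\<^bsup>n+1\<^esup> = 3 D / 2\<^sup>n\<close>, where \<open>D\<close> is the dimension of the ambient space.\<close>

definition near_pairs :: "nat \<Rightarrow> ((real^'n) \<times> (real^'n)) set" where
  "near_pairs n = {yz \<in> net (2^n) \<times> net (2^Suc n). dist (fst yz) (snd yz) \<le> 3 * real CARD('n) / 2^n}"

lemma near_pairs_sphere:
  assumes "yz \<in> near_pairs n" shows "fst yz \<in> sphere 0 1" "snd yz \<in> sphere 0 1"
proof -
  have "fst yz \<in> net (2^n)" "snd yz \<in> net (2^Suc n)" using assms by (simp_all add: near_pairs_def mem_Times_iff)
  then show "fst yz \<in> sphere 0 1" "snd yz \<in> sphere 0 1" using net_subset by blast+
qed

lemma finite_near_pairs: "finite (near_pairs n)"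
  unfolding near_pairs_def by (rule finite_subset[OF _ finite_cartesian_product[OF finite_net finite_net]]) blast

lemma card_near_pairs: "real (card (near_pairs n)) \<le> (5 * 2^n) ^ (2 * CARD('n))"
proof -
  have "card (near_pairs n) \<le> card (net (2^n) \<times> net (2^Suc n) :: ((real^'n) \<times> (real^'n)) set)"
    unfolding near_pairs_def by (rule card_mono) (auto simp: finite_net)
  also have "\<dots> \<le> (2 * 2^n + 1) ^ CARD('n) * (2 * 2^Suc n + 1) ^ CARD('n)"
    unfolding card_cartesian_product by (intro mult_mono card_net) auto
  also have "\<dots> \<le> (5 * 2^n) ^ CARD('n) * (5 * 2^n) ^ CARD('n)"
    by (intro mult_mono power_mono) (auto simp: Suc_le_eq)
  also have "\<dots> = (5 * 2^n) ^ (2 * CARD('n))" by (simp add: mult_2 power_add)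
  finally have "real (card (near_pairs n)) \<le> real ((5 * 2^n) ^ (2 * CARD('n)))" by (simp only: of_nat_le_iff)
  then show ?thesis by simp
qed

lemma near_pairs_moment:
  "(\<integral>\<^sup>+w. (\<Sum>yz\<in>near_pairs n. ennreal ((Z (fst yz) w - Z (snd yz) w) ^ (2 * p))) \<partial>M) \<le>
    ennreal ((5 * 2^n) ^ (2 * CARD('n)) * (gauss_moment p * (L * (3 * real CARD('n) / 2^n) powr \<alpha>) ^ p))"
proof -
  note S = near_pairs_sphere
  let ?b = "gauss_moment p * (L * (3 * real CARD('n) / 2^n) powr \<alpha>) ^ p"
  have b0: "0 \<le> ?b" using L by (intro mult_nonneg_nonneg gauss_moment_nonneg zero_le_power) auto
  have "(\<integral>\<^sup>+w. (\<Sum>yz\<in>near_pairs n. ennreal ((Z (fst yz) w - Z (snd yz) w) ^ (2 * p))) \<partial>M) =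
     (\<Sum>yz\<in>near_pairs n. \<integral>\<^sup>+w. ennreal ((Z (fst yz) w - Z (snd yz) w) ^ (2 * p)) \<partial>M)"
  proof (rule nn_integral_sum)
    fix yz assume "yz \<in> near_pairs n"
    from S[OF this] have [measurable]: "Z (fst yz) \<in> borel_measurable M" "Z (snd yz) \<in> borel_measurable M"
      by (auto intro: Z_measurable)
    show "(\<lambda>w. ennreal ((Z (fst yz) w - Z (snd yz) w) ^ (2 * p))) \<in> borel_measurable M" by measurable
  qed
  also have "\<dots> \<le> (\<Sum>yz\<in>near_pairs n. ennreal ?b)"
    by (intro sum_mono increment_moment_le S) (auto simp: near_pairs_def)
  also have "\<dots> = ennreal (real (card (near_pairs n)) * ?b)"
    using b0 by (simp add: ennreal_mult' flip: ennreal_of_nat_eq_real_of_nat)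
  also have "\<dots> \<le> ennreal ((5 * 2^n) ^ (2 * CARD('n)) * ?b)"
    by (intro ennreal_leI mult_right_mono card_near_pairs b0)
  finally show ?thesis .
qed

text \<open>Kolmogorov's argument: about \<open>2\<^bsup>2nD\<^esup>\<close> pairs, each with a moment of size \<open>2\<^bsup>-n\<alpha>p\<^esup>\<close>.  For
  \<open>p > 4 D / \<alpha>\<close> the moments win even after multiplication by \<open>2\<^bsup>n\<alpha>p/2\<^esup>\<close>, which gives the rate \<open>2\<^bsup>-n\<alpha>/4\<^esup>\<close>.\<close>

lemma AE_near_pairs_small:
  "AE w in M. \<exists>B. \<forall>n. \<forall>yz\<in>near_pairs n. \<bar>Z (fst yz) w - Z (snd yz) w\<bar> \<le> B * (2 powr (- \<alpha> / 4)) ^ n"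
proof -
  let ?D = "CARD('n)"
  obtain p :: nat where p: "4 * real ?D / \<alpha> < real p" using reals_Archimedean2 by blast
  have p0: "0 < p" using p \<alpha> by (intro Nat.gr0I) (auto simp: divide_less_0_iff)
  have pD: "4 * real ?D < \<alpha> * real p" using p \<alpha> by (simp add: field_simps)
  define s where "s = 2 powr (\<alpha> * real p / 2)"
  define q where "q = 2 powr (2 * real ?D - \<alpha> * real p / 2)"
  define A where "A = 5 ^ (2 * ?D) * (gauss_moment p * (L * (3 * real ?D) powr \<alpha>) ^ p)"
  have A0: "0 \<le> A" unfolding A_def using L by (intro mult_nonneg_nonneg gauss_moment_nonneg zero_le_power) auto
  have q: "0 \<le> q" "q < 1" using pD by (auto simp: q_def powr_less_one)
  have s0: "s > 0" by (simp add: s_def)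
  define V where "V n w = ennreal (s ^ n) * (\<Sum>yz\<in>near_pairs n. ennreal ((Z (fst yz) w - Z (snd yz) w) ^ (2 * p)))" for n w
  note S = near_pairs_sphere
  have meas: "(\<lambda>w. \<Sum>yz\<in>near_pairs n. ennreal ((Z (fst yz) w - Z (snd yz) w) ^ (2 * p))) \<in> borel_measurable M" for n
  proof (rule borel_measurable_sum)
    fix yz assume "yz \<in> near_pairs n"
    from S[OF this] have [measurable]: "Z (fst yz) \<in> borel_measurable M" "Z (snd yz) \<in> borel_measurable M"
      by (auto intro: Z_measurable)
    show "(\<lambda>w. ennreal ((Z (fst yz) w - Z (snd yz) w) ^ (2 * p))) \<in> borel_measurable M" by measurable
  qed
  have "AE w in M. \<exists>B>0. \<forall>n. V n w \<le> ennreal B"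
  proof (rule AE_bounded_of_geometric_moments[OF _ _ q A0])
    show "V n \<in> borel_measurable M" for n unfolding V_def[abs_def] using meas by measurable
    fix n
    have pw: "(2::real) ^ n = 2 powr real n" by (simp add: powr_realpow)
    have "(\<integral>\<^sup>+w. V n w \<partial>M) = ennreal (s ^ n) * (\<integral>\<^sup>+w. (\<Sum>yz\<in>near_pairs n. ennreal ((Z (fst yz) w - Z (snd yz) w) ^ (2 * p))) \<partial>M)"
      unfolding V_def by (rule nn_integral_cmult[OF meas])
    also have "\<dots> \<le> ennreal (s ^ n) * ennreal ((5 * 2^n) ^ (2 * ?D) * (gauss_moment p * (L * (3 * real ?D / 2^n) powr \<alpha>) ^ p))"
      by (intro mult_left_mono near_pairs_moment) simp
    also have "\<dots> = ennreal (s ^ n * ((5 * 2^n) ^ (2 * ?D) * (gauss_moment p * (L * (3 * real ?D / 2^n) powr \<alpha>) ^ p)))"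
      using s0 by (simp add: ennreal_mult')
    also have "s ^ n * ((5 * 2^n) ^ (2 * ?D) * (gauss_moment p * (L * (3 * real ?D / 2^n) powr \<alpha>) ^ p)) = A * q ^ n"
    proof -
      have e1: "(L * (3 * real ?D / 2^n) powr \<alpha>) ^ p = (L * (3 * real ?D) powr \<alpha>) ^ p * 2 powr (- (real n * \<alpha> * real p))"
      proof -
        have "(3 * real ?D / 2^n) powr \<alpha> = (3 * real ?D) powr \<alpha> * 2 powr (- (real n * \<alpha>))"
          by (simp add: powr_divide pw powr_powr powr_minus_divide)
        moreover have "(2 powr (- (real n * \<alpha>))) ^ p = 2 powr (- (real n * \<alpha> * real p))"
          by (simp add: powr_power mult_ac)
        ultimately show ?thesis by (simp only: power_mult_distrib mult.assoc)
      qed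
      have e2: "((5::real) * 2^n) ^ (2 * ?D) = 5 ^ (2 * ?D) * 2 powr (real n * (2 * real ?D))"
        by (simp add: power_mult_distrib pw powr_power mult_ac)
      have e3: "s ^ n = 2 powr (real n * (\<alpha> * real p / 2))" "q ^ n = 2 powr (real n * (2 * real ?D - \<alpha> * real p / 2))"
        by (simp_all add: s_def q_def powr_power mult_ac)
      have e4: "2 powr (real n * (\<alpha> * real p / 2)) * 2 powr (real n * (2 * real ?D)) * 2 powr (- (real n * \<alpha> * real p))
        = 2 powr (real n * (2 * real ?D - \<alpha> * real p / 2))"
        by (simp add: powr_add[symmetric] algebra_simps)
      show ?thesis unfolding A_def e1 e2 e3 e4[symmetric] by (simp add: mult_ac)
    qed
    finally show "(\<integral>\<^sup>+w. V n w \<partial>M) \<le> ennreal (A * q ^ n)" .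
  qed
  then show ?thesis
  proof (rule AE_mp, intro AE_I2 impI)
    fix w assume "\<exists>B>0. \<forall>n. V n w \<le> ennreal B"
    then obtain B where B: "B > 0" "\<And>n. V n w \<le> ennreal B" by blast
    let ?k = "2 powr (- \<alpha> / 4)"
    have "\<bar>Z (fst yz) w - Z (snd yz) w\<bar> \<le> max 1 B * ?k ^ n" if yz: "yz \<in> near_pairs n" for n yz
    proof -
      let ?z = "(Z (fst yz) w - Z (snd yz) w) ^ (2 * p)"
      note fin = finite_near_pairs
      have z0: "0 \<le> ?z" by (simp add: power_mult)
      have "ennreal (s ^ n * ?z) = ennreal (s ^ n) * ennreal ?z" using s0 z0 by (simp add: ennreal_mult)
      also have "\<dots> \<le> V n w"
        unfolding V_def by (intro mult_left_mono member_le_sum yz fin) auto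
      also have "\<dots> \<le> ennreal B" by (rule B)
      finally have "s ^ n * ?z \<le> B" using B(1) by (simp add: ennreal_le_iff)
      then have "?z \<le> B / s ^ n" using s0 by (simp add: field_simps)
      also have "\<dots> \<le> (max 1 B) ^ (2 * p) * (?k ^ n) ^ (2 * p)"
      proof -
        have "(?k ^ n) ^ (2 * p) = inverse (s ^ n)"
          by (simp add: s_def powr_power powr_minus[symmetric] algebra_simps)
        moreover have "max 1 B ^ 1 \<le> max 1 B ^ (2 * p)" using p0 by (intro power_increasing) auto
        moreover have "B \<le> max 1 B ^ 1" by simp
        ultimately have "B \<le> max 1 B ^ (2 * p)" "(?k ^ n) ^ (2 * p) = inverse (s ^ n)" by linarith+
        moreover have "0 \<le> inverse (s ^ n)" using s0 by simp
        ultimately show ?thesis unfolding divide_inverse by (simp only: mult_right_mono)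
      qed
      also have "\<dots> = (max 1 B * ?k ^ n) ^ (2 * p)" by (simp add: power_mult_distrib)
      finally have "\<bar>Z (fst yz) w - Z (snd yz) w\<bar> ^ (2 * p) \<le> (max 1 B * ?k ^ n) ^ (2 * p)"
        by (simp add: power_mult)
      then show ?thesis using p0 by (subst (asm) power_mono_iff) auto
    qed
    then show "\<exists>B. \<forall>n. \<forall>yz\<in>near_pairs n. \<bar>Z (fst yz) w - Z (snd yz) w\<bar> \<le> B * ?k ^ n" by blast
  qed
qed

text \<open>The weights of either net sum up to \<open>1\<close>, so both interpolations are averages over pairs of net points with the same
  product weights, and only near pairs contribute.\<close>

lemma approx_step:
  assumes B: "\<And>yz. yz \<in> near_pairs n \<Longrightarrow> \<bar>Z (fst yz) w - Z (snd yz) w\<bar> \<le> b" and b: "0 \<le> b"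
    and x: "x \<in> sphere 0 1"
  shows "\<bar>approx n w x - approx (Suc n) w x\<bar> \<le> b"
proof -
  let ?f = "\<lambda>y. pou (2^n) y x" and ?g = "\<lambda>z. pou (2^Suc n) z x"
  let ?N = "net (2^n) :: (real^'n) set" and ?N' = "net (2^Suc n) :: (real^'n) set"
  have f1: "(\<Sum>y\<in>?N. ?f y) = 1" and g1: "(\<Sum>z\<in>?N'. ?g z) = 1" using x by (intro pou_sum; simp)+
  have "approx n w x = (\<Sum>y\<in>?N. ?f y * Z y w) * (\<Sum>z\<in>?N'. ?g z)"
    by (simp add: approx_def g1[simplified])
  also have "\<dots> = (\<Sum>y\<in>?N. \<Sum>z\<in>?N'. ?f y * ?g z * Z y w)"
    unfolding sum_product by (intro sum.cong refl) (simp add: mult_ac)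
  finally have 1: "approx n w x = (\<Sum>y\<in>?N. \<Sum>z\<in>?N'. ?f y * ?g z * Z y w)" .
  have "approx (Suc n) w x = (\<Sum>y\<in>?N. ?f y) * (\<Sum>z\<in>?N'. ?g z * Z z w)"
    by (simp add: approx_def f1)
  also have "\<dots> = (\<Sum>y\<in>?N. \<Sum>z\<in>?N'. ?f y * ?g z * Z z w)"
    unfolding sum_product by (intro sum.cong refl) (simp add: mult_ac)
  finally have 2: "approx (Suc n) w x = (\<Sum>y\<in>?N. \<Sum>z\<in>?N'. ?f y * ?g z * Z z w)" .
  have "\<bar>approx n w x - approx (Suc n) w x\<bar> = \<bar>\<Sum>y\<in>?N. \<Sum>z\<in>?N'. ?f y * ?g z * (Z y w - Z z w)\<bar>"
    unfolding 1 2 by (simp add: sum_subtractf right_diff_distrib)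
  also have "\<dots> \<le> (\<Sum>y\<in>?N. \<Sum>z\<in>?N'. \<bar>?f y * ?g z * (Z y w - Z z w)\<bar>)"
    by (rule order_trans[OF sum_abs]) (intro sum_mono sum_abs)
  also have "\<dots> \<le> (\<Sum>y\<in>?N. \<Sum>z\<in>?N'. ?f y * ?g z * b)"
  proof (intro sum_mono)
    fix y z assume y: "y \<in> ?N" and z: "z \<in> ?N'"
    show "\<bar>?f y * ?g z * (Z y w - Z z w)\<bar> \<le> ?f y * ?g z * b"
    proof (cases "?f y = 0 \<or> ?g z = 0")
      case False
      then have "dist x y \<le> 2 * real CARD('n) / 2^n" "dist x z \<le> 2 * real CARD('n) / 2^Suc n"
        using pou_nz_dist[of "2^n" y x] pou_nz_dist[of "2^Suc n" z x] by auto
      then have "dist y z \<le> 2 * real CARD('n) / 2^n + 2 * real CARD('n) / 2^Suc n"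
        using dist_triangle2[of y z x] by (simp add: dist_commute)
      also have "\<dots> = 3 * real CARD('n) / 2^n" by (simp add: field_simps)
      finally have "(y, z) \<in> near_pairs n" using y z by (simp add: near_pairs_def)
      from B[OF this] show ?thesis
        using pou_nonneg[of "2^n" y x] pou_nonneg[of "2^Suc n" z x] by (simp add: abs_mult mult_left_mono)
    qed auto
  qed
  also have "\<dots> = (\<Sum>y\<in>?N. ?f y) * (\<Sum>z\<in>?N'. ?g z) * b"
    by (simp only: sum_distrib_right[symmetric] sum_distrib_left[symmetric])
  finally show ?thesis by (simp only: f1 g1 mult_1)
qed

lemma AE_approx_uniform:
  "AE w in M. uniform_limit (sphere 0 1) (\<lambda>n. approx n w) (\<lambda>x. lim (\<lambda>n. approx n w x)) sequentially"
  using AE_near_pairs_small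
proof (rule AE_mp, intro AE_I2 impI)
  let ?k = "2 powr (- \<alpha> / 4)"
  fix w assume "\<exists>B. \<forall>n. \<forall>yz\<in>near_pairs n. \<bar>Z (fst yz) w - Z (snd yz) w\<bar> \<le> B * ?k ^ n"
  then obtain B where B: "\<And>n yz. yz \<in> near_pairs n \<Longrightarrow> \<bar>Z (fst yz) w - Z (snd yz) w\<bar> \<le> B * ?k ^ n" by blast
  have k: "0 < ?k" "?k < 1" using \<alpha> by (auto simp: powr_less_one)
  have step: "\<bar>approx n w x - approx (Suc n) w x\<bar> \<le> \<bar>B\<bar> * ?k ^ n" if "x \<in> sphere 0 1" for n x
  proof (rule approx_step[OF _ _ that])
    show "\<bar>Z (fst yz) w - Z (snd yz) w\<bar> \<le> \<bar>B\<bar> * ?k ^ n" if "yz \<in> near_pairs n" for yz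
      using B[OF that] k by (meson abs_ge_self mult_right_mono order_trans zero_le_power less_imp_le)
  qed (use k in auto)
  have "uniform_limit (sphere 0 1) (\<lambda>n x. \<Sum>i<n. approx (Suc i) w x - approx i w x)
      (\<lambda>x. \<Sum>i. approx (Suc i) w x - approx i w x) sequentially"
  proof (rule Weierstrass_m_test)
    show "norm (approx (Suc n) w x - approx n w x) \<le> \<bar>B\<bar> * ?k ^ n" if "x \<in> sphere 0 1" for n x
      using step[OF that, of n] by (simp add: abs_minus_commute)
    show "summable (\<lambda>n. \<bar>B\<bar> * ?k ^ n)" using k by (intro summable_mult summable_geometric) auto
  qed
  then have "uniform_limit (sphere 0 1) (\<lambda>n x. approx 0 w x + (\<Sum>i<n. approx (Suc i) w x - approx i w x))
      (\<lambda>x. approx 0 w x + (\<Sum>i. approx (Suc i) w x - approx i w x)) sequentially"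
    by (intro uniform_limit_add uniform_limit_const)
  moreover have "approx 0 w x + (\<Sum>i<n. approx (Suc i) w x - approx i w x) = approx n w x" for n x
    by (induction n) auto
  ultimately have u: "uniform_limit (sphere 0 1) (\<lambda>n. approx n w)
      (\<lambda>x. approx 0 w x + (\<Sum>i. approx (Suc i) w x - approx i w x)) sequentially" by simp
  have "lim (\<lambda>n. approx n w x) = approx 0 w x + (\<Sum>i. approx (Suc i) w x - approx i w x)" if "x \<in> sphere 0 1" for x
    using tendsto_uniform_limitI[OF u that] by (rule limI)
  then show "uniform_limit (sphere 0 1) (\<lambda>n. approx n w) (\<lambda>x. lim (\<lambda>n. approx n w x)) sequentially"
    using u by (subst uniform_limit_cong'[where g="\<lambda>n. approx n w" and i="\<lambda>x. approx 0 w x + (\<Sum>i. approx (Suc i) w x - approx i w x)"]) auto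
qed

text \<open>The interpolation is a weighted mean of values at points near \<open>x\<close>, and the square of a mean is at most the mean
  of the squares.\<close>

lemma approx_second_moment:
  assumes x: "x \<in> sphere 0 1"
  shows "(\<integral>\<^sup>+w. ennreal ((approx n w x - Z x w)^2) \<partial>M) \<le> ennreal (L * (2 * real CARD('n) / 2^n) powr \<alpha>)"
proof -
  let ?f = "\<lambda>y. pou (2^n) y x" and ?N = "net (2^n) :: (real^'n) set"
  have f1: "(\<Sum>y\<in>?N. ?f y) = 1" using x by (intro pou_sum) auto
  have NS: "y \<in> sphere 0 1" if "y \<in> ?N" for y using that net_subset by blast
  let ?r = "L * (2 * real CARD('n) / 2^n) powr \<alpha>"
  have le: "(approx n w x - Z x w)^2 \<le> (\<Sum>y\<in>?N. ?f y * (Z y w - Z x w)^2)" for w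
  proof -
    have "approx n w x - Z x w = (\<Sum>y\<in>?N. ?f y * Z y w) - (\<Sum>y\<in>?N. ?f y) * Z x w" by (simp add: approx_def f1)
    also have "\<dots> = (\<Sum>y\<in>?N. sqrt (?f y) * (sqrt (?f y) * (Z y w - Z x w)))"
      by (simp add: sum_distrib_right sum_subtractf right_diff_distrib pou_nonneg flip: mult.assoc)
    finally have "(approx n w x - Z x w)^2 = (\<Sum>y\<in>?N. sqrt (?f y) * (sqrt (?f y) * (Z y w - Z x w)))^2" by simp
    also have "\<dots> \<le> (\<Sum>y\<in>?N. (sqrt (?f y))^2) * (\<Sum>y\<in>?N. (sqrt (?f y) * (Z y w - Z x w))^2)"
      by (rule Cauchy_Schwarz_ineq_sum)
    also have "\<dots> = (\<Sum>y\<in>?N. ?f y * (Z y w - Z x w)^2)"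
      by (simp add: pou_nonneg f1 power_mult_distrib)
    finally show ?thesis .
  qed
  have m[measurable]: "Z x \<in> borel_measurable M" using x by (rule Z_measurable)
  have "(\<integral>\<^sup>+w. ennreal ((approx n w x - Z x w)^2) \<partial>M) \<le> (\<integral>\<^sup>+w. (\<Sum>y\<in>?N. ennreal (?f y) * ennreal ((Z y w - Z x w)^2)) \<partial>M)"
    using le by (intro nn_integral_mono) (simp add: sum_ennreal pou_nonneg ennreal_leI flip: ennreal_mult)
  also have "\<dots> = (\<Sum>y\<in>?N. \<integral>\<^sup>+w. ennreal (?f y) * ennreal ((Z y w - Z x w)^2) \<partial>M)"
    by (rule nn_integral_sum) (use NS Z_measurable in measurable)
  also have "\<dots> = (\<Sum>y\<in>?N. ennreal (?f y) * (\<integral>\<^sup>+w. ennreal ((Z y w - Z x w)^2) \<partial>M))"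
    by (intro sum.cong refl nn_integral_cmult) (use NS Z_measurable in measurable)
  also have "\<dots> \<le> (\<Sum>y\<in>?N. ennreal (?f y) * ennreal ?r)"
  proof (rule sum_mono)
    fix y assume y: "y \<in> ?N"
    show "ennreal (?f y) * (\<integral>\<^sup>+w. ennreal ((Z y w - Z x w)^2) \<partial>M) \<le> ennreal (?f y) * ennreal ?r"
    proof (cases "?f y = 0")
      case False
      then have "dist y x \<le> 2 * real CARD('n) / 2^n" using pou_nz_dist[of "2^n" y x] by (simp add: dist_commute)
      from increment_moment_le[OF NS[OF y] x this, of 1] show ?thesis
        by (intro mult_left_mono) (auto simp: gauss_moment_def fact_2)
    qed simp
  qed
  also have "\<dots> = ennreal ((\<Sum>y\<in>?N. ?f y) * ?r)"
    using L by (simp add: sum_distrib_right pou_nonneg flip: ennreal_mult)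
  finally show ?thesis by (simp add: f1)
qed

lemma AE_approx_tendsto:
  assumes x: "x \<in> sphere 0 1"
  shows "AE w in M. (\<lambda>n. approx n w x) \<longlonglongrightarrow> Z x w"
proof -
  define s where "s = 2 powr (\<alpha> / 2)"
  define V where "V n w = ennreal (s ^ n * (approx n w x - Z x w)^2)" for n w
  have s: "s > 1" using \<alpha> by (simp add: s_def)
  have [measurable]: "Z x \<in> borel_measurable M" "(\<lambda>w. approx n w x) \<in> borel_measurable M" for n
    using x by (auto intro: Z_measurable approx_measurable)
  have "AE w in M. \<exists>B>0. \<forall>n. V n w \<le> ennreal B"
  proof (rule AE_bounded_of_geometric_moments[where A="L * (2 * real CARD('n)) powr \<alpha>" and q="2 powr (- \<alpha> / 2)"])
    show "V n \<in> borel_measurable M" for n unfolding V_def[abs_def] by measurable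
    fix n
    have "(\<integral>\<^sup>+w. V n w \<partial>M) = (\<integral>\<^sup>+w. ennreal (s ^ n) * ennreal ((approx n w x - Z x w)^2) \<partial>M)"
      unfolding V_def using s by (simp add: ennreal_mult)
    also have "\<dots> = ennreal (s ^ n) * (\<integral>\<^sup>+w. ennreal ((approx n w x - Z x w)^2) \<partial>M)"
      by (rule nn_integral_cmult) measurable
    also have "\<dots> \<le> ennreal (s ^ n) * ennreal (L * (2 * real CARD('n) / 2^n) powr \<alpha>)"
      by (intro mult_left_mono approx_second_moment x) simp
    also have "\<dots> = ennreal (s ^ n * (L * (2 * real CARD('n) / 2^n) powr \<alpha>))"
      using s by (simp add: ennreal_mult')
    also have "s ^ n * (L * (2 * real CARD('n) / 2^n) powr \<alpha>) = L * (2 * real CARD('n)) powr \<alpha> * (2 powr (- \<alpha> / 2)) ^ n"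
    proof -
      have "(2 * real CARD('n) / 2^n) powr \<alpha> = (2 * real CARD('n)) powr \<alpha> * 2 powr (- (real n * \<alpha>))"
        by (simp add: powr_divide powr_powr powr_minus_divide flip: powr_realpow)
      moreover have "s ^ n = 2 powr (real n * (\<alpha> / 2))" "(2 powr (- \<alpha> / 2)) ^ n = 2 powr (real n * (- \<alpha> / 2))"
        by (simp_all only: s_def powr_power zero_neq_numeral simp_thms)
      moreover have "2 powr (real n * (\<alpha> / 2)) * 2 powr (- (real n * \<alpha>)) = 2 powr (real n * (- \<alpha> / 2))"
        by (simp add: powr_add[symmetric] algebra_simps)
      ultimately show ?thesis by (simp add: mult_ac)
    qed
    finally show "(\<integral>\<^sup>+w. V n w \<partial>M) \<le> ennreal (L * (2 * real CARD('n)) powr \<alpha> * (2 powr (- \<alpha> / 2)) ^ n)" .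
  qed (use \<alpha> L in \<open>auto simp: powr_less_one\<close>)
  then show ?thesis
  proof (rule AE_mp, intro AE_I2 impI)
    fix w assume "\<exists>B>0. \<forall>n. V n w \<le> ennreal B"
    then obtain B where B: "B > 0" "\<And>n. V n w \<le> ennreal B" by blast
    have le: "(approx n w x - Z x w)^2 \<le> B * (inverse s) ^ n" for n
    proof -
      have "s ^ n * (approx n w x - Z x w)^2 \<le> B" using B by (simp add: V_def ennreal_le_iff)
      then show ?thesis using s by (simp add: field_simps power_inverse)
    qed
    have "(\<lambda>n. B * (inverse s) ^ n) \<longlonglongrightarrow> B * 0"
      by (intro tendsto_mult tendsto_const LIMSEQ_power_zero) (use s in \<open>simp add: inverse_less_1_iff\<close>)
    then have lim: "(\<lambda>n. B * (inverse s) ^ n) \<longlonglongrightarrow> 0" by simp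
    have "(\<lambda>n. (approx n w x - Z x w)^2) \<longlonglongrightarrow> 0"
      by (rule tendsto_sandwich[OF _ _ tendsto_const lim])
        (use le in \<open>simp_all add: always_eventually\<close>)
    then have "(\<lambda>n. sqrt ((approx n w x - Z x w)^2)) \<longlonglongrightarrow> sqrt 0" by (rule tendsto_real_sqrt)
    then have "(\<lambda>n. approx n w x - Z x w) \<longlonglongrightarrow> 0" by (simp add: tendsto_rabs_zero_iff)
    then show "(\<lambda>n. approx n w x) \<longlonglongrightarrow> Z x w" by (rule LIM_zero_cancel)
  qed
qed

lemma continuous_modification:
  "modification_on M (sphere 0 1) Z (\<lambda>x w. lim (\<lambda>n. approx n w x))"
  unfolding modification_on_def
proof (intro ballI conjI)
  fix x :: "real^'n" assume x: "x \<in> sphere 0 1"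
  have [measurable]: "(\<lambda>w. approx n w x) \<in> borel_measurable M" for n by (auto intro: approx_measurable)
  show "(\<lambda>w. lim (\<lambda>n. approx n w x)) \<in> borel_measurable M" by measurable
  show "AE w in M. lim (\<lambda>n. approx n w x) = Z x w"
    using AE_approx_tendsto[OF x] by (rule AE_mp) (auto intro: limI)
qed

end


section \<open>Random fields with covariance \<open>C - \<rho>\<^sup>\<alpha> / 2\<close>\<close>

text \<open>A lower bound for \<open>sin\<close> that compares arcs with chords.\<close>

lemma third_le_sin:
  assumes "0 \<le> u" "u \<le> pi / 2" shows "u / 3 \<le> sin u"
proof (cases "u \<le> pi / 3")
  case True
  have "(\<lambda>t. sin t - t / 3) 0 \<le> (\<lambda>t. sin t - t / 3) u"
  proof (rule DERIV_nonneg_imp_nondecreasing[OF assms(1)])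
    fix t assume t: "0 \<le> t" "t \<le> u"
    have "cos (pi / 3) \<le> cos t" using t True by (intro cos_monotone_0_pi_le) auto
    then have "0 \<le> cos t - 1/3" by (simp add: cos_60)
    moreover have "((\<lambda>t. sin t - t / 3) has_real_derivative cos t - 1/3) (at t)"
      by (auto intro!: derivative_eq_intros)
    ultimately show "\<exists>y. ((\<lambda>t. sin t - t / 3) has_real_derivative y) (at t) \<and> 0 \<le> y" by blast
  qed
  then show ?thesis by simp
next
  case False
  have "sin (pi / 3) \<le> sin u" using False assms by (intro sin_monotone_2pi_le) auto
  moreover have "2 / 3 \<le> sin (pi / 3)"
  proof -
    have "4 / 3 \<le> sqrt 3" by (rule real_le_rsqrt) (simp add: power2_eq_square)
    then show ?thesis by (simp add: sin_60)
  qed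
  moreover have "u / 3 \<le> 2 / 3" using assms pi_less_4 by simp
  ultimately show ?thesis by linarith
qed

lemma
  assumes x: "x \<in> sphere 0 1" and y: "y \<in> sphere (0::'a::euclidean_space) 1"
  shows geodist_nonneg: "0 \<le> geodist x y" and geodist_le_dist: "geodist x y \<le> 3 * dist x y"
proof -
  have ip: "\<bar>x \<bullet> y\<bar> \<le> 1" using Cauchy_Schwarz_ineq2[of x y] x y by simp
  then have b: "0 \<le> geodist x y" "geodist x y \<le> pi" "cos (geodist x y) = x \<bullet> y"
    by (auto simp: geodist_def abs_le_iff intro: arccos_lbound arccos_ubound)
  then show "0 \<le> geodist x y" by simp
  let ?u = "geodist x y / 2"
  have "(dist x y)^2 = x \<bullet> x + y \<bullet> y - 2 * (x \<bullet> y)"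
    by (simp add: dist_norm power2_norm_eq_inner inner_diff_left inner_diff_right inner_commute)
  also have "\<dots> = 2 - 2 * cos (2 * ?u)"
    using x y by (simp add: b(3) flip: power2_norm_eq_inner)
  also have "\<dots> = (2 * sin ?u)^2" by (simp only: cos_double_sin) (simp add: power2_eq_square)
  finally have sq: "(dist x y)^2 = (2 * sin ?u)^2" .
  have "0 \<le> ?u" "?u \<le> pi / 2" using b(1,2) by simp_all
  moreover from this have "0 \<le> 2 * sin ?u" using pi_gt_zero by (simp add: sin_ge_zero)
  ultimately have "dist x y = 2 * sin ?u" using sq by (simp only: power2_eq_imp_eq zero_le_dist)
  moreover have "?u / 3 \<le> sin ?u" by (rule third_le_sin) fact+
  ultimately show "geodist x y \<le> 3 * dist x y" by simp
qed

locale geodesic_field = gaussian_field M "sphere (0::real^'n::finite) 1" Z "\<lambda>x y. C - 1 / 2 * geodist x y powr \<alpha>"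
  for M :: "'w measure" and Z :: "real^'n \<Rightarrow> 'w \<Rightarrow> real" and C \<alpha> :: real +
  assumes \<alpha>: "0 < \<alpha>" and dim: "2 \<le> CARD('n)"
begin

abbreviation K :: "real^'n \<Rightarrow> real^'n \<Rightarrow> real" where
  "K x y \<equiv> C - 1 / 2 * geodist x y powr \<alpha>"

lemma increment_eq: "x \<in> sphere 0 1 \<Longrightarrow> y \<in> sphere 0 1 \<Longrightarrow> K x x - 2 * K x y + K y y = geodist x y powr \<alpha>"
  using \<alpha> by (simp add: geodist_self)

lemma increment_bound:
  assumes "x \<in> sphere 0 1" "y \<in> sphere 0 1"
  shows "K x x - 2 * K x y + K y y \<le> 3 powr \<alpha> * dist x y powr \<alpha>"
proof -
  have "geodist x y powr \<alpha> \<le> (3 * dist x y) powr \<alpha>"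
    using \<alpha> by (intro powr_mono2 geodist_nonneg geodist_le_dist assms) auto
  then show ?thesis unfolding increment_eq[OF assms] by (simp add: powr_mult)
qed

sublocale hoelder_field M Z K "3 powr \<alpha>" \<alpha>
  by unfold_locales (use \<alpha> increment_bound in auto)

abbreviation S :: "(real^'n) set" where "S \<equiv> sphere 0 1"
abbreviation N :: "nat \<Rightarrow> (real^'n) set" where "N n \<equiv> net (2 ^ n)"
abbreviation \<phi> :: "nat \<Rightarrow> real^'n \<Rightarrow> real^'n \<Rightarrow> real" where "\<phi> n \<equiv> pou (2 ^ n)"

lemma N_subset: "y \<in> N n \<Longrightarrow> y \<in> S"
  using net_subset by blast

lemma \<phi>_continuous: "sphere_continuous (\<phi> n y)"
  by (rule pou_continuous) simp

lemma K_uniformly_continuous: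
  assumes "\<epsilon> > 0"
  shows "\<exists>\<delta>>0. \<forall>x\<in>S. \<forall>x'\<in>S. \<forall>y\<in>S. \<forall>y'\<in>S. dist x x' < \<delta> \<longrightarrow> dist y y' < \<delta> \<longrightarrow> \<bar>K x y - K x' y'\<bar> < \<epsilon>"
proof -
  have "continuous_on (S \<times> S) (\<lambda>p. C - 1 / 2 * geodist (fst p) (snd p) powr \<alpha>)"
  proof (intro continuous_on_diff continuous_on_mult continuous_on_const continuous_on_powr' ballI conjI impI)
    show "continuous_on (S \<times> S) (\<lambda>p. geodist (fst p) (snd p))"
      unfolding geodist_def
    proof (rule continuous_on_compose2[OF continuous_on_arccos'])
      show "continuous_on (S \<times> S) (\<lambda>p. fst p \<bullet> snd p)" by (intro continuous_intros)
      show "(\<lambda>p. fst p \<bullet> snd p) ` (S \<times> S) \<subseteq> {-1..1}"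
      proof (rule image_subsetI)
        fix p :: "(real^'n) \<times> (real^'n)" assume "p \<in> S \<times> S"
        then show "fst p \<bullet> snd p \<in> {-1..1}"
          using Cauchy_Schwarz_ineq2[of "fst p" "snd p"] by (auto simp: abs_le_iff)
      qed
    qed
  qed (use \<alpha> geodist_nonneg in auto)
  then have "uniformly_continuous_on (S \<times> S) (\<lambda>p. C - 1 / 2 * geodist (fst p) (snd p) powr \<alpha>)"
    by (rule compact_uniformly_continuous) (intro compact_Times compact_sphere)
  from this[unfolded uniformly_continuous_on_def, rule_format, OF assms]
  obtain d where d: "d > 0" "\<And>p q. p \<in> S \<times> S \<Longrightarrow> q \<in> S \<times> S \<Longrightarrow> dist q p < d \<Longrightarrow>
      dist (K (fst q) (snd q)) (K (fst p) (snd p)) < \<epsilon>"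
    by blast
  have "\<bar>K x y - K x' y'\<bar> < \<epsilon>"
    if "x \<in> S" "x' \<in> S" "y \<in> S" "y' \<in> S" "dist x x' < d / 2" "dist y y' < d / 2" for x x' y y'
  proof -
    have "dist (x, y) (x', y') \<le> dist x x' + dist y y'" by (simp add: dist_Pair_Pair sqrt_sum_squares_le_sum)
    also have "\<dots> < d" using that by simp
    finally show ?thesis using d(2)[of "(x', y')" "(x, y)"] that by (simp add: dist_real_def)
  qed
  then show ?thesis using d(1) by (intro exI[of _ "d / 2"]) auto
qed

text \<open>The covariance of the interpolations at \<open>x\<close> and \<open>x'\<close>.\<close>

definition cov :: "nat \<Rightarrow> real^'n \<Rightarrow> real^'n \<Rightarrow> real" where
  "cov n x x' = (\<Sum>y\<in>N n. \<Sum>z\<in>N n. \<phi> n y x * \<phi> n z x' * K y z)"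

text \<open>\<open>cov n x x'\<close> is an average of values of \<open>K\<close> at points near \<open>x\<close> and \<open>x'\<close>.\<close>

lemma cov_close:
  assumes "\<epsilon> > 0"
  shows "\<exists>n0. \<forall>n\<ge>n0. \<forall>x\<in>S. \<forall>x'\<in>S. \<bar>cov n x x' - K x x'\<bar> \<le> \<epsilon>"
proof -
  obtain d where d: "d > 0" "\<And>x x' y y'. x \<in> S \<Longrightarrow> x' \<in> S \<Longrightarrow> y \<in> S \<Longrightarrow> y' \<in> S \<Longrightarrow>
      dist x x' < d \<Longrightarrow> dist y y' < d \<Longrightarrow> \<bar>K x y - K x' y'\<bar> < \<epsilon>"
    using K_uniformly_continuous[OF assms] by blast
  have "(\<lambda>n. 2 * real CARD('n) * inverse (2 ^ n)) \<longlonglongrightarrow> 2 * real CARD('n) * 0"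
    by (intro tendsto_mult tendsto_const LIMSEQ_inverse_realpow_zero) auto
  then have "\<forall>\<^sub>F n in sequentially. 2 * real CARD('n) * inverse (2 ^ n) < d"
    using d(1) by (intro order_tendstoD(2)[where a=d]) auto
  then obtain n0 where n0: "\<And>n. n \<ge> n0 \<Longrightarrow> 2 * real CARD('n) / 2 ^ n < d"
    by (auto simp: eventually_sequentially divide_inverse)
  have "\<bar>cov n x x' - K x x'\<bar> \<le> \<epsilon>" if n: "n \<ge> n0" and x: "x \<in> S" "x' \<in> S" for n x x'
  proof -
    have s1: "(\<Sum>y\<in>N n. \<phi> n y u) = 1" if "u \<in> S" for u using that by (intro pou_sum) auto
    have "K x x' = (\<Sum>y\<in>N n. \<phi> n y x) * (\<Sum>z\<in>N n. \<phi> n z x') * K x x'" by (simp only: s1 x mult_1)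
    also have "\<dots> = (\<Sum>y\<in>N n. \<Sum>z\<in>N n. \<phi> n y x * \<phi> n z x' * K x x')"
      by (simp only: sum_distrib_right[symmetric] sum_distrib_left[symmetric])
    finally have KK: "K x x' = (\<Sum>y\<in>N n. \<Sum>z\<in>N n. \<phi> n y x * \<phi> n z x' * K x x')" .
    have "cov n x x' - (\<Sum>y\<in>N n. \<Sum>z\<in>N n. \<phi> n y x * \<phi> n z x' * K x x') =
        (\<Sum>y\<in>N n. \<Sum>z\<in>N n. \<phi> n y x * \<phi> n z x' * (K y z - K x x'))"
      unfolding cov_def sum_subtractf[symmetric] by (simp only: right_diff_distrib)
    then have "cov n x x' - K x x' = (\<Sum>y\<in>N n. \<Sum>z\<in>N n. \<phi> n y x * \<phi> n z x' * (K y z - K x x'))"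
      using KK by argo
    then have "\<bar>cov n x x' - K x x'\<bar> \<le> (\<Sum>y\<in>N n. \<Sum>z\<in>N n. \<bar>\<phi> n y x * \<phi> n z x' * (K y z - K x x')\<bar>)"
      by (simp only:) (rule order_trans[OF sum_abs], intro sum_mono sum_abs)
    also have "\<dots> \<le> (\<Sum>y\<in>N n. \<Sum>z\<in>N n. \<phi> n y x * \<phi> n z x' * \<epsilon>)"
    proof (intro sum_mono)
      fix y z assume yz: "y \<in> N n" "z \<in> N n"
      show "\<bar>\<phi> n y x * \<phi> n z x' * (K y z - K x x')\<bar> \<le> \<phi> n y x * \<phi> n z x' * \<epsilon>"
      proof (cases "\<phi> n y x = 0 \<or> \<phi> n z x' = 0")
        case False
        then have "dist x y < d" "dist x' z < d"
          using pou_nz_dist[of "2 ^ n" y x] pou_nz_dist[of "2 ^ n" z x'] n0[OF n] by auto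
        then have "\<bar>K y z - K x x'\<bar> \<le> \<epsilon>"
          using d(2)[OF N_subset[OF yz(1)] x(1) N_subset[OF yz(2)] x(2)] by (simp add: dist_commute)
        then show ?thesis
          using pou_nonneg[of "2 ^ n" y x] pou_nonneg[of "2 ^ n" z x'] by (simp only: abs_mult abs_of_nonneg mult_left_mono mult_nonneg_nonneg)
      qed auto
    qed
    also have "\<dots> = (\<Sum>y\<in>N n. \<phi> n y x) * (\<Sum>z\<in>N n. \<phi> n z x') * \<epsilon>"
      by (simp only: sum_distrib_right[symmetric] sum_distrib_left[symmetric])
    also have "\<dots> = \<epsilon>" by (simp only: s1 x mult_1)
    finally show ?thesis .
  qed
  then show ?thesis by blast
qed

lemma variance_form_difference:
  "variance_form (N n) (\<lambda>y. \<phi> n y u - \<phi> n y x) = cov n u u - cov n u x - cov n x u + cov n x x"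
proof -
  have "(a - b) * (c - d) * k = a * c * k - a * d * k - b * c * k + b * d * k" for a b c d k :: real
    by (simp add: algebra_simps)
  then show ?thesis unfolding variance_form_def cov_def by (simp only: sum_subtractf sum.distrib)
qed

lemma expected_energy:
  assumes a: "\<And>y. y \<in> N n \<Longrightarrow> sphere_continuous (a y)"
  shows "integrable M (\<lambda>w. sip (\<lambda>x. \<Sum>y\<in>N n. a y x * Z y w) (\<lambda>x. \<Sum>y\<in>N n. a y x * Z y w))"
    and "expectation (\<lambda>w. sip (\<lambda>x. \<Sum>y\<in>N n. a y x * Z y w) (\<lambda>x. \<Sum>y\<in>N n. a y x * Z y w)) =
      (LINT x|sphere_measure. variance_form (N n) (\<lambda>y. a y x))"
proof -
  have eq: "sip (\<lambda>x. \<Sum>y\<in>N n. a y x * Z y w) (\<lambda>x. \<Sum>y\<in>N n. a y x * Z y w) =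
      (\<Sum>y\<in>N n. \<Sum>z\<in>N n. sip (a y) (a z) * (Z y w * Z z w))" for w
  proof -
    let ?f = "\<lambda>x. \<Sum>y\<in>N n. a y x * Z y w"
    have c: "sphere_continuous ?f"
      by (intro continuous_on_sum continuous_on_mult continuous_on_const a)
    have lin: "sip ?f g = (\<Sum>y\<in>N n. sip (a y) g * Z y w)" if "sphere_continuous g" for g
    proof -
      have "sip ?f g = (\<Sum>y\<in>N n. sip (\<lambda>x. a y x * Z y w) g)"
        by (rule sip_sum_left[OF continuous_on_mult[OF a continuous_on_const] that])
      also have "\<dots> = (\<Sum>y\<in>N n. sip (a y) g * Z y w)"
        by (intro sum.cong refl) (simp only: mult.commute[of _ "Z _ w"] sip_cmult_left)
      finally show ?thesis .
    qed
    have "sip ?f ?f = (\<Sum>y\<in>N n. sip (a y) ?f * Z y w)" by (rule lin[OF c])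
    also have "\<dots> = (\<Sum>y\<in>N n. (\<Sum>z\<in>N n. sip (a z) (a y) * Z z w) * Z y w)"
      by (intro sum.cong refl) (simp only: sip_commute[of _ ?f] lin[OF a])
    also have "\<dots> = (\<Sum>y\<in>N n. \<Sum>z\<in>N n. sip (a y) (a z) * (Z y w * Z z w))"
      unfolding sum_distrib_right by (intro sum.cong refl) (simp add: sip_commute mult_ac)
    finally show ?thesis .
  qed
  have int: "integrable M (\<lambda>w. sip (a y) (a z) * (Z y w * Z z w))" if "y \<in> N n" "z \<in> N n" for y z
    by (rule integrable_mult_right) (rule product_integrable[OF N_subset[OF that(1)] N_subset[OF that(2)]])
  show "integrable M (\<lambda>w. sip (\<lambda>x. \<Sum>y\<in>N n. a y x * Z y w) (\<lambda>x. \<Sum>y\<in>N n. a y x * Z y w))"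
    unfolding eq by (intro Bochner_Integration.integrable_sum int)
  have "expectation (\<lambda>w. sip (\<lambda>x. \<Sum>y\<in>N n. a y x * Z y w) (\<lambda>x. \<Sum>y\<in>N n. a y x * Z y w)) =
     (\<Sum>y\<in>N n. expectation (\<lambda>w. \<Sum>z\<in>N n. sip (a y) (a z) * (Z y w * Z z w)))"
    unfolding eq by (rule Bochner_Integration.integral_sum) (intro Bochner_Integration.integrable_sum int)
  also have "\<dots> = (\<Sum>y\<in>N n. \<Sum>z\<in>N n. expectation (\<lambda>w. sip (a y) (a z) * (Z y w * Z z w)))"
    by (intro sum.cong refl Bochner_Integration.integral_sum int)
  also have "\<dots> = (\<Sum>y\<in>N n. \<Sum>z\<in>N n. sip (a y) (a z) * K y z)"
    by (intro sum.cong refl) (simp only: integral_mult_right_zero covariance[OF N_subset N_subset])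
  also have "\<dots> = (\<Sum>y\<in>N n. \<Sum>z\<in>N n. LINT x|sphere_measure. a y x * a z x * K y z)"
    by (intro sum.cong refl) (simp only: sip_def integral_mult_left_zero)
  also have "\<dots> = (\<Sum>y\<in>N n. LINT x|sphere_measure. (\<Sum>z\<in>N n. a y x * a z x * K y z))"
    by (intro sum.cong refl Bochner_Integration.integral_sum[symmetric] integrable_mult_left sip_integrable a)
  also have "\<dots> = (LINT x|sphere_measure. (\<Sum>y\<in>N n. \<Sum>z\<in>N n. a y x * a z x * K y z))"
    by (rule Bochner_Integration.integral_sum[symmetric])
      (intro Bochner_Integration.integrable_sum integrable_mult_left sip_integrable a)
  finally show "expectation (\<lambda>w. sip (\<lambda>x. \<Sum>y\<in>N n. a y x * Z y w) (\<lambda>x. \<Sum>y\<in>N n. a y x * Z y w)) =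
      (LINT x|sphere_measure. variance_form (N n) (\<lambda>y. a y x))"
    unfolding variance_form_def .
qed

end


section \<open>Moments of the Littlewood--Paley blocks\<close>

text \<open>The sums over \<open>i\<close> are kernels \<open>G(u, v)\<close>.  The multiplier acts on them in each variable separately, and its sup
  bound is applied once in \<open>v\<close> and once in \<open>u\<close>.\<close>

lemma multiplier_tensor_bound:
  fixes p q p' q' :: "'i \<Rightarrow> real^'n \<Rightarrow> real"
  assumes B: "\<And>f s. sphere_continuous f \<Longrightarrow> (\<forall>u\<in>sphere 0 1. \<bar>f u\<bar> \<le> s) \<Longrightarrow> \<bar>multiplier c m f x\<bar> \<le> B * s"
    and cont: "\<And>i. i \<in> I \<Longrightarrow> sphere_continuous (p i)" "\<And>i. i \<in> I \<Longrightarrow> sphere_continuous (q i)"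
      "\<And>i. i \<in> I \<Longrightarrow> sphere_continuous (p' i)" "\<And>i. i \<in> I \<Longrightarrow> sphere_continuous (q' i)"
    and le: "\<And>u v. u \<in> sphere 0 1 \<Longrightarrow> v \<in> sphere 0 1 \<Longrightarrow>
      \<bar>(\<Sum>i\<in>I. k i * p i u * q i v) - (\<Sum>i\<in>I. k i * p' i u * q' i v)\<bar> \<le> s"
  shows "\<bar>(\<Sum>i\<in>I. k i * multiplier c m (p i) x * multiplier c m (q i) x) -
      (\<Sum>i\<in>I. k i * multiplier c m (p' i) x * multiplier c m (q' i) x)\<bar> \<le> B * (B * s)"
proof -
  let ?T = "\<lambda>f. multiplier c m f x"
  have sc: "sphere_continuous (\<lambda>v. \<Sum>i\<in>I. z i * f i v)" if "\<And>i. i \<in> I \<Longrightarrow> sphere_continuous (f i)" for z and f :: "'i \<Rightarrow> real^'n \<Rightarrow> real"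
    by (intro continuous_on_sum continuous_on_mult continuous_on_const that)
  have lin: "?T (\<lambda>v. (\<Sum>i\<in>I. z i * f i v) - (\<Sum>i\<in>I. z' i * f' i v)) = (\<Sum>i\<in>I. z i * ?T (f i)) - (\<Sum>i\<in>I. z' i * ?T (f' i))"
    if "\<And>i. i \<in> I \<Longrightarrow> sphere_continuous (f i)" "\<And>i. i \<in> I \<Longrightarrow> sphere_continuous (f' i)"
    for z z' and f f' :: "'i \<Rightarrow> real^'n \<Rightarrow> real"
    by (simp only: multiplier_diff[OF sc[OF that(1)] sc[OF that(2)]] multiplier_sum[OF that(1)] multiplier_sum[OF that(2)])
  have inner: "\<bar>(\<Sum>i\<in>I. (k i * ?T (q i)) * p i u) - (\<Sum>i\<in>I. (k i * ?T (q' i)) * p' i u)\<bar> \<le> B * s" if u: "u \<in> sphere 0 1" for u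
  proof -
    have "\<bar>?T (\<lambda>v. (\<Sum>i\<in>I. (k i * p i u) * q i v) - (\<Sum>i\<in>I. (k i * p' i u) * q' i v))\<bar> \<le> B * s"
      by (rule B) (use le[OF u] cont in \<open>auto intro!: continuous_intros\<close>)
    then have "\<bar>(\<Sum>i\<in>I. (k i * p i u) * ?T (q i)) - (\<Sum>i\<in>I. (k i * p' i u) * ?T (q' i))\<bar> \<le> B * s"
      by (subst (asm) lin) (use cont in auto)
    then show ?thesis by (simp only: mult_ac)
  qed
  have "\<bar>?T (\<lambda>u. (\<Sum>i\<in>I. (k i * ?T (q i)) * p i u) - (\<Sum>i\<in>I. (k i * ?T (q' i)) * p' i u))\<bar> \<le> B * (B * s)"
    by (rule B) (use inner cont in \<open>auto intro!: continuous_intros\<close>)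
  then have "\<bar>(\<Sum>i\<in>I. (k i * ?T (q i)) * ?T (p i)) - (\<Sum>i\<in>I. (k i * ?T (q' i)) * ?T (p' i))\<bar> \<le> B * (B * s)"
    by (subst (asm) lin) (use cont in auto)
  then show ?thesis by (simp only: mult_ac)
qed

context geodesic_field
begin

definition block :: "(real \<Rightarrow> real) \<Rightarrow> nat \<Rightarrow> (real^'n \<Rightarrow> real) \<Rightarrow> real^'n \<Rightarrow> real" where
  "block \<Phi> j = multiplier (block_coeff \<Phi> j TYPE('n)) (2 ^ (j + 1))"

definition block_variance :: "(real \<Rightarrow> real) \<Rightarrow> nat \<Rightarrow> nat \<Rightarrow> real^'n \<Rightarrow> real" where
  "block_variance \<Phi> j n x = variance_form (N n) (\<lambda>y. block \<Phi> j (\<phi> n y) x)"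

lemma block_approx: "block \<Phi> j (approx n w) x = (\<Sum>y\<in>N n. block \<Phi> j (\<phi> n y) x * Z y w)"
proof -
  have "approx n w = (\<lambda>x. \<Sum>y\<in>N n. Z y w * \<phi> n y x)" by (simp add: approx_def fun_eq_iff mult.commute)
  then show ?thesis by (simp add: block_def multiplier_sum[OF \<phi>_continuous] mult.commute)
qed

lemma block_continuous: "sphere_continuous (block \<Phi> j f)"
  unfolding block_def by (rule multiplier_continuous)

lemma block_variance_continuous: "sphere_continuous (block_variance \<Phi> j n)"
  unfolding block_variance_def[abs_def] variance_form_def
  by (intro continuous_on_sum continuous_on_mult continuous_on_const block_continuous)

lemma block_bounded:
  "\<exists>B\<ge>0. \<forall>f s x. sphere_continuous f \<longrightarrow> (\<forall>y\<in>S. \<bar>f y\<bar> \<le> s) \<longrightarrow> x \<in> S \<longrightarrow> \<bar>block \<Phi> j f x\<bar> \<le> B * s"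
  unfolding block_def by (rule multiplier_bounded)

text \<open>The block acts on the covariance of the interpolation in both variables.  That covariance is uniformly close to
  the rotation invariant kernel \<open>K\<close>, and the block commutes with rotations, so the variances at \<open>u\<close> and at \<open>x = U u\<close> are close.\<close>

lemma block_variance_nearly_constant:
  assumes "\<epsilon> > 0"
  shows "\<exists>n0. \<forall>n\<ge>n0. \<forall>x\<in>S. \<forall>u\<in>S. block_variance \<Phi> j n x \<le> block_variance \<Phi> j n u + \<epsilon>"
proof -
  obtain B where B: "0 \<le> B" "\<And>f s x. sphere_continuous f \<Longrightarrow> (\<forall>y\<in>S. \<bar>f y\<bar> \<le> s) \<Longrightarrow> x \<in> S \<Longrightarrow> \<bar>block \<Phi> j f x\<bar> \<le> B * s"
    using block_bounded by blast
  define e where "e = \<epsilon> / (2 * (B * B) + 1)"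
  have "0 < 2 * (B * B) + 1" using B(1) by (intro add_nonneg_pos) auto
  then have e: "e > 0" and eB: "B * (B * (2 * e)) \<le> \<epsilon>"
    using assms by (auto simp: e_def field_simps)
  obtain n0 where n0: "\<And>n x x'. n \<ge> n0 \<Longrightarrow> x \<in> S \<Longrightarrow> x' \<in> S \<Longrightarrow> \<bar>cov n x x' - K x x'\<bar> \<le> e"
    using cov_close[OF e] by blast
  have "block_variance \<Phi> j n x \<le> block_variance \<Phi> j n u + \<epsilon>" if n: "n \<ge> n0" and x: "x \<in> S" and u: "u \<in> S" for n x u
  proof -
    have "norm u = norm x" using x u by simp
    then obtain U where U: "orthogonal_transformation U" "U u = x"
      by (rule orthogonal_transformation_exists)
    have US: "U v \<in> S" if "v \<in> S" for v using that orthogonal_on_sphere[OF U(1)] by blast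
    have inner: "U v \<bullet> U v' = v \<bullet> v'" for v v' using U(1) by (simp add: orthogonal_transformation_def)
    let ?I = "N n \<times> N n"
    have cUc: "sphere_continuous (\<lambda>v. \<phi> n y (U v))" for y
      by (rule continuous_on_compose_orthogonal[OF U(1) \<phi>_continuous])
    have "\<bar>(\<Sum>i\<in>?I. K (fst i) (snd i) * block \<Phi> j (\<lambda>v. \<phi> n (fst i) (U v)) u * block \<Phi> j (\<lambda>v. \<phi> n (snd i) (U v)) u) -
       (\<Sum>i\<in>?I. K (fst i) (snd i) * block \<Phi> j (\<phi> n (fst i)) u * block \<Phi> j (\<phi> n (snd i)) u)\<bar> \<le> B * (B * (2 * e))"
      unfolding block_def
    proof (rule multiplier_tensor_bound)
      show "\<bar>multiplier (block_coeff \<Phi> j TYPE('n)) (2 ^ (j + 1)) f u\<bar> \<le> B * s"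
        if "sphere_continuous f" "\<forall>u\<in>S. \<bar>f u\<bar> \<le> s" for f s
        using B(2)[OF that u] by (simp add: block_def)
      fix v v' assume v: "v \<in> S" "v' \<in> S"
      have c1: "(\<Sum>i\<in>?I. K (fst i) (snd i) * \<phi> n (fst i) a * \<phi> n (snd i) b) = cov n a b" for a b
        unfolding cov_def sum.cartesian_product case_prod_unfold by (intro sum.cong refl) (simp only: mult_ac)
      have "K (U v) (U v') = K v v'" by (simp add: geodist_def inner)
      then show "\<bar>(\<Sum>i\<in>?I. K (fst i) (snd i) * \<phi> n (fst i) (U v) * \<phi> n (snd i) (U v')) -
          (\<Sum>i\<in>?I. K (fst i) (snd i) * \<phi> n (fst i) v * \<phi> n (snd i) v')\<bar> \<le> 2 * e"
        unfolding c1 using n0[OF n US[OF v(1)] US[OF v(2)]] n0[OF n v] by linarith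
    qed (simp_all add: cUc \<phi>_continuous)
    moreover have "block \<Phi> j (\<lambda>v. \<phi> n y (U v)) u = block \<Phi> j (\<phi> n y) x" for y
      unfolding block_def using multiplier_orthogonal[OF U(1) \<phi>_continuous u] by (simp add: U(2))
    moreover have "(\<Sum>i\<in>?I. K (fst i) (snd i) * block \<Phi> j (\<phi> n (fst i)) a * block \<Phi> j (\<phi> n (snd i)) a) = block_variance \<Phi> j n a" for a
      unfolding block_variance_def variance_form_def sum.cartesian_product case_prod_unfold by (intro sum.cong refl) (simp only: mult_ac)
    ultimately show ?thesis using eB by (simp only:)
  qed
  then show ?thesis by blast
qed

text \<open>The integral is the expected energy of the block.  By \<open>block_energy_bound\<close> it is controlled by the expected energies
  of the increments along coordinate rotations by the angle \<open>2\<^bsup>-(j+1)\<^esup>\<close>, and the variance of such an increment is close to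
  \<open>\<rho>(x, R x)\<^sup>\<alpha>\<close>.\<close>

lemma block_variance_integral:
  assumes \<Phi>: "smooth_cutoff \<Phi>" and j: "1 \<le> j" and \<epsilon>: "\<epsilon> > 0"
  shows "\<exists>n0. \<forall>n\<ge>n0. (LINT x|sphere_measure. block_variance \<Phi> j n x) \<le>
     16 * (real CARD('n))^2 * measure sphere_measure S * ((1 / 2 ^ (j + 1)) powr \<alpha> + \<epsilon>)"
proof -
  define \<theta> where "\<theta> = (1 / 2 ^ (j + 1) :: real)"
  have \<theta>: "0 < \<theta>" "\<theta> \<le> pi"
  proof -
    have "(1::real) \<le> 2 ^ (j + 1)" by (rule one_le_power) simp
    then have "\<theta> \<le> 1" unfolding \<theta>_def by (simp only: divide_le_eq_1_pos zero_less_power zero_less_numeral)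
    then show "\<theta> \<le> pi" using pi_ge_two by linarith
    show "0 < \<theta>" by (simp add: \<theta>_def)
  qed
  obtain n0 where n0: "\<And>n x x'. n \<ge> n0 \<Longrightarrow> x \<in> S \<Longrightarrow> x' \<in> S \<Longrightarrow> \<bar>cov n x x' - K x x'\<bar> \<le> \<epsilon> / 4"
    using cov_close[of "\<epsilon> / 4"] \<epsilon> by (meson divide_pos_pos zero_less_numeral)
  let ?P = "{(i, l). i \<noteq> l} :: ('n \<times> 'n) set"
  let ?R = "\<lambda>il. plane_rot (fst il) (snd il) \<theta> :: real^'n \<Rightarrow> real^'n"
  have "(LINT x|sphere_measure. block_variance \<Phi> j n x) \<le> 16 * (real CARD('n))^2 * measure sphere_measure S * (\<theta> powr \<alpha> + \<epsilon>)" if n: "n \<ge> n0" for n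
  proof -
    let ?d = "\<lambda>il y x. \<phi> n y (?R il x) - \<phi> n y x"
    have orth: "orthogonal_transformation (?R il)" if "il \<in> ?P" for il
      using that by (auto intro: orthogonal_plane_rot)
    have dc: "sphere_continuous (?d il y)" if "il \<in> ?P" for il y
      by (rule continuous_on_diff[OF continuous_on_compose_orthogonal[OF orth[OF that] \<phi>_continuous] \<phi>_continuous])
    have approx_d: "approx n w (?R il x) - approx n w x = (\<Sum>y\<in>N n. ?d il y x * Z y w)" for il w x
      unfolding approx_def sum_subtractf[symmetric] left_diff_distrib ..
    have "(LINT x|sphere_measure. block_variance \<Phi> j n x) =
        expectation (\<lambda>w. sip (block \<Phi> j (approx n w)) (block \<Phi> j (approx n w)))"
      unfolding block_variance_def block_approx[abs_def] by (rule expected_energy(2)[symmetric]) (rule block_continuous)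
    also have "\<dots> \<le> expectation (\<lambda>w. 16 * (\<Sum>il\<in>?P. sip (\<lambda>x. \<Sum>y\<in>N n. ?d il y x * Z y w) (\<lambda>x. \<Sum>y\<in>N n. ?d il y x * Z y w)))"
    proof (rule Bochner_Integration.integral_mono)
      show "integrable M (\<lambda>w. sip (block \<Phi> j (approx n w)) (block \<Phi> j (approx n w)))"
        unfolding block_approx[abs_def] by (rule expected_energy(1)) (rule block_continuous)
      show "integrable M (\<lambda>w. 16 * (\<Sum>il\<in>?P. sip (\<lambda>x. \<Sum>y\<in>N n. ?d il y x * Z y w) (\<lambda>x. \<Sum>y\<in>N n. ?d il y x * Z y w)))"
        by (intro integrable_mult_right Bochner_Integration.integrable_sum expected_energy(1) dc)
      show "sip (block \<Phi> j (approx n w)) (block \<Phi> j (approx n w)) \<le>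
          16 * (\<Sum>il\<in>?P. sip (\<lambda>x. \<Sum>y\<in>N n. ?d il y x * Z y w) (\<lambda>x. \<Sum>y\<in>N n. ?d il y x * Z y w))" for w
        using block_energy_bound[OF dim \<Phi> approx_continuous[of n w] j \<theta>_def, of "2 ^ (j + 1)"]
        unfolding block_def approx_d[symmetric] by (simp only: case_prod_unfold)
    qed
    also have "\<dots> = 16 * (\<Sum>il\<in>?P. expectation (\<lambda>w. sip (\<lambda>x. \<Sum>y\<in>N n. ?d il y x * Z y w) (\<lambda>x. \<Sum>y\<in>N n. ?d il y x * Z y w)))"
      by (simp only: integral_mult_right_zero) (subst Bochner_Integration.integral_sum, intro expected_energy(1) dc, simp_all)
    also have "\<dots> = 16 * (\<Sum>il\<in>?P. LINT x|sphere_measure. variance_form (N n) (\<lambda>y. ?d il y x))"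
      by (intro arg_cong[where f="\<lambda>t. 16 * t"] sum.cong refl expected_energy(2) dc)
    also have "\<dots> \<le> 16 * (\<Sum>il\<in>?P. measure sphere_measure S * (\<theta> powr \<alpha> + \<epsilon>))"
    proof (intro mult_left_mono sum_mono)
      fix il assume il: "il \<in> ?P"
      have "(LINT x|sphere_measure. variance_form (N n) (\<lambda>y. ?d il y x)) \<le> (LINT x|(sphere_measure :: (real^'n) measure). \<theta> powr \<alpha> + \<epsilon>)"
      proof (rule Bochner_Integration.integral_mono)
        show "integrable sphere_measure (\<lambda>x. variance_form (N n) (\<lambda>y. ?d il y x))"
          unfolding variance_form_def
          by (intro integrable_sphere_continuous continuous_on_sum continuous_on_mult continuous_on_const dc[OF il])
        show "integrable (sphere_measure :: (real^'n) measure) (\<lambda>x. \<theta> powr \<alpha> + \<epsilon>)" by simp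
        fix x :: "real^'n" assume "x \<in> space sphere_measure"
        then have x: "x \<in> S" by simp
        have Rx: "?R il x \<in> S" using x orthogonal_on_sphere[OF orth[OF il]] by blast
        have "geodist x (?R il x) powr \<alpha> \<le> \<theta> powr \<alpha>"
          using il \<alpha> \<theta> x by (intro powr_mono2) (auto intro: geodist_plane_rot)
        moreover have "K (?R il x) (?R il x) - K (?R il x) x - K x (?R il x) + K x x = geodist x (?R il x) powr \<alpha>"
          using increment_eq[OF x Rx] by (simp add: geodist_commute[of "?R il x" x])
        ultimately show "variance_form (N n) (\<lambda>y. ?d il y x) \<le> \<theta> powr \<alpha> + \<epsilon>"
          unfolding variance_form_difference
          using n0[OF n Rx Rx] n0[OF n Rx x] n0[OF n x Rx] n0[OF n x x] by linarith
      qed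
      then show "(LINT x|sphere_measure. variance_form (N n) (\<lambda>y. ?d il y x)) \<le> measure sphere_measure S * (\<theta> powr \<alpha> + \<epsilon>)" by simp
    qed simp
    also have "\<dots> = 16 * real (card ?P) * measure sphere_measure S * (\<theta> powr \<alpha> + \<epsilon>)" by simp
    also have "\<dots> \<le> 16 * (real CARD('n))^2 * measure sphere_measure S * (\<theta> powr \<alpha> + \<epsilon>)"
    proof -
      have "card ?P \<le> card (UNIV :: ('n \<times> 'n) set)" by (rule card_mono) auto
      then have "card ?P \<le> CARD('n)^2" by (simp add: power2_eq_square card_cartesian_product flip: UNIV_Times_UNIV)
      then have "real (card ?P) \<le> (real CARD('n))^2" by (metis of_nat_le_iff of_nat_power)
      moreover have "0 \<le> \<theta> powr \<alpha> + \<epsilon>" using \<epsilon> by (simp add: add_nonneg_nonneg)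
      ultimately show ?thesis by (intro mult_right_mono mult_left_mono) auto
    qed
    finally show ?thesis .
  qed
  then show ?thesis unfolding \<theta>_def by blast
qed

text \<open>The variance is nearly constant on the sphere, so it is bounded by its mean.  Both errors \<open>\<epsilon>\<close> are taken of the size of
  the main term \<open>t = 2\<^bsup>-(j+1)\<alpha>\<^esup>\<close>, which gives the constant \<open>33 = 16 \<cdot> 2 + 1\<close>.\<close>

lemma block_variance_bound:
  assumes \<Phi>: "smooth_cutoff \<Phi>" and j: "1 \<le> j"
  shows "\<exists>n0. \<forall>n\<ge>n0. \<forall>x\<in>S. block_variance \<Phi> j n x \<le> 33 * (real CARD('n))^2 * (1 / 2 ^ (j + 1)) powr \<alpha>"
proof -
  let ?t = "(1 / 2 ^ (j + 1)) powr \<alpha> :: real" and ?D2 = "(real CARD('n))^2"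
  have t: "0 < ?t" by simp
  have D2: "1 \<le> ?D2" using dim by (simp add: one_le_power)
  then have D2t: "0 < ?D2 * ?t" using t by (intro mult_pos_pos) auto
  obtain n1 where n1: "\<And>n. n \<ge> n1 \<Longrightarrow> (LINT x|sphere_measure. block_variance \<Phi> j n x) \<le> 16 * ?D2 * measure sphere_measure S * (?t + ?t)"
    using block_variance_integral[OF \<Phi> j t] by blast
  obtain n2 where n2: "\<And>n x u. n \<ge> n2 \<Longrightarrow> x \<in> S \<Longrightarrow> u \<in> S \<Longrightarrow> block_variance \<Phi> j n x \<le> block_variance \<Phi> j n u + ?D2 * ?t"
    using block_variance_nearly_constant[OF D2t] by blast
  have "block_variance \<Phi> j n x \<le> 33 * ?D2 * ?t" if n: "n \<ge> max n1 n2" and x: "x \<in> S" for n x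
  proof -
    have "measure sphere_measure S * block_variance \<Phi> j n x = (LINT u|(sphere_measure :: (real^'n) measure). block_variance \<Phi> j n x)" by simp
    also have "\<dots> \<le> (LINT u|sphere_measure. block_variance \<Phi> j n u + ?D2 * ?t)"
      by (rule Bochner_Integration.integral_mono)
        (use n2 n x block_variance_continuous in \<open>auto intro!: integrable_sphere_continuous continuous_intros\<close>)
    also have "\<dots> = (LINT u|sphere_measure. block_variance \<Phi> j n u) + measure sphere_measure S * (?D2 * ?t)"
      by (subst Bochner_Integration.integral_add) (auto intro!: integrable_sphere_continuous block_variance_continuous)
    also have "\<dots> \<le> 16 * ?D2 * measure sphere_measure S * (?t + ?t) + measure sphere_measure S * (?D2 * ?t)"
      by (rule add_right_mono, rule n1) (use n in simp)
    also have "\<dots> = measure sphere_measure S * (33 * ?D2 * ?t)" by (simp add: algebra_simps)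
    finally show ?thesis by (rule mult_left_le_imp_le) (rule sphere_measure_pos)
  qed
  then show ?thesis by blast
qed

text \<open>Tonelli's theorem, and the Gaussian moments of the block at a fixed point of the sphere.\<close>

lemma block_approx_moment:
  assumes \<Phi>: "smooth_cutoff \<Phi>" and j: "1 \<le> j"
  shows "\<exists>n0. \<forall>n\<ge>n0. (\<integral>\<^sup>+w. \<integral>\<^sup>+x. ennreal ((block \<Phi> j (approx n w) x) ^ (2 * p)) \<partial>sphere_measure \<partial>M) \<le>
     ennreal (measure sphere_measure S * (gauss_moment p * (33 * (real CARD('n))^2 * (1 / 2 ^ (j + 1)) powr \<alpha>) ^ p))"
    and "(\<lambda>w. \<integral>\<^sup>+x. ennreal ((block \<Phi> j (approx n w) x) ^ (2 * p)) \<partial>sphere_measure) \<in> borel_measurable M"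
proof -
  interpret pair_sigma_finite "sphere_measure :: (real^'n) measure" M
    by (intro pair_sigma_finite.intro sphere.sigma_finite_measure_axioms sigma_finite_measure_axioms)
  have meas: "(\<lambda>(x, w). ennreal ((block \<Phi> j (approx n w) x) ^ (2 * p))) \<in> borel_measurable (sphere_measure \<Otimes>\<^sub>M M)" for n
  proof -
    have "(\<lambda>xw. block \<Phi> j (\<phi> n y) (fst xw) * Z y (snd xw)) \<in> borel_measurable (sphere_measure \<Otimes>\<^sub>M M)" if "y \<in> N n" for y
      by (intro borel_measurable_times measurable_compose[OF measurable_fst borel_measurable_sphere_continuous[OF block_continuous]]
          measurable_compose[OF measurable_snd Z_measurable[OF N_subset[OF that]]])
    then have "(\<lambda>xw. \<Sum>y\<in>N n. block \<Phi> j (\<phi> n y) (fst xw) * Z y (snd xw)) \<in> borel_measurable (sphere_measure \<Otimes>\<^sub>M M)"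
      by (rule borel_measurable_sum)
    then show ?thesis unfolding block_approx case_prod_unfold by measurable
  qed
  from meas[of n] have "(\<lambda>(w, x). ennreal ((block \<Phi> j (approx n w) x) ^ (2 * p))) \<in> borel_measurable (M \<Otimes>\<^sub>M sphere_measure)"
    by (subst measurable_pair_swap_iff) (simp add: case_prod_unfold)
  then show "(\<lambda>w. \<integral>\<^sup>+x. ennreal ((block \<Phi> j (approx n w) x) ^ (2 * p)) \<partial>sphere_measure) \<in> borel_measurable M"
    by (rule sphere.borel_measurable_nn_integral)
  let ?b = "33 * (real CARD('n))^2 * (1 / 2 ^ (j + 1)) powr \<alpha>"
  obtain n0 where n0: "\<And>n x. n \<ge> n0 \<Longrightarrow> x \<in> S \<Longrightarrow> block_variance \<Phi> j n x \<le> ?b"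
    using block_variance_bound[OF \<Phi> j] by blast
  have "(\<integral>\<^sup>+w. \<integral>\<^sup>+x. ennreal ((block \<Phi> j (approx n w) x) ^ (2 * p)) \<partial>sphere_measure \<partial>M) \<le>
     ennreal (measure sphere_measure S * (gauss_moment p * ?b ^ p))" if n: "n \<ge> n0" for n
  proof -
    have "(\<integral>\<^sup>+w. \<integral>\<^sup>+x. ennreal ((block \<Phi> j (approx n w) x) ^ (2 * p)) \<partial>sphere_measure \<partial>M) =
       (\<integral>\<^sup>+x. \<integral>\<^sup>+w. ennreal ((block \<Phi> j (approx n w) x) ^ (2 * p)) \<partial>M \<partial>sphere_measure)"
      using Fubini'[OF meas[of n]] .
    also have "\<dots> = (\<integral>\<^sup>+x. ennreal (gauss_moment p * block_variance \<Phi> j n x ^ p) \<partial>sphere_measure)"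
      unfolding block_approx block_variance_def
      by (intro nn_integral_cong combination_moment finite_net net_subset)
    also have "\<dots> \<le> (\<integral>\<^sup>+x. ennreal (gauss_moment p * ?b ^ p) \<partial>(sphere_measure :: (real^'n) measure))"
    proof (rule nn_integral_mono)
      fix x :: "real^'n" assume "x \<in> space sphere_measure"
      then have "x \<in> S" by simp
      moreover have "0 \<le> block_variance \<Phi> j n x"
        unfolding block_variance_def by (rule variance_form_nonneg[OF finite_net net_subset])
      ultimately show "ennreal (gauss_moment p * block_variance \<Phi> j n x ^ p) \<le> ennreal (gauss_moment p * ?b ^ p)"
        using n0[OF n] by (intro ennreal_leI mult_left_mono power_mono gauss_moment_nonneg)
    qed
    also have "\<dots> = ennreal (gauss_moment p * ?b ^ p) * ennreal (measure sphere_measure S)"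
      by (simp add: sphere.emeasure_eq_measure)
    also have "\<dots> = ennreal (measure sphere_measure S * (gauss_moment p * ?b ^ p))"
      by (subst mult.commute) (rule ennreal_mult[symmetric], auto intro!: mult_nonneg_nonneg gauss_moment_nonneg zero_le_power)
    finally show ?thesis .
  qed
  then show "\<exists>n0. \<forall>n\<ge>n0. (\<integral>\<^sup>+w. \<integral>\<^sup>+x. ennreal ((block \<Phi> j (approx n w) x) ^ (2 * p)) \<partial>sphere_measure \<partial>M) \<le>
     ennreal (measure sphere_measure S * (gauss_moment p * ?b ^ p))" by blast
qed

text \<open>Where the interpolations diverge the value of \<open>lim\<close> is arbitrary; \<open>path_converges\<close> singles out the outcomes
  without such points.\<close>

definition path :: "'w \<Rightarrow> real^'n \<Rightarrow> real" where
  "path w x = lim (\<lambda>n. approx n w x)"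

definition path_converges :: "'w \<Rightarrow> bool" where
  "path_converges w \<longleftrightarrow> uniform_limit S (\<lambda>n. approx n w) (path w) sequentially"

lemma AE_path_converges: "AE w in M. path_converges w"
  unfolding path_converges_def path_def by (rule AE_approx_uniform)

lemma path_continuous: "path_converges w \<Longrightarrow> sphere_continuous (path w)"
  unfolding path_converges_def by (rule uniform_limit_theorem[rotated]) (auto simp: approx_continuous)

lemma block_approx_tendsto:
  assumes good: "path_converges w" and x: "x \<in> S"
  shows "(\<lambda>n. block \<Phi> j (approx n w) x) \<longlonglongrightarrow> block \<Phi> j (path w) x"
proof -
  obtain B where B: "0 \<le> B" "\<And>f s x. sphere_continuous f \<Longrightarrow> (\<forall>y\<in>S. \<bar>f y\<bar> \<le> s) \<Longrightarrow> x \<in> S \<Longrightarrow> \<bar>block \<Phi> j f x\<bar> \<le> B * s"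
    using block_bounded by blast
  show ?thesis
  proof (rule tendstoI)
    fix e :: real assume e: "e > 0"
    define s where "s = e / (B + 1)"
    have s: "s > 0" "B * s < e" using e B(1) by (auto simp: s_def field_simps)
    have "\<forall>\<^sub>F n in sequentially. \<forall>y\<in>S. dist (approx n w y) (path w y) < s"
      using good s(1) unfolding path_converges_def by (rule uniform_limitD)
    then show "\<forall>\<^sub>F n in sequentially. dist (block \<Phi> j (approx n w) x) (block \<Phi> j (path w) x) < e"
    proof (rule eventually_mono)
      fix n assume n: "\<forall>y\<in>S. dist (approx n w y) (path w y) < s"
      have "\<bar>block \<Phi> j (\<lambda>y. approx n w y - path w y) x\<bar> \<le> B * s"
        by (rule B(2)[OF _ _ x])
          (use n in \<open>auto simp: dist_real_def less_imp_le intro!: continuous_on_diff approx_continuous path_continuous good\<close>)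
      then show "dist (block \<Phi> j (approx n w) x) (block \<Phi> j (path w) x) < e"
        using s(2) multiplier_diff[OF approx_continuous[of n w] path_continuous[OF good], of "block_coeff \<Phi> j TYPE('n)" "2 ^ (j + 1)" x]
        by (simp add: dist_real_def block_def)
    qed
  qed
qed

text \<open>The variable \<open>V\<close> dominates the supremum over the sphere.  It is obtained from the sup bound for polynomials, applied
  to the block of the limiting path; Fatou's lemma on the sphere compares its integral with those of the interpolations, and
  Fatou's lemma on the probability space bounds the expectation.\<close>

lemma block_sup_moment:
  assumes \<Phi>: "smooth_cutoff \<Phi>" and j: "1 \<le> j"
  shows "\<exists>V. V \<in> borel_measurable M \<and>
    (\<integral>\<^sup>+w. V w \<partial>M) \<le> ennreal (real ((p * 2 ^ (j + 1) + 1) ^ CARD('n)) *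
        (gauss_moment p * (33 * (real CARD('n))^2 * (1 / 2 ^ (j + 1)) powr \<alpha>) ^ p)) \<and>
    (\<forall>w x. path_converges w \<longrightarrow> x \<in> S \<longrightarrow> ennreal ((block \<Phi> j (path w) x) ^ (2 * p)) \<le> V w)"
proof -
  let ?b = "gauss_moment p * (33 * (real CARD('n))^2 * (1 / 2 ^ (j + 1)) powr \<alpha>) ^ p"
  let ?d = "real ((p * 2 ^ (j + 1) + 1) ^ CARD('n))"
  let ?G = "\<lambda>n w. \<integral>\<^sup>+x. ennreal ((block \<Phi> j (approx n w) x) ^ (2 * p)) \<partial>sphere_measure"
  have b0: "0 \<le> ?b" by (intro mult_nonneg_nonneg gauss_moment_nonneg zero_le_power) auto
  have mpos: "measure sphere_measure S > 0" by (rule sphere_measure_pos)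
  have [measurable]: "?G n \<in> borel_measurable M" for n by (rule block_approx_moment(2)[OF \<Phi> j])
  \<comment> \<open>The factor is the constant of the sup bound for polynomials of degree \<open>p 2\<^bsup>j+1\<^esup>\<close>.\<close>
  define V where "V w = ennreal (?d / measure sphere_measure S) * liminf (\<lambda>n. ?G n w)" for w
  have "V \<in> borel_measurable M" unfolding V_def[abs_def] by measurable
  moreover have "(\<integral>\<^sup>+w. V w \<partial>M) \<le> ennreal (?d * ?b)"
  proof -
    have "(\<integral>\<^sup>+w. V w \<partial>M) = ennreal (?d / measure sphere_measure S) * (\<integral>\<^sup>+w. liminf (\<lambda>n. ?G n w) \<partial>M)"
      unfolding V_def by (rule nn_integral_cmult) measurable
    also have "(\<integral>\<^sup>+w. liminf (\<lambda>n. ?G n w) \<partial>M) \<le> liminf (\<lambda>n. \<integral>\<^sup>+w. ?G n w \<partial>M)"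
      by (rule nn_integral_liminf) measurable
    also have "\<dots> \<le> ennreal (measure sphere_measure S * ?b)"
      using block_approx_moment(1)[OF \<Phi> j, of p] by (intro Liminf_le) (auto simp: eventually_sequentially)
    also have "ennreal (?d / measure sphere_measure S) * ennreal (measure sphere_measure S * ?b) = ennreal (?d / measure sphere_measure S * (measure sphere_measure S * ?b))"
      by (rule ennreal_mult[symmetric], (rule divide_nonneg_nonneg; simp), (rule mult_nonneg_nonneg[OF _ b0]; simp))
    also have "?d / measure sphere_measure S * (measure sphere_measure S * ?b) = ?d * ?b" using mpos by simp
    finally show ?thesis by (simp add: mult_left_mono)
  qed
  moreover have "ennreal ((block \<Phi> j (path w) x) ^ (2 * p)) \<le> V w" if good: "path_converges w" and x: "x \<in> S" for w x
  proof -
    \<comment> \<open>The block of the limiting path is a polynomial again, so its \<open>2p\<close>-th moment controls its supremum.\<close>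
    let ?f = "block \<Phi> j (path w)"
    have cf: "sphere_continuous (\<lambda>x. ?f x ^ (2 * p))" by (intro continuous_intros block_continuous)
    have nn: "0 \<le> t ^ (2 * p)" for t :: real by (simp add: power_mult)
    have "ennreal (LINT y|sphere_measure. ?f y ^ (2 * p)) = (\<integral>\<^sup>+y. ennreal (?f y ^ (2 * p)) \<partial>sphere_measure)"
      by (rule nn_integral_eq_integral[symmetric, OF integrable_sphere_continuous[OF cf]]) (simp add: nn)
    also have "\<dots> = (\<integral>\<^sup>+y. liminf (\<lambda>n. ennreal (block \<Phi> j (approx n w) y ^ (2 * p))) \<partial>sphere_measure)"
    proof (rule nn_integral_cong)
      fix y :: "real^'n" assume "y \<in> space sphere_measure"
      then have "(\<lambda>n. ennreal (block \<Phi> j (approx n w) y ^ (2 * p))) \<longlonglongrightarrow> ennreal (?f y ^ (2 * p))"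
        by (intro tendsto_ennrealI tendsto_power block_approx_tendsto[OF good]) simp
      then show "ennreal (?f y ^ (2 * p)) = liminf (\<lambda>n. ennreal (block \<Phi> j (approx n w) y ^ (2 * p)))"
        by (intro lim_imp_Liminf[symmetric]) simp_all
    qed
    also have "\<dots> \<le> liminf (\<lambda>n. ?G n w)"
    proof (rule nn_integral_liminf)
      fix n
      have "(\<lambda>y. block \<Phi> j (approx n w) y ^ (2 * p)) \<in> borel_measurable sphere_measure"
        by (intro borel_measurable_sphere_continuous continuous_on_power block_continuous)
      then show "(\<lambda>y. ennreal (block \<Phi> j (approx n w) y ^ (2 * p))) \<in> borel_measurable sphere_measure" by measurable
    qed
    finally have int: "ennreal (LINT y|sphere_measure. ?f y ^ (2 * p)) \<le> liminf (\<lambda>n. ?G n w)" .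
    have "?f x ^ (2 * p) * measure sphere_measure S \<le> ?d * (LINT y|sphere_measure. ?f y ^ (2 * p))"
      unfolding block_def by (rule polys_sup_moment_bound[OF multiplier_polys x])
    then have "?f x ^ (2 * p) \<le> ?d / measure sphere_measure S * (LINT y|sphere_measure. ?f y ^ (2 * p))"
      using mpos by (simp add: field_simps)
    then have "ennreal (?f x ^ (2 * p)) \<le> ennreal (?d / measure sphere_measure S * (LINT y|sphere_measure. ?f y ^ (2 * p)))" by (rule ennreal_leI)
    also have "\<dots> = ennreal (?d / measure sphere_measure S) * ennreal (LINT y|sphere_measure. ?f y ^ (2 * p))"
      using mpos by (intro ennreal_mult divide_nonneg_nonneg Bochner_Integration.integral_nonneg nn) auto
    also have "\<dots> \<le> V w" unfolding V_def by (intro mult_left_mono int) simp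
    finally show ?thesis .
  qed
  ultimately show ?thesis by blast
qed

end


section \<open>Besov regularity of the trajectories\<close>

context geodesic_field
begin

text \<open>Passing to the supremum costs the factor \<open>2\<^bsup>jD\<^esup>\<close> whatever \<open>p\<close> is, while the moments decay like
  \<open>2\<^bsup>-j\<alpha>p\<^esup>\<close>.  Since \<open>2\<tau> < \<alpha>\<close>, a large \<open>p\<close> leaves room for the weight \<open>2\<^bsup>2pj\<tau>\<^esup>\<close>.\<close>

lemma AE_block_decay:
  assumes \<Phi>: "smooth_cutoff \<Phi>" and \<tau>: "\<tau> < \<alpha> / 2"
  shows "AE w in M. path_converges w \<longrightarrow> (\<exists>B\<ge>0. \<forall>n. \<forall>x\<in>S. \<bar>block \<Phi> (Suc n) (path w) x\<bar> \<le> B * (2 powr (- \<tau>)) ^ n)"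
proof -
  let ?D = "CARD('n)"
  obtain p :: nat where p: "real ?D < real p * (\<alpha> - 2 * \<tau>)"
    using reals_Archimedean3[of "\<alpha> - 2 * \<tau>"] \<tau> by auto
  have p0: "0 < p" using p by (cases "p = 0") auto
  define s where "s = 2 powr (2 * real p * \<tau>)"
  define A where "A = (4 * real p + 1) ^ ?D * (gauss_moment p * (33 * (real ?D)^2) ^ p)"
  \<comment> \<open>The rate at which the weighted expectations decay; \<open>q < 1\<close> is the choice of \<open>p\<close>.\<close>
  define q where "q = s * 2 ^ ?D * (2 powr (- \<alpha>)) ^ p"
  have s0: "0 < s" by (simp add: s_def)
  have A0: "0 \<le> A" unfolding A_def by (intro mult_nonneg_nonneg zero_le_power gauss_moment_nonneg) auto
  have q: "0 \<le> q" "q < 1"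
  proof -
    have "q = 2 powr (2 * real p * \<tau> + real ?D + real p * (- \<alpha>))"
      by (simp add: q_def s_def powr_add powr_diff powr_power powr_realpow powr_minus_divide power_divide)
    also have "\<dots> < 1" using p by (intro powr_less_one) (auto simp: algebra_simps)
    finally show "q < 1" .
    show "0 \<le> q" using s0 by (simp add: q_def)
  qed
  have "\<forall>n. \<exists>V. V \<in> borel_measurable M \<and>
    (\<integral>\<^sup>+w. V w \<partial>M) \<le> ennreal (real ((p * 2 ^ (Suc n + 1) + 1) ^ ?D) *
        (gauss_moment p * (33 * (real ?D)^2 * (1 / 2 ^ (Suc n + 1)) powr \<alpha>) ^ p)) \<and>
    (\<forall>w x. path_converges w \<longrightarrow> x \<in> S \<longrightarrow> ennreal ((block \<Phi> (Suc n) (path w) x) ^ (2 * p)) \<le> V w)"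
    by (intro allI block_sup_moment[OF \<Phi>]) simp
  from choice[OF this] obtain V where
    meas [measurable]: "\<And>n. V n \<in> borel_measurable M" and
    int: "\<And>n. (\<integral>\<^sup>+w. V n w \<partial>M) \<le> ennreal (real ((p * 2 ^ (Suc n + 1) + 1) ^ ?D) *
        (gauss_moment p * (33 * (real ?D)^2 * (1 / 2 ^ (Suc n + 1)) powr \<alpha>) ^ p))" and
    le: "\<And>n w x. path_converges w \<Longrightarrow> x \<in> S \<Longrightarrow> ennreal ((block \<Phi> (Suc n) (path w) x) ^ (2 * p)) \<le> V n w"
    by blast
  have "AE w in M. \<exists>B>0. \<forall>n. ennreal (s ^ n) * V n w \<le> ennreal B"
  proof (rule AE_bounded_of_geometric_moments[OF _ _ q A0])
    show "(\<lambda>w. ennreal (s ^ n) * V n w) \<in> borel_measurable M" for n by measurable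
    fix n
    let ?Y = "2 ^ n :: real"
    have Y: "1 \<le> ?Y" by (rule one_le_power) simp
    have "real ((p * 2 ^ (Suc n + 1) + 1) ^ ?D) = (4 * real p * ?Y + 1) ^ ?D" by (simp add: mult_ac add.commute)
    also have "\<dots> \<le> ((4 * real p + 1) * ?Y) ^ ?D"
      by (rule power_mono) (use Y in \<open>auto simp: distrib_right\<close>)
    finally have 1: "real ((p * 2 ^ (Suc n + 1) + 1) ^ ?D) \<le> (4 * real p + 1) ^ ?D * (2 ^ ?D) ^ n"
      by (simp add: power_mult_distrib mult.commute flip: power_mult)
    have "(1 / 2 ^ (Suc n + 1)) powr \<alpha> \<le> (1 / ?Y) powr \<alpha>"
      using \<alpha> by (intro powr_mono2) (auto simp: field_simps)
    also have "\<dots> = (2 powr (- \<alpha>)) ^ n"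
    proof -
      have "1 / ?Y = 2 powr (- real n)" by (simp add: powr_minus powr_realpow divide_inverse)
      then show ?thesis by (simp add: powr_powr powr_power)
    qed
    finally have "(33 * (real ?D)^2 * (1 / 2 ^ (Suc n + 1)) powr \<alpha>) ^ p \<le> (33 * (real ?D)^2 * (2 powr (- \<alpha>)) ^ n) ^ p"
      by (intro power_mono mult_left_mono) auto
    also have "\<dots> = (33 * (real ?D)^2) ^ p * ((2 powr (- \<alpha>)) ^ p) ^ n"
      unfolding power_mult_distrib power_mult[symmetric] mult.commute[of n p] ..
    finally have 2: "(33 * (real ?D)^2 * (1 / 2 ^ (Suc n + 1)) powr \<alpha>) ^ p \<le> (33 * (real ?D)^2) ^ p * ((2 powr (- \<alpha>)) ^ p) ^ n" .
    have "(\<integral>\<^sup>+w. ennreal (s ^ n) * V n w \<partial>M) = ennreal (s ^ n) * (\<integral>\<^sup>+w. V n w \<partial>M)"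
      by (rule nn_integral_cmult[OF meas])
    also have "\<dots> \<le> ennreal (s ^ n) * ennreal (((4 * real p + 1) ^ ?D * (2 ^ ?D) ^ n) *
        (gauss_moment p * ((33 * (real ?D)^2) ^ p * ((2 powr (- \<alpha>)) ^ p) ^ n)))"
    proof (rule mult_left_mono[OF order_trans[OF int ennreal_leI]])
      show "real ((p * 2 ^ (Suc n + 1) + 1) ^ ?D) * (gauss_moment p * (33 * (real ?D)^2 * (1 / 2 ^ (Suc n + 1)) powr \<alpha>) ^ p)
        \<le> ((4 * real p + 1) ^ ?D * (2 ^ ?D) ^ n) * (gauss_moment p * ((33 * (real ?D)^2) ^ p * ((2 powr (- \<alpha>)) ^ p) ^ n))"
        by (rule mult_mono[OF 1 mult_left_mono[OF 2 gauss_moment_nonneg]])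
          (auto intro!: mult_nonneg_nonneg gauss_moment_nonneg zero_le_power)
    qed simp
    also have "\<dots> = ennreal (s ^ n * (((4 * real p + 1) ^ ?D * (2 ^ ?D) ^ n) *
        (gauss_moment p * ((33 * (real ?D)^2) ^ p * ((2 powr (- \<alpha>)) ^ p) ^ n))))"
      by (rule ennreal_mult'[symmetric]) (use s0 in simp)
    also have "s ^ n * (((4 * real p + 1) ^ ?D * (2 ^ ?D) ^ n) *
        (gauss_moment p * ((33 * (real ?D)^2) ^ p * ((2 powr (- \<alpha>)) ^ p) ^ n))) = A * q ^ n"
      unfolding A_def q_def power_mult_distrib[of _ _ n] by (simp only: mult_ac)
    finally show "(\<integral>\<^sup>+w. ennreal (s ^ n) * V n w \<partial>M) \<le> ennreal (A * q ^ n)" .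
  qed
  then show ?thesis
  proof (rule AE_mp, intro AE_I2 impI)
    fix w assume "\<exists>B>0. \<forall>n. ennreal (s ^ n) * V n w \<le> ennreal B" and good: "path_converges w"
    then obtain B where B: "0 < B" "\<And>n. ennreal (s ^ n) * V n w \<le> ennreal B" by blast
    let ?k = "2 powr (- \<tau>)"
    have "\<bar>block \<Phi> (Suc n) (path w) x\<bar> \<le> max 1 B * ?k ^ n" if x: "x \<in> S" for n x
    proof -
      let ?b = "\<bar>block \<Phi> (Suc n) (path w) x\<bar>"
      have "ennreal (s ^ n * ?b ^ (2 * p)) = ennreal (s ^ n) * ennreal (block \<Phi> (Suc n) (path w) x ^ (2 * p))"
        using s0 by (simp add: ennreal_mult' power_mult)
      also have "\<dots> \<le> ennreal (s ^ n) * V n w" by (intro mult_left_mono le good x) simp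
      also have "\<dots> \<le> ennreal B" by (rule B)
      finally have "s ^ n * ?b ^ (2 * p) \<le> B" using B(1) by (simp add: ennreal_le_iff)
      then have "?b ^ (2 * p) \<le> B * inverse (s ^ n)" using s0 by (simp add: field_simps)
      also have "\<dots> \<le> max 1 B ^ (2 * p) * (?k ^ n) ^ (2 * p)"
      proof -
        have "(?k ^ n) ^ (2 * p) = inverse (s ^ n)"
          by (simp add: s_def powr_power powr_minus[symmetric] algebra_simps)
        moreover have "max 1 B ^ 1 \<le> max 1 B ^ (2 * p)" using p0 by (intro power_increasing) auto
        moreover have "B \<le> max 1 B ^ 1" by simp
        ultimately have "B \<le> max 1 B ^ (2 * p)" "(?k ^ n) ^ (2 * p) = inverse (s ^ n)" by linarith+
        moreover have "0 \<le> inverse (s ^ n)" using s0 by simp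
        ultimately show ?thesis by (simp only: mult_right_mono)
      qed
      also have "\<dots> = (max 1 B * ?k ^ n) ^ (2 * p)" by (simp only: power_mult_distrib)
      finally show ?thesis using p0 by (subst (asm) power_mono_iff) auto
    qed
    moreover have "0 \<le> max 1 B" by simp
    ultimately show "\<exists>B\<ge>0. \<forall>n. \<forall>x\<in>S. \<bar>block \<Phi> (Suc n) (path w) x\<bar> \<le> B * ?k ^ n" by blast
  qed
qed

lemma besov_if_block_decay:
  assumes \<Phi>: "smooth_cutoff \<Phi>" and f: "sphere_continuous f" and \<gamma>: "\<gamma> < \<tau>" and B: "0 \<le> B"
    and decay: "\<And>n x. x \<in> S \<Longrightarrow> \<bar>block \<Phi> (Suc n) f x\<bar> \<le> B * (2 powr (- \<tau>)) ^ n"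
  shows "f \<in> besov_inf_1 \<Phi> \<gamma>"
proof -
  obtain e :: "real^'n" where e: "norm e = 1" using vector_choose_size[of 1] by auto
  then have e: "e \<in> S" by simp
  have lp: "\<bar>littlewood_paley \<Phi> (Suc n) f x\<bar> \<le> B * (2 powr (- \<tau>)) ^ n" if "x \<in> S" for n x
    using decay[OF that, of n] littlewood_paley_eq_multiplier[OF dim \<Phi> f that, of "Suc n"] by (simp only: block_def)
  have norm_le: "sphere_sup_norm (littlewood_paley \<Phi> (Suc n) f) \<le> B * (2 powr (- \<tau>)) ^ n" for n
    unfolding sphere_sup_norm_def by (rule cSUP_least) (use e lp in blast)+
  have norm_nonneg: "0 \<le> sphere_sup_norm (littlewood_paley \<Phi> (Suc n) f)" for n
    unfolding sphere_sup_norm_def by (rule cSUP_upper2[OF _ e abs_ge_zero], rule bdd_aboveI2, rule lp)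
  have "summable (\<lambda>n. 2 powr (real (Suc n) * \<gamma>) * sphere_sup_norm (littlewood_paley \<Phi> (Suc n) f))"
  proof (rule summable_comparison_test'[where N = 0])
    show "summable (\<lambda>n. (2 powr \<gamma> * B) * (2 powr (\<gamma> - \<tau>)) ^ n)"
      using \<gamma> by (intro summable_mult summable_geometric) (simp add: powr_less_one)
    fix n :: nat
    have "norm (2 powr (real (Suc n) * \<gamma>) * sphere_sup_norm (littlewood_paley \<Phi> (Suc n) f)) =
        2 powr (real (Suc n) * \<gamma>) * sphere_sup_norm (littlewood_paley \<Phi> (Suc n) f)"
      using norm_nonneg[of n] by simp
    also have "\<dots> \<le> 2 powr (real (Suc n) * \<gamma>) * (B * (2 powr (- \<tau>)) ^ n)"
      by (rule mult_left_mono[OF norm_le]) simp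
    also have "\<dots> = (2 powr \<gamma> * B) * (2 powr (\<gamma> - \<tau>)) ^ n"
    proof -
      have "2 powr (real (Suc n) * \<gamma>) = 2 powr \<gamma> * (2 powr \<gamma>) ^ n"
        by (simp add: powr_power powr_add[symmetric] algebra_simps)
      moreover have "2 powr (\<gamma> - \<tau>) = 2 powr \<gamma> * 2 powr (- \<tau>)" by (simp add: powr_add[symmetric])
      ultimately show ?thesis by (simp add: power_mult_distrib)
    qed
    finally show "norm (2 powr (real (Suc n) * \<gamma>) * sphere_sup_norm (littlewood_paley \<Phi> (Suc n) f))
        \<le> (2 powr \<gamma> * B) * (2 powr (\<gamma> - \<tau>)) ^ n" .
  qed
  then have "summable (\<lambda>j. 2 powr (real j * \<gamma>) * sphere_sup_norm (littlewood_paley \<Phi> j f))"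
    by (subst (asm) summable_Suc_iff)
  then show ?thesis using f by (simp add: besov_inf_1_def)
qed

text \<open>The exceptional null set must not depend on \<open>\<gamma>\<close>; it is the union of those of the countably many rational rates
  \<open>\<tau> < \<alpha>/2\<close>.\<close>

lemma AE_besov:
  assumes \<Phi>: "smooth_cutoff \<Phi>"
  shows "AE w in M. \<forall>\<gamma>. \<gamma> < \<alpha> / 2 \<longrightarrow> path w \<in> besov_inf_1 \<Phi> \<gamma>"
proof -
  let ?Q = "{\<tau> \<in> \<rat>. \<tau> < \<alpha> / 2}"
  have "countable ?Q" by (rule countable_subset[OF _ countable_rat]) auto
  then have "AE w in M. \<forall>\<tau>\<in>?Q. path_converges w \<longrightarrow> (\<exists>B\<ge>0. \<forall>n. \<forall>x\<in>S. \<bar>block \<Phi> (Suc n) (path w) x\<bar> \<le> B * (2 powr (- \<tau>)) ^ n)"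
    by (subst AE_ball_countable) (auto intro: AE_block_decay[OF \<Phi>])
  with AE_path_converges show ?thesis
  proof eventually_elim
    fix w assume good: "path_converges w" and
      decay: "\<forall>\<tau>\<in>?Q. path_converges w \<longrightarrow> (\<exists>B\<ge>0. \<forall>n. \<forall>x\<in>S. \<bar>block \<Phi> (Suc n) (path w) x\<bar> \<le> B * (2 powr (- \<tau>)) ^ n)"
    show "\<forall>\<gamma>. \<gamma> < \<alpha> / 2 \<longrightarrow> path w \<in> besov_inf_1 \<Phi> \<gamma>"
    proof (intro allI impI)
      fix \<gamma> assume "\<gamma> < \<alpha> / 2"
      then obtain \<tau> where \<tau>: "\<tau> \<in> \<rat>" "\<gamma> < \<tau>" "\<tau> < \<alpha> / 2" using Rats_dense_in_real by blast
      then obtain B where "0 \<le> B" "\<And>n x. x \<in> S \<Longrightarrow> \<bar>block \<Phi> (Suc n) (path w) x\<bar> \<le> B * (2 powr (- \<tau>)) ^ n"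
        using decay good by blast
      then show "path w \<in> besov_inf_1 \<Phi> \<gamma>"
        by (rule besov_if_block_decay[OF \<Phi> path_continuous[OF good] \<tau>(2)])
    qed
  qed
qed

lemma path_modification: "modification_on M S Z (\<lambda>x w. path w x)"
  unfolding path_def by (rule continuous_modification)

end

theorem theorem6:
  fixes d :: nat and \<alpha> :: real
  assumes "d \<ge> 1" and "CARD('n) = d + 1"
    and "0 < \<alpha>" and "\<alpha> \<le> 1"
  shows "negative_definite_on (sphere (0 :: real ^ 'n) 1) (\<lambda>\<xi> \<eta>. geodist \<xi> \<eta> powr \<alpha>) \<and>
    (\<exists>C\<^sub>0>0. \<forall>C\<ge>C\<^sub>0. positive_definite_on (sphere (0 :: real ^ 'n) 1)
       (\<lambda>\<xi> \<eta>. C - 1 / 2 * geodist \<xi> \<eta> powr \<alpha>)) \<and>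
    (\<forall>C (M :: 'w measure) (Z :: real ^ 'n \<Rightarrow> 'w \<Rightarrow> real) \<Phi>.
       C > 0 \<longrightarrow>
       positive_definite_on (sphere (0 :: real ^ 'n) 1) (\<lambda>\<xi> \<eta>. C - 1 / 2 * geodist \<xi> \<eta> powr \<alpha>) \<longrightarrow>
       centered_gaussian_process M (sphere 0 1) Z (\<lambda>\<xi> \<eta>. C - 1 / 2 * geodist \<xi> \<eta> powr \<alpha>) \<longrightarrow>
       smooth_cutoff \<Phi> \<longrightarrow>
       (\<exists>Z'. modification_on M (sphere 0 1) Z Z' \<and>
          (AE w in M. \<forall>\<gamma>. 0 < \<gamma> \<and> \<gamma> < \<alpha> / 2 \<longrightarrow> (\<lambda>\<xi>. Z' \<xi> w) \<in> besov_inf_1 \<Phi> \<gamma>)))"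
proof (intro conjI allI impI)
  show "negative_definite_on (sphere (0 :: real ^ 'n) 1) (\<lambda>\<xi> \<eta>. geodist \<xi> \<eta> powr \<alpha>)"
    using assms by (intro negative_definite_power_geodist)
  have "(0::real) < (pi / 2) powr \<alpha> / 2" by simp
  moreover have "\<forall>C\<ge>(pi / 2) powr \<alpha> / 2. positive_definite_on (sphere (0 :: real ^ 'n) 1)
       (\<lambda>\<xi> \<eta>. C - 1 / 2 * geodist \<xi> \<eta> powr \<alpha>)"
    using assms(3,4) by (intro allI impI positive_definite_power_geodist)
  ultimately show "\<exists>C\<^sub>0>0. \<forall>C\<ge>C\<^sub>0. positive_definite_on (sphere (0 :: real ^ 'n) 1)
       (\<lambda>\<xi> \<eta>. C - 1 / 2 * geodist \<xi> \<eta> powr \<alpha>)" by blast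
next
  fix C and M :: "'w measure" and Z :: "real ^ 'n \<Rightarrow> 'w \<Rightarrow> real" and \<Phi>
  assume process: "centered_gaussian_process M (sphere 0 1) Z (\<lambda>\<xi> \<eta>. C - 1 / 2 * geodist \<xi> \<eta> powr \<alpha>)"
    and \<Phi>: "smooth_cutoff \<Phi>"
  have "prob_space M" using process by (simp only: centered_gaussian_process_def)
  then interpret prob_space M .
  interpret geodesic_field M Z C \<alpha>
    by unfold_locales (use process assms in simp_all)
  have "AE w in M. \<forall>\<gamma>. 0 < \<gamma> \<and> \<gamma> < \<alpha> / 2 \<longrightarrow> (\<lambda>\<xi>. path w \<xi>) \<in> besov_inf_1 \<Phi> \<gamma>"
    using AE_besov[OF \<Phi>] by eventually_elim simp
  then show "\<exists>Z'. modification_on M (sphere 0 1) Z Z' \<and>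
          (AE w in M. \<forall>\<gamma>. 0 < \<gamma> \<and> \<gamma> < \<alpha> / 2 \<longrightarrow> (\<lambda>\<xi>. Z' \<xi> w) \<in> besov_inf_1 \<Phi> \<gamma>)"
    using path_modification by (intro exI[of _ "\<lambda>\<xi> w. path w \<xi>"] conjI)
qed


end
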